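(* Let $A \in C^{0}_{I}(X,\mathcal{C}(\mathcal{H}))$ be a partially hyperbolic cocycle with a non-trivial unstable bundle and such that $\sum n_{c,A}\,\lambda^c_A = 0$. Then, for any $\epsilon>0$, there exists a cocycle $B \in C^{0}_{I}(X,\mathcal{C}(\mathcal{H}))$ such that: (a) $B$ is partially hyperbolic; (b) $B$ is $\epsilon$-$C^0$-close to $A$; (c) $\hbar_{\mu}(B)=\hbar_{\mu}(A)$; (d) $\sum n_{c,B}\,\lambda^c_B >0$.
   Context: Setting. $\mathcal{H}$ is an infinite dimensional separable Hilbert space, $\mathcal{C}(\mathcal{H})$ is the set of compact linear operators on $\mathcal{H}$ with the uniform (operator) norm, $X$ is a compact Hausdorff space, $f:X\to X$ is a homeomorphism, and $\mu$ is an $f$-invariant ergodic Borel probability measure which is positive on non-empty open subsets of $X$. $C^0_I(X,\mathcal{C}(\mathcal{H}))$ is the set of continuous maps (cocycles) $A:X\to\mathcal{C}(\mathcal{H})$ with $\int_X\log^+\|A(x)\|\,d\mu(x)<\infty$, where $\log^+(y)=\max\{0,\log y\}$, with the $C^0$ norm $\|A\|=\sup_{x\in X}\|A(x)\|$; $\epsilon$-$C^0$-close means at $C^0$-distance at most $\epsilon$. Write $A^0(x)=id$ and $A^n(x)=A(f^{n-1}(x))\circ\cdots\circ A(f(x))\circ A(x)$. Lyapunov exponents. By Ruelle's theorem, for $\mu$-a.e. $x$ the limit $\mathcal{L}(x)=\lim_n (A^n(x)^*A^n(x))^{1/(2n)}$ exists and is a compact operator. If $e^{\lambda_1}>e^{\lambda_2}>\cdots$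 are its distinct nonzero eigenvalues, with associated eigenspaces $U_1(x),U_2(x),\dots$ of dimensions $n_1,n_2,\dots$, the numbers $\lambda_i$ are the Lyapunov exponents of $A$, with multiplicities $n_i$; they and the $n_i$ are $\mu$-a.e. constant by ergodicity. The kernel of $\mathcal{L}(x)$ corresponds to the exponent $-\infty$. The spaces $U_i(x)$ and $\ker\mathcal{L}(x)$ are the Oseledets subspaces and form the Oseledets-Ruelle decomposition. $\mathcal{O}(A)$ denotes the full-measure (hence dense) set of points where this holds. Domination. Given $\ell\in\mathbb{N}$ and $\alpha\in\,]0,1[$, a direct sum $E_1(x)\oplus E_2(x)$ on an $f$-invariant set $K$ is $\ell,\alpha$-dominated, written $E_1\succ_{\ell,\alpha}E_2$, if (I) $A(x)(E_i(x))\subset E_i(f(x))$ for all $x\in K$; (II) $\dim E_i(x)$ is constant in $x$ for $i=1,2$; (III) there is $\theta>0$ such that for every $x\in K$ and all unit vectors $u\in E_2(x)$, $v\in E_1(x)$: $\|A(x)v\|\ge\theta$ and $\|A^\ell(x)u\|\le\alpha\|A^\ell(x)v\|$. The Oseledets-Ruelle decomposition on $\mathcal{O}(A)$ is $\ell,\alpha$-dominated if its subspaces can be grouped so that it is rewritten as $E_1(x)\oplus\cdots\oplus E_k(x)=\mathcal{H}$ with constant dimensions and $E_i\succ_{\ell,\alpha}E_j$ for all $i<j$; a dominated decomposition extends continuously to a dominated splitting over the closure of $\mathcal{O}(A)$, which is $X$ (the extended Oseledets-Ruelle decomposition). Partial hyperbolicity. A cocycle $A\in C^0_I(X,\mathcal{C}(\mathcal{H}))$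 with an extended Oseledets-Ruelle decomposition is partially hyperbolic if for every $x\in X$ this splitting may be rewritten as $E^u_x\oplus E^c_x\oplus E^s_x=\mathcal{H}$ and there are $\ell\in\mathbb{N}$, $\alpha,\beta\in\,]0,1[$ such that: (1) $E^u_x$ contains only Oseledets subspaces associated to positive Lyapunov exponents; (2) $E^c_x$ contains the sum of all Oseledets subspaces associated to zero Lyapunov exponents; (3) $E^s_x$ contains only Oseledets subspaces associated to negative Lyapunov exponents and includes all those with exponent $-\infty$; (4) $E^u\succ_{\ell,\alpha}E^c$ and $E^c\succ_{\ell,\beta}E^s$. Put $E^{cu}=E^u\oplus E^c$; it is finite dimensional. The unstable bundle is non-trivial if $E^u_x\ne\{\vec 0\}$ for every $x\in X$. Notation. $\sum n_{c,A}\lambda^c_A$ is the sum of the Lyapunov exponents of $A$ associated with $E^c_A$, counted with multiplicity. The center-unstable metric entropy $\hbar_\mu(A)$ of a partially hyperbolic cocycle $A$ over $f$ is the sum of the Lyapunov exponents of $A$ associated with $E^{cu}_A$, counted with multiplicity. *)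

theory Defs
  imports "HOL-Probability.Probability"
begin

section \<open>The Hilbert space and its scalars\<close>

text \<open>
  Hilbert spaces over the reals and over the complex numbers are treated at once. The type is a
  complete real inner product space, and the operator \<open>J\<close> records the scalars: \<open>J\<close> is the identity
  for real scalars, and multiplication by the imaginary unit for complex scalars. In the complex
  case the type carries the real part of the complex inner product, which gives the same norm, and
  the complex inner product is recovered from it and \<open>J\<close>. Complex linear means commuting with \<open>J\<close>.
  For a complex linear operator the adjoint, positivity, positive roots, the eigenspaces to real
  eigenvalues and compactness are the same over the reals and over the complex numbers; dimensions
  are not, so \<open>hdim\<close> divides by the degree of the scalar field.
\<close>

definition hilbert_scalars :: "('h::real_inner \<Rightarrow>\<^sub>L 'h) \<Rightarrow> bool" where
  "hilbert_scalars J \<longleftrightarrow>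
     J = id_blinfun \<or> (J o\<^sub>L J = - id_blinfun \<and> (\<forall>u v. J u \<bullet> J v = u \<bullet> v))"

definition scalar_degree :: "('h::real_inner \<Rightarrow>\<^sub>L 'h) \<Rightarrow> nat" where
  "scalar_degree J = (if J = id_blinfun then 1 else 2)"

definition closed_subspace :: "('h::real_inner \<Rightarrow>\<^sub>L 'h) \<Rightarrow> 'h set \<Rightarrow> bool" where
  "closed_subspace J V \<longleftrightarrow> subspace V \<and> closed V \<and> (\<forall>v\<in>V. J v \<in> V)"

definition finite_dim :: "'h::real_vector set \<Rightarrow> bool" where
  "finite_dim V \<longleftrightarrow> (\<exists>S. finite S \<and> V \<subseteq> span S)"

text \<open>In a separable space all infinite dimensional closed subspaces have the same Hilbert dimension.\<close>

definition hdim :: "('h::real_inner \<Rightarrow>\<^sub>L 'h) \<Rightarrow> 'h set \<Rightarrow> enat" where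
  "hdim J V = (if finite_dim V then enat (dim V div scalar_degree J) else \<infinity>)"

definition compact_operator :: "('h::real_normed_vector \<Rightarrow>\<^sub>L 'h) \<Rightarrow> bool" where
  "compact_operator T \<longleftrightarrow> compact (closure (blinfun_apply T ` cball 0 1))"

definition positive_operator :: "('h::real_inner \<Rightarrow>\<^sub>L 'h) \<Rightarrow> bool" where
  "positive_operator T \<longleftrightarrow> (\<forall>u v. T u \<bullet> v = u \<bullet> T v) \<and> (\<forall>v. 0 \<le> T v \<bullet> v)"

definition positive_root :: "nat \<Rightarrow> ('h::real_inner \<Rightarrow>\<^sub>L 'h) \<Rightarrow> ('h \<Rightarrow>\<^sub>L 'h)" where
  "positive_root k T = (THE S. positive_operator S \<and> blinfun_apply S ^^ k = blinfun_apply T)"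

section \<open>The base dynamics and cocycles\<close>

definition ergodic_base :: "('x::topological_space \<Rightarrow> 'x) \<Rightarrow> 'x measure \<Rightarrow> bool" where
  "ergodic_base f M \<longleftrightarrow>
     sets M = sets borel \<and> prob_space M \<and> distr M M f = M \<and>
     (\<forall>S\<in>sets M. f -` S = S \<longrightarrow> measure M S = 0 \<or> measure M S = 1)"

text \<open>Since \<open>ln 0 = 0\<close>, the integrand below is 0 where \<open>A x = 0\<close>, as it should be.\<close>

definition C0I :: "('h::real_inner \<Rightarrow>\<^sub>L 'h) \<Rightarrow> 'x::topological_space measure \<Rightarrow>
    ('x \<Rightarrow> 'h \<Rightarrow>\<^sub>L 'h) set" where
  "C0I J M = {A. continuous_on UNIV A \<and>
     (\<forall>x. compact_operator (A x) \<and> A x o\<^sub>L J = J o\<^sub>L A x) \<and>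
     integrable M (\<lambda>x. max 0 (ln (norm (A x))))}"

definition C0_norm :: "('x \<Rightarrow> 'h::real_normed_vector \<Rightarrow>\<^sub>L 'h) \<Rightarrow> real" where
  "C0_norm A = (SUP x. norm (A x))"

primrec iterate :: "('x \<Rightarrow> 'x) \<Rightarrow> ('x \<Rightarrow> 'h::real_normed_vector \<Rightarrow>\<^sub>L 'h) \<Rightarrow> nat \<Rightarrow> 'x \<Rightarrow> ('h \<Rightarrow>\<^sub>L 'h)" where
  "iterate f A 0 x = id_blinfun"
| "iterate f A (Suc n) x = A ((f ^^ n) x) o\<^sub>L iterate f A n x"

section \<open>Lyapunov exponents and Oseledets subspaces\<close>

definition lyapunov_approx ::
    "('x \<Rightarrow> 'x) \<Rightarrow> ('x \<Rightarrow> 'h::real_inner \<Rightarrow>\<^sub>L 'h) \<Rightarrow> 'x \<Rightarrow> nat \<Rightarrow> ('h \<Rightarrow>\<^sub>L 'h)" where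
  "lyapunov_approx f A x n =
     positive_root (2 * n) (Blinfun (adjoint (iterate f A n x)) o\<^sub>L iterate f A n x)"

definition lyapunov_operator ::
    "('x \<Rightarrow> 'x) \<Rightarrow> ('x \<Rightarrow> 'h::real_inner \<Rightarrow>\<^sub>L 'h) \<Rightarrow> 'x \<Rightarrow> ('h \<Rightarrow>\<^sub>L 'h)" where
  "lyapunov_operator f A x = lim (lyapunov_approx f A x)"

definition ruelle_point :: "('x \<Rightarrow> 'x) \<Rightarrow> ('x \<Rightarrow> 'h::real_inner \<Rightarrow>\<^sub>L 'h) \<Rightarrow> 'x \<Rightarrow> bool" where
  "ruelle_point f A x \<longleftrightarrow>
     convergent (lyapunov_approx f A x) \<and> compact_operator (lyapunov_operator f A x)"

text \<open>The Oseledets subspace of the exponent \<open>\<kappa>\<close>; for \<open>\<kappa> = -\<infinity>\<close> it is the kernel.\<close>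

definition oseledets ::
    "('x \<Rightarrow> 'x) \<Rightarrow> ('x \<Rightarrow> 'h::real_inner \<Rightarrow>\<^sub>L 'h) \<Rightarrow> 'x \<Rightarrow> ereal \<Rightarrow> 'h set" where
  "oseledets f A x \<kappa> =
     {v. lyapunov_operator f A x v = (if \<kappa> = -\<infinity> then 0 else exp (real_of_ereal \<kappa>)) *\<^sub>R v}"

definition has_multiplicities :: "('h::real_inner \<Rightarrow>\<^sub>L 'h) \<Rightarrow> ('x \<Rightarrow> 'x) \<Rightarrow>
    ('x \<Rightarrow> 'h \<Rightarrow>\<^sub>L 'h) \<Rightarrow> (real \<Rightarrow> enat) \<Rightarrow> 'x \<Rightarrow> bool" where
  "has_multiplicities J f A m x \<longleftrightarrow>
     ruelle_point f A x \<and> (\<forall>\<kappa>. hdim J (oseledets f A x (ereal \<kappa>)) = m \<kappa>)"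

text \<open>
  The almost everywhere constant multiplicity function: \<open>multiplicity J f M A \<kappa>\<close> is nonzero if and
  only if the real number \<open>\<kappa>\<close> is a Lyapunov exponent.
\<close>

definition multiplicity :: "('h::real_inner \<Rightarrow>\<^sub>L 'h) \<Rightarrow> ('x \<Rightarrow> 'x) \<Rightarrow> 'x measure \<Rightarrow>
    ('x \<Rightarrow> 'h \<Rightarrow>\<^sub>L 'h) \<Rightarrow> real \<Rightarrow> enat" where
  "multiplicity J f M A = (THE m. AE x in M. has_multiplicities J f A m x)"

text \<open>
  The points along whose whole orbit Ruelle's theorem holds with the almost everywhere constant
  exponents and multiplicities. Taking whole orbits makes the set invariant under \<open>f\<close>.
\<close>

definition oseledets_points :: "('h::real_inner \<Rightarrow>\<^sub>L 'h) \<Rightarrow> ('x \<Rightarrow> 'x) \<Rightarrow> 'x measure \<Rightarrow>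
    ('x \<Rightarrow> 'h \<Rightarrow>\<^sub>L 'h) \<Rightarrow> 'x set" where
  "oseledets_points J f M A =
     {x. \<forall>n. has_multiplicities J f A (multiplicity J f M A) ((f ^^ n) x) \<and>
             has_multiplicities J f A (multiplicity J f M A) ((inv f ^^ n) x)}"

definition exponents :: "('h::real_inner \<Rightarrow>\<^sub>L 'h) \<Rightarrow> ('x \<Rightarrow> 'x) \<Rightarrow> 'x measure \<Rightarrow>
    ('x \<Rightarrow> 'h \<Rightarrow>\<^sub>L 'h) \<Rightarrow> real set" where
  "exponents J f M A = {\<kappa>. multiplicity J f M A \<kappa> \<noteq> 0}"

section \<open>Domination and partial hyperbolicity\<close>

text \<open>
  The lower bound \<open>\<theta>\<close> is imposed on \<open>E1\<close> also where \<open>E2 x = {0}\<close>. As the \<open>A x\<close> are compact, this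
  forces \<open>E1\<close> to be finite dimensional in every case.
\<close>

definition dominated :: "('h::real_inner \<Rightarrow>\<^sub>L 'h) \<Rightarrow> ('x \<Rightarrow> 'x) \<Rightarrow> ('x \<Rightarrow> 'h \<Rightarrow>\<^sub>L 'h) \<Rightarrow> 'x set \<Rightarrow>
    nat \<Rightarrow> real \<Rightarrow> ('x \<Rightarrow> 'h set) \<Rightarrow> ('x \<Rightarrow> 'h set) \<Rightarrow> bool" where
  "dominated J f A K l \<alpha> E1 E2 \<longleftrightarrow>
     (\<forall>x\<in>K. closed_subspace J (E1 x) \<and> closed_subspace J (E2 x) \<and> E1 x \<inter> E2 x = {0}) \<and>
     (\<forall>x\<in>K. A x ` E1 x \<subseteq> E1 (f x) \<and> A x ` E2 x \<subseteq> E2 (f x)) \<and>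
     (\<exists>d1 d2. \<forall>x\<in>K. hdim J (E1 x) = d1 \<and> hdim J (E2 x) = d2) \<and>
     (\<exists>\<theta>>0. \<forall>x\<in>K.
        (\<forall>v\<in>E1 x. norm v = 1 \<longrightarrow> \<theta> \<le> norm (A x v)) \<and>
        (\<forall>u\<in>E2 x. \<forall>v\<in>E1 x. norm u = 1 \<longrightarrow> norm v = 1 \<longrightarrow>
           norm (iterate f A l x u) \<le> \<alpha> * norm (iterate f A l x v)))"

definition bundle_sum :: "(nat \<Rightarrow> 'x \<Rightarrow> 'h::real_vector set) \<Rightarrow> nat set \<Rightarrow> 'x \<Rightarrow> 'h set" where
  "bundle_sum E I x = span (\<Union>i\<in>I. E i x)"

definition direct_decomposition :: "nat \<Rightarrow> (nat \<Rightarrow> 'h::real_vector set) \<Rightarrow> bool" where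
  "direct_decomposition k V \<longleftrightarrow>
     (\<forall>v. \<exists>!w. (\<forall>i<k. w i \<in> V i) \<and> (\<forall>i\<ge>k. w i = 0) \<and> v = (\<Sum>i<k. w i))"

text \<open>Continuity of the subspaces in \<open>x\<close>, through the projections along the splitting.\<close>

definition continuous_splitting ::
    "nat \<Rightarrow> (nat \<Rightarrow> 'x::topological_space \<Rightarrow> 'h::real_normed_vector set) \<Rightarrow> bool" where
  "continuous_splitting k E \<longleftrightarrow>
     (\<exists>P :: nat \<Rightarrow> 'x \<Rightarrow> 'h \<Rightarrow>\<^sub>L 'h. \<forall>i<k. continuous_on UNIV (P i) \<and>
        (\<forall>x v. P i x v \<in> E i x \<and> v - P i x v \<in> bundle_sum E ({..<k} - {i}) x))"

text \<open>
  \<open>E 0, \<dots>, E (k - 1)\<close> is an extended Oseledets-Ruelle decomposition: on the Oseledets points, \<open>E i\<close>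
  is the closed sum of the Oseledets subspaces whose exponents are in the group \<open>G i\<close>, and the
  splitting extends to a continuous dominated splitting over the whole space. That almost every
  point is an Oseledets point is part of the definition; it is the content of Ruelle's theorem.
\<close>

definition extended_oseledets_ruelle :: "('h::real_inner \<Rightarrow>\<^sub>L 'h) \<Rightarrow> ('x::topological_space \<Rightarrow> 'x) \<Rightarrow>
    'x measure \<Rightarrow> ('x \<Rightarrow> 'h \<Rightarrow>\<^sub>L 'h) \<Rightarrow> nat \<Rightarrow> (nat \<Rightarrow> ereal set) \<Rightarrow> (nat \<Rightarrow> 'x \<Rightarrow> 'h set) \<Rightarrow> bool" where
  "extended_oseledets_ruelle J f M A k G E \<longleftrightarrow>
     (AE x in M. x \<in> oseledets_points J f M A) \<and>
     (\<Union>i<k. G i) = insert (-\<infinity>) (ereal ` exponents J f M A) \<and>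
     disjoint_family_on G {..<k} \<and>
     (\<forall>x\<in>oseledets_points J f M A. \<forall>i<k. E i x = closure (span (\<Union>\<kappa>\<in>G i. oseledets f A x \<kappa>))) \<and>
     (\<forall>x. \<forall>i<k. closed_subspace J (E i x)) \<and>
     (\<forall>x. direct_decomposition k (\<lambda>i. E i x)) \<and>
     (\<forall>i<k. \<exists>d. \<forall>x. hdim J (E i x) = d) \<and>
     continuous_splitting k E \<and>
     (\<exists>l \<alpha>. 0 < \<alpha> \<and> \<alpha> < 1 \<and> (\<forall>i j. i < j \<longrightarrow> j < k \<longrightarrow> dominated J f A UNIV l \<alpha> (E i) (E j)))"

definition partially_hyperbolic :: "('h::real_inner \<Rightarrow>\<^sub>L 'h) \<Rightarrow> ('x::topological_space \<Rightarrow> 'x) \<Rightarrow>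
    'x measure \<Rightarrow> ('x \<Rightarrow> 'h \<Rightarrow>\<^sub>L 'h) \<Rightarrow>
    ('x \<Rightarrow> 'h set) \<Rightarrow> ('x \<Rightarrow> 'h set) \<Rightarrow> ('x \<Rightarrow> 'h set) \<Rightarrow> bool" where
  "partially_hyperbolic J f M A Eu Ec Es \<longleftrightarrow>
     (\<exists>k G E Iu Ic Is.
        extended_oseledets_ruelle J f M A k G E \<and>
        Iu \<union> Ic \<union> Is = {..<k} \<and> Iu \<inter> Ic = {} \<and> Iu \<inter> Is = {} \<and> Ic \<inter> Is = {} \<and>
        Eu = bundle_sum E Iu \<and> Ec = bundle_sum E Ic \<and> Es = bundle_sum E Is \<and>
        (\<forall>\<kappa>\<in>(\<Union>i\<in>Iu. G i). 0 < \<kappa>) \<and>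
        (0 \<in> exponents J f M A \<longrightarrow> 0 \<in> (\<Union>i\<in>Ic. G i)) \<and>
        (\<forall>\<kappa>\<in>(\<Union>i\<in>Is. G i). \<kappa> < 0) \<and> -\<infinity> \<in> (\<Union>i\<in>Is. G i) \<and>
        (\<exists>l \<alpha> \<beta>. 0 < \<alpha> \<and> \<alpha> < 1 \<and> 0 < \<beta> \<and> \<beta> < 1 \<and>
           dominated J f A UNIV l \<alpha> Eu Ec \<and> dominated J f A UNIV l \<beta> Ec Es))"

text \<open>The sum, with multiplicities, of the Lyapunov exponents associated with the bundle \<open>E\<close>.\<close>

definition exponent_sum :: "('h::real_inner \<Rightarrow>\<^sub>L 'h) \<Rightarrow> ('x \<Rightarrow> 'x) \<Rightarrow> 'x measure \<Rightarrow>
    ('x \<Rightarrow> 'h \<Rightarrow>\<^sub>L 'h) \<Rightarrow> ('x \<Rightarrow> 'h set) \<Rightarrow> real" where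
  "exponent_sum J f M A E =
     (\<Sum>\<kappa> | \<kappa> \<in> exponents J f M A \<and>
            (\<forall>x\<in>oseledets_points J f M A. oseledets f A x (ereal \<kappa>) \<subseteq> E x).
        real (the_enat (multiplicity J f M A \<kappa>)) * \<kappa>)"

definition center_unstable_entropy :: "('h::real_inner \<Rightarrow>\<^sub>L 'h) \<Rightarrow> ('x \<Rightarrow> 'x) \<Rightarrow> 'x measure \<Rightarrow>
    ('x \<Rightarrow> 'h \<Rightarrow>\<^sub>L 'h) \<Rightarrow> ('x \<Rightarrow> 'h set) \<Rightarrow> ('x \<Rightarrow> 'h set) \<Rightarrow> real" where
  "center_unstable_entropy J f M A Eu Ec = exponent_sum J f M A (\<lambda>x. span (Eu x \<union> Ec x))"

text \<open>
  A cocycle may admit several partially hyperbolic splittings: from \<open>(Eu, Ec, Es)\<close> one may pass to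
  \<open>({0}, Eu + Ec, Es)\<close>. So the center bundle of a perturbation is meaningful only as the
  continuation of the center bundle of the original cocycle, which for nearby cocycles is the one
  with the same dimensions. A zero center bundle has no nonzero continuation, and then no
  condition is imposed.
\<close>

definition continuation :: "('h::real_inner \<Rightarrow>\<^sub>L 'h) \<Rightarrow> ('x \<Rightarrow> 'h set) \<Rightarrow> ('x \<Rightarrow> 'h set) \<Rightarrow>
    ('x \<Rightarrow> 'h set) \<Rightarrow> ('x \<Rightarrow> 'h set) \<Rightarrow> bool" where
  "continuation J Eu Ec Eu' Ec' \<longleftrightarrow>
     (\<forall>x. Ec x = {0}) \<or> (\<forall>x. hdim J (Eu' x) = hdim J (Eu x) \<and> hdim J (Ec' x) = hdim J (Ec x))"

end

theory Submission
  imports Defs "HOL-Computational_Algebra.Formal_Power_Series"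
begin

text \<open>
  On Oseledets points the bundles of a dominated splitting are closed sums of eigenspaces of the
  positive operator \<open>lim ((A\<^sup>n)* A\<^sup>n)\<^sup>1\<^sup>/\<^sup>2\<^sup>n\<close>, hence mutually orthogonal; Oseledets points are dense, so by
  continuity the splitting is orthogonal everywhere. If the center bundle is not zero, put
  \<open>D x = e\<^sup>a P\<^sup>u + e\<^sup>b P\<^sup>c + P\<^sup>s\<close> with the orthogonal projections onto the three bundles and
  \<open>B x = A x D x\<close>. Then \<open>(B\<^sup>n)* B\<^sup>n = (A\<^sup>n)* A\<^sup>n D\<^sup>2\<^sup>n\<close> with commuting factors, so the Lyapunov operator
  is multiplied by \<open>D\<close>: the unstable exponents are shifted by \<open>a\<close>, the center ones by \<open>b\<close>. Small
  \<open>a \<le> 0 \<le> b\<close> with \<open>a dim E\<^sup>u + b dim E\<^sup>c = 0\<close> keep the domination and the entropy and make the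
  center sum positive. If the center bundle is zero, \<open>A\<close> itself works once its unstable bundle is
  regarded as the center.
\<close>

text \<open>Three points shape the details. The Lyapunov operator is a limit of
  \<open>2 * n\<close>-th roots given by a definite description, so existence and uniqueness of
  positive roots come first. The binomial series yields a root that commutes with everything
  commuting with the operator, and against such a root uniqueness is elementary. Domination then
  reaches the limit by comparing Rayleigh quotients of the roots with norms of iterates.

  Second, the bundles are described at every Oseledets point of the cocycle at hand, so the
  perturbed cocycle must have exactly the same Oseledets points as the original, not the same up to
  a null set. Hence its multiplicities at a point must tell which exponent belongs to which bundle;
  domination and the dimensions of the bundles decide this.

  Third, the projections depend on the point only strongly continuously. Equivariance rewrites
  \<open>A x D x\<close> as \<open>D (f x) A x\<close>, where compactness of \<open>A x\<close>
  gives continuity in norm. With a zero center bundle, the unstable and the stable bundle are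
  related only through the groups of Oseledets subspaces, and their domination has to be
  assembled.\<close>

section \<open>Adjoints in a Hilbert space\<close>

text \<open>The representing vector is the minimiser of \<open>v \<mapsto> \<parallel>v\<parallel>\<^sup>2 - 2 \<phi> v\<close>; minimising sequences are Cauchy
  by the parallelogram law.\<close>

lemma riesz_representation:
  fixes \<phi> :: "'h::{real_inner, banach} \<Rightarrow> real"
  assumes "bounded_linear \<phi>"
  shows "\<exists>w. \<forall>v. \<phi> v = w \<bullet> v"
proof -
  interpret \<phi>: bounded_linear \<phi> by fact
  define q where "q v = (norm v)\<^sup>2 - 2 * \<phi> v" for v
  define m where "m = (INF v. q v)"
  have low: "q v \<ge> - (onorm \<phi>)\<^sup>2" for v
  proof -
    have "\<phi> v \<le> onorm \<phi> * norm v"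
      using onorm[OF assms, of v] by (simp add: abs_le_iff)
    moreover have "0 \<le> (norm v - onorm \<phi>)\<^sup>2" by simp
    ultimately show ?thesis
      by (simp add: q_def power2_diff algebra_simps)
  qed
  then have bdd: "bdd_below (range q)" by (auto simp: bdd_below_def)
  have m_le: "m \<le> q v" for v unfolding m_def by (rule cINF_lower[OF bdd]) simp
  have "\<exists>v. q v < m + 1 / real (Suc n)" for n
    using cINF_less_iff[OF _ bdd, of "m + 1 / real (Suc n)"] by (auto simp: m_def)
  then obtain u where u: "\<And>n. q (u n) < m + 1 / real (Suc n)" by metis
  have par: "(norm (v - w))\<^sup>2 \<le> 2 * (q v - m) + 2 * (q w - m)" for v w
  proof -
    have "m \<le> q ((1/2) *\<^sub>R (v + w))" by (rule m_le)
    also have "\<dots> = (q v + q w) / 2 - (norm (v - w))\<^sup>2 / 4"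
      by (simp add: q_def power2_norm_eq_inner inner_simps \<phi>.scaleR \<phi>.add field_simps inner_commute)
    finally show ?thesis by argo
  qed
  have "Cauchy u"
  proof (rule metric_CauchyI)
    fix e :: real assume "0 < e"
    then obtain N where N: "4 / e\<^sup>2 < real N" using reals_Archimedean2 by blast
    moreover have "4 / e\<^sup>2 > 0" using \<open>0 < e\<close> by simp
    ultimately have N0: "real N > 0" by linarith
    show "\<exists>N. \<forall>i\<ge>N. \<forall>j\<ge>N. dist (u i) (u j) < e"
    proof (intro exI allI impI)
      fix i j assume ij: "i \<ge> N" "j \<ge> N"
      have "1 / real (Suc i) \<le> 1 / real N" "1 / real (Suc j) \<le> 1 / real N"
        using ij N0 by (auto intro!: divide_left_mono)
      then have "q (u i) - m < 1 / real N" "q (u j) - m < 1 / real N"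
        using u[of i] u[of j] by (simp_all del: of_nat_Suc)
      then have "(norm (u i - u j))\<^sup>2 < 4 * (1 / real N)"
        using par[of "u i" "u j"] by argo
      also have "\<dots> < e\<^sup>2" using N N0 \<open>0 < e\<close> by (simp add: field_simps)
      finally show "dist (u i) (u j) < e"
        using \<open>0<e\<close> by (simp add: dist_norm power2_less_imp_less)
    qed
  qed
  then obtain w where w: "u \<longlonglongrightarrow> w" using Cauchy_convergent convergent_def by blast
  have "(\<lambda>n. q (u n)) \<longlonglongrightarrow> q w"
    unfolding q_def by (intro tendsto_intros w \<phi>.tendsto)
  moreover have "(\<lambda>n. q (u n)) \<longlonglongrightarrow> m"
  proof (rule tendsto_sandwich[OF _ _ tendsto_const])
    show "\<forall>\<^sub>F n in sequentially. m \<le> q (u n)" using m_le by simp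
    show "\<forall>\<^sub>F n in sequentially. q (u n) \<le> m + inverse (real (Suc n))"
      using u by (auto simp: inverse_eq_divide intro!: always_eventually less_imp_le)
    show "(\<lambda>n. m + inverse (real (Suc n))) \<longlonglongrightarrow> m"
      using tendsto_add[OF tendsto_const LIMSEQ_inverse_real_of_nat] by simp
  qed
  ultimately have qw: "q w = m" by (rule LIMSEQ_unique)
  have "\<phi> v = w \<bullet> v" for v
  proof (cases "v = 0")
    case False
    define d where "d = w \<bullet> v - \<phi> v"
    \<comment> \<open>The minimiser of \<open>q\<close> along the line through \<open>w\<close> in
      direction \<open>v\<close>.\<close>
    define t where "t = - d / (v \<bullet> v)"
    have vv: "v \<bullet> v > 0" using False by simp
    have "q w \<le> q (w + t *\<^sub>R v)" using m_le qw by simp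
    also have "\<dots> = q w + 2 * t * d + t\<^sup>2 * (v \<bullet> v)"
      unfolding q_def d_def power2_norm_eq_inner
      by (simp add: inner_simps \<phi>.scaleR \<phi>.add power2_eq_square algebra_simps inner_commute)
    also have "2 * t * d + t\<^sup>2 * (v \<bullet> v) = - d\<^sup>2 / (v \<bullet> v)"
      using vv by (simp add: t_def power2_eq_square field_simps)
    then have "q w + 2 * t * d + t\<^sup>2 * (v \<bullet> v) = q w - d\<^sup>2 / (v \<bullet> v)" by simp
    finally have "d\<^sup>2 / (v \<bullet> v) \<le> 0" by simp
    then have "d = 0" using vv by (simp add: divide_le_0_iff)
    then show ?thesis by (simp add: d_def)
  qed (simp add: \<phi>.zero)
  then show ?thesis by blast
qed

text \<open>\<open>adjoint\<close> is a choice and \<open>Blinfun\<close> inverts an embedding, so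
  both say nothing before a bounded adjoint is known to exist. Riesz gives its values; testing with
  \<open>g x\<close> itself gives the bound.\<close>

lemma adjoint_blinfun:
  fixes C :: "'h::{real_inner, banach} \<Rightarrow>\<^sub>L 'h"
  shows "Blinfun (adjoint C) u \<bullet> v = u \<bullet> C v"
proof -
  have "\<exists>w. \<forall>v. u \<bullet> C v = w \<bullet> v" for u
    by (rule riesz_representation)
      (intro bounded_linear_intros)
  then obtain g where g: "\<And>u v. u \<bullet> C v = g u \<bullet> v" by metis
  have adj: "adjoint C = g"
    by (rule adjoint_unique) (metis g inner_commute)
  have "bounded_linear g"
  proof
    show "g (a + b) = g a + g b" for a b
      by (rule vector_eq_rdot[THEN iffD1]) (metis g inner_add_left)
    show "g (r *\<^sub>R a) = r *\<^sub>R g a" for r a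
      by (rule vector_eq_rdot[THEN iffD1]) (metis g inner_scaleR_left)
    have "norm (g x) \<le> norm x * norm C" for x
    proof (cases "g x = 0")
      case False
      have "norm (g x) * norm (g x) = x \<bullet> C (g x)"
        using g[of x "g x"] by (simp add: dot_square_norm power2_eq_square)
      also have "\<dots> \<le> norm x * (norm C * norm (g x))"
        by (meson norm_blinfun norm_cauchy_schwarz order_trans mult_left_mono norm_ge_zero)
      finally show ?thesis using False by (simp add: mult.assoc[symmetric])
    qed simp
    then show "\<exists>K. \<forall>x. norm (g x) \<le> norm x * K" by blast
  qed
  then show ?thesis by (simp add: adj bounded_linear_Blinfun_apply g)
qed

definition gram :: "('h::{real_inner, banach} \<Rightarrow>\<^sub>L 'h) \<Rightarrow> 'h \<Rightarrow>\<^sub>L 'h" where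
  "gram C = Blinfun (adjoint C) o\<^sub>L C"

lemma gram_inner: "gram C u \<bullet> v = C u \<bullet> C v"
  by (simp add: gram_def adjoint_blinfun)

lemma positive_operatorD:
  assumes "positive_operator S"
  shows "S u \<bullet> v = u \<bullet> S v" and "0 \<le> S v \<bullet> v"
  using assms by (auto simp: positive_operator_def)

lemma positive_gram: "positive_operator (gram C)"
  unfolding positive_operator_def by (metis gram_inner inner_commute inner_ge_zero)

section \<open>Positive roots\<close>

primrec bpow :: "('h::real_normed_vector \<Rightarrow>\<^sub>L 'h) \<Rightarrow> nat \<Rightarrow> 'h \<Rightarrow>\<^sub>L 'h" where
  "bpow U 0 = id_blinfun"
| "bpow U (Suc n) = U o\<^sub>L bpow U n"

text \<open>\<open>bpow\<close> is \<open>funpow\<close> lifted to the space of operators, where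
  series can converge in norm; this translates back to the powers that occur in
  \<open>positive_root\<close>.\<close>

lemma bpow_apply: "bpow U n v = (blinfun_apply U ^^ n) v"
  by (induction n) auto

lemma bpow_add: "bpow U (m + n) = bpow U m o\<^sub>L bpow U n"
  by (rule blinfun_eqI) (subst bpow_apply, simp add: bpow_apply funpow_add)

lemma norm_bpow_le: "norm U \<le> 1 \<Longrightarrow> norm (bpow U n) \<le> 1"
proof (induction n)
  case 0 show ?case using norm_blinfun_id_le by simp
next
  case (Suc n)
  have "norm (bpow U (Suc n)) \<le> norm U * norm (bpow U n)"
    using norm_blinfun_compose[of U "bpow U n"] by simp
  also have "\<dots> \<le> 1 * 1" using Suc by (intro mult_mono) auto
  finally show ?case by simp
qed

lemma bpow_commute: "R o\<^sub>L U = U o\<^sub>L R \<Longrightarrow> R o\<^sub>L bpow U n = bpow U n o\<^sub>L R"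
proof (induction n)
  case (Suc n)
  have "R (U v) = U (R v)" "R (bpow U n v) = bpow U n (R v)" for v
    using Suc by (metis blinfun_apply_blinfun_compose)+
  then show ?case by (intro blinfun_eqI) simp
qed (auto intro: blinfun_eqI)

interpretation blinfun_compose: bounded_bilinear "(o\<^sub>L)"
  by (rule bounded_bilinear_blinfun_compose)

definition bseries :: "(nat \<Rightarrow> real) \<Rightarrow> ('h::{real_inner,banach} \<Rightarrow>\<^sub>L 'h) \<Rightarrow> 'h \<Rightarrow>\<^sub>L 'h" where
  "bseries c U = (\<Sum>n. c n *\<^sub>R bpow U n)"

lemma bseries_summable:
  assumes "summable (\<lambda>n. \<bar>c n\<bar>)" "norm U \<le> 1"
  shows "summable (\<lambda>n. norm (c n *\<^sub>R bpow U n))"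
proof (rule summable_comparison_test'[OF assms(1)])
  show "norm (norm (c n *\<^sub>R bpow U n)) \<le> \<bar>c n\<bar>" for n
    using norm_bpow_le[OF assms(2), of n] by (simp add: mult_left_le)
qed

lemma bseries_sums:
  assumes "summable (\<lambda>n. \<bar>c n\<bar>)" "norm U \<le> 1"
  shows "(\<lambda>n. c n *\<^sub>R bpow U n) sums bseries c U"
  unfolding bseries_def
  by (rule summable_sums, rule summable_norm_cancel, rule bseries_summable[OF assms])

lemma bseries_has_sum:
  assumes "summable (\<lambda>n. \<bar>c n\<bar>)" "norm U \<le> 1"
  shows "((\<lambda>n. c n *\<^sub>R bpow U n) has_sum bseries c U) UNIV"
  using norm_summable_imp_has_sum[OF bseries_summable[OF assms] bseries_sums[OF assms]] .

lemma summable_abs_Cauchy: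
  fixes c d :: "nat \<Rightarrow> real"
  assumes c: "summable (\<lambda>n. \<bar>c n\<bar>)" and d: "summable (\<lambda>n. \<bar>d n\<bar>)"
  shows "summable (\<lambda>n. \<bar>\<Sum>i\<le>n. c i * d (n - i)\<bar>)"
proof (rule summable_comparison_test')
  show "summable (\<lambda>n. \<Sum>i\<le>n. \<bar>c i\<bar> * \<bar>d (n - i)\<bar>)"
    using Cauchy_product_sums[of "\<lambda>n. \<bar>c n\<bar>" "\<lambda>n. \<bar>d n\<bar>"] c d by (simp add: sums_iff)
  show "norm \<bar>\<Sum>i\<le>n. c i * d (n - i)\<bar> \<le> (\<Sum>i\<le>n. \<bar>c i\<bar> * \<bar>d (n - i)\<bar>)" for n
    using sum_abs[of "\<lambda>i. c i * d (n - i)" "{..n}"] by (simp add: abs_mult)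
qed

text \<open>Absolute summability allows summing the doubly indexed family of products in two orders:
  by rows it gives the composition of the two series, along the antidiagonals the Cauchy
  coefficients.\<close>

lemma bseries_mult:
  fixes U :: "'h::{real_inner,banach} \<Rightarrow>\<^sub>L 'h"
  assumes c: "summable (\<lambda>n. \<bar>c n\<bar>)" and d: "summable (\<lambda>n. \<bar>d n\<bar>)" and U: "norm U \<le> 1"
  shows "bseries (\<lambda>n. \<Sum>i\<le>n. c i * d (n - i)) U = bseries c U o\<^sub>L bseries d U"
proof -
  define G where "G = (\<lambda>(j, i). (d j * c i) *\<^sub>R bpow U (i + j))"
  have "(\<lambda>j. \<bar>d j\<bar>) summable_on UNIV" "(\<lambda>j. \<bar>c j\<bar>) summable_on UNIV"
    using c d by (auto intro!: norm_summable_imp_summable_on)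
  then have "(\<lambda>(j, i). \<bar>d j\<bar> * \<bar>c i\<bar>) summable_on UNIV \<times> UNIV"
    by (intro summable_on_SigmaI[where g = "\<lambda>j. \<bar>d j\<bar> * (\<Sum>\<^sub>\<infinity>i. \<bar>c i\<bar>)"])
      (auto intro!: has_sum_cmult_right summable_on_cmult_left)
  then have "(\<lambda>p. norm (G p)) summable_on UNIV \<times> UNIV"
  proof (rule summable_on_comparison_test)
    fix p :: "nat \<times> nat"
    obtain j i where p: "p = (j, i)" by fastforce
    have "norm (bpow U (i + j)) \<le> 1" by (rule norm_bpow_le[OF U])
    then show "norm (G p) \<le> (case p of (j, i) \<Rightarrow> \<bar>d j\<bar> * \<bar>c i\<bar>)"
      by (simp add: p G_def abs_mult mult_left_le)
  qed auto
  then have "G summable_on UNIV \<times> UNIV" by (rule abs_summable_summable)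
  then obtain s where s: "(G has_sum s) (UNIV \<times> UNIV)" by (auto simp: summable_on_def)
  have inner: "((\<lambda>i. G (j, i)) has_sum (d j *\<^sub>R (bseries c U o\<^sub>L bpow U j))) UNIV" for j
  proof -
    have "((\<lambda>i. d j *\<^sub>R ((c i *\<^sub>R bpow U i) o\<^sub>L bpow U j)) has_sum (d j *\<^sub>R (bseries c U o\<^sub>L bpow U j))) UNIV"
      by (rule has_sum_bounded_linear[OF _ bseries_has_sum[OF c U],
            where h = "\<lambda>x. d j *\<^sub>R (x o\<^sub>L bpow U j)", unfolded o_def])
        (intro bounded_linear_intros bounded_linear_scaleR_right
          bounded_linear_compose[OF bounded_linear_scaleR_right]
          blinfun_compose.bounded_linear_left)
    then show ?thesis
      by (rule has_sum_cong[THEN iffD1, rotated])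
        (auto simp: G_def bpow_add blinfun_compose.scaleR_left)
  qed
  have "((\<lambda>j. d j *\<^sub>R (bseries c U o\<^sub>L bpow U j)) has_sum s) UNIV"
    using has_sum_SigmaD[OF s[unfolded UNIV_Times_UNIV[symmetric]], of "\<lambda>j. d j *\<^sub>R (bseries c U o\<^sub>L bpow U j)"] inner
    by auto
  moreover have "((\<lambda>j. bseries c U o\<^sub>L (d j *\<^sub>R bpow U j)) has_sum (bseries c U o\<^sub>L bseries d U)) UNIV"
    by (rule has_sum_bounded_linear[OF _ bseries_has_sum[OF d U], unfolded o_def])
      (rule blinfun_compose.bounded_linear_right)
  ultimately have seq: "s = bseries c U o\<^sub>L bseries d U"
    by (simp add: blinfun_compose.scaleR_right has_sum_unique)
  let ?S = "SIGMA n:(UNIV::nat set). {..n}"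
  have "((\<lambda>(n, i). G (n - i, i)) has_sum s) ?S"
    using s
    by (subst has_sum_reindex_bij_witness[where T = "UNIV \<times> UNIV" and h = G
          and j = "\<lambda>(n, i). (n - i, i)" and i = "\<lambda>(j, i). (i + j, i)" and s' = s]) auto
  then have "((\<lambda>n. \<Sum>i\<le>n. G (n - i, i)) has_sum s) UNIV"
    by (rule has_sum_SigmaD) (auto intro!: has_sum_finite_iff[THEN iffD2])
  moreover have "(\<Sum>i\<le>n. G (n - i, i)) = (\<Sum>i\<le>n. c i * d (n - i)) *\<^sub>R bpow U n" for n
    by (simp add: G_def scaleR_sum_left mult.commute)
  ultimately have "((\<lambda>n. (\<Sum>i\<le>n. c i * d (n - i)) *\<^sub>R bpow U n) has_sum s) UNIV" by simp
  then have "(\<lambda>n. (\<Sum>i\<le>n. c i * d (n - i)) *\<^sub>R bpow U n) sums s" by (rule has_sum_imp_sums)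
  then show ?thesis
    using bseries_sums[OF summable_abs_Cauchy[OF c d] U] seq sums_unique2 by blast
qed

text \<open>Turns an identity between formal power series, such as
  \<open>fps_binomial (1 / k) ^ k = 1 + fps_X\<close>, into an identity between operators.\<close>

lemma bseries_fps_power:
  fixes U :: "'h::{real_inner,banach} \<Rightarrow>\<^sub>L 'h" and F :: "real fps"
  assumes F: "summable (\<lambda>n. \<bar>fps_nth F n\<bar>)" and U: "norm U \<le> 1"
  shows "summable (\<lambda>n. \<bar>fps_nth (F ^ k) n\<bar>) \<and> bseries (\<lambda>n. fps_nth (F ^ k) n) U = bpow (bseries (\<lambda>n. fps_nth F n) U) k"
proof (induction k)
  case 0
  have s: "(\<lambda>n. fps_nth (1 :: real fps) n *\<^sub>R bpow U n) sums (id_blinfun)"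
    using sums_finite[of "{0}" "\<lambda>n. fps_nth (1 :: real fps) n *\<^sub>R bpow U n"] by auto
  have "summable (\<lambda>n. \<bar>fps_nth (1 :: real fps) n\<bar>)"
    by (rule summable_finite[of "{0}"]) auto
  then show ?case using s by (auto simp: bseries_def sums_iff)
next
  case (Suc k)
  then show ?case
    using bseries_mult[OF F _ U, of "\<lambda>n. fps_nth (F ^ k) n"] summable_abs_Cauchy[OF F, of "\<lambda>n. fps_nth (F ^ k) n"]
    by (simp add: fps_mult_nth atMost_atLeast0)
qed

text \<open>Apart from the constant one, the coefficients of (1 - z)^a are nonpositive, and their
  partial sums at z = 1 are products of nonnegative factors over a factorial. So the later
  coefficients have total absolute value at most 1, the constant coefficient. This gives convergence
  on the closed unit ball and, later, positivity of the root.\<close>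

lemma binomial_coeffs:
  fixes a :: real
  assumes a: "0 < a" "a \<le> 1"
  shows "n > 0 \<Longrightarrow> (a gchoose n) * (-1) ^ n \<le> 0"
    and "summable (\<lambda>n. \<bar>a gchoose n\<bar>)"
    and "(\<Sum>n. \<bar>a gchoose Suc n\<bar>) \<le> 1"
proof -
  have neg: "(a gchoose n) * (-1) ^ n \<le> 0" if "n > 0" for n
  proof -
    obtain m where m: "n = Suc m" using \<open>n > 0\<close> gr0_implies_Suc by blast
    have "(a gchoose n) * (-1) ^ n = ((-1) ^ n * (-1) ^ n) * (real n - a - 1 gchoose n)"
      by (subst gbinomial_negated_upper) (simp only: mult_ac)
    also have "\<dots> = (real n - a - 1) gchoose n"
      by (simp only: minus_one_mult_self mult_1_left)
    also have "\<dots> = (\<Prod>i = 0..<n. real n - a - 1 - real i) / fact n"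
      by (simp add: gbinomial_prod_rev)
    \<comment> \<open>Only the last factor, at index \<open>m\<close>, is negative; the others are
      at least \<open>1 - a\<close>.\<close>
    also have "(\<Prod>i = 0..<n. real n - a - 1 - real i) = (\<Prod>i = 0..<m. real n - a - 1 - real i) * (- a)"
      by (simp add: m)
    also have "\<dots> / fact n \<le> 0"
      using a by (intro divide_nonpos_pos mult_nonneg_nonpos prod_nonneg) (auto simp: m)
    finally show ?thesis .
  qed
  then show "n > 0 \<Longrightarrow> (a gchoose n) * (-1) ^ n \<le> 0" .
  have abs: "\<bar>a gchoose n\<bar> = - ((a gchoose n) * (-1) ^ n)" if "n > 0" for n
  proof -
    have "\<bar>a gchoose n\<bar> = \<bar>(a gchoose n) * (-1) ^ n\<bar>" by (simp add: abs_mult power_abs)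
    then show ?thesis using neg[OF that] by linarith
  qed
  have bound: "(\<Sum>n<N. \<bar>a gchoose Suc n\<bar>) \<le> 1" for N
  proof -
    have "(\<Sum>n\<le>N. (a gchoose n) * (-1) ^ n) = (-1) ^ N * (a - 1 gchoose N)"
      by (rule gbinomial_sum_lower_neg)
    also have "\<dots> = (real N - a gchoose N)"
    proof -
      have "(a - 1 gchoose N) = (-1) ^ N * (real N - (a - 1) - 1 gchoose N)"
        by (rule gbinomial_negated_upper)
      then have "(-1) ^ N * (a - 1 gchoose N) = ((-1) ^ N * (-1) ^ N) * (real N - (a - 1) - 1 gchoose N)"
        by (simp only: mult.assoc)
      then show ?thesis by (simp only: minus_one_mult_self mult_1_left) simp
    qed
    also have "\<dots> = (\<Prod>i = 0..<N. real N - a - real i) / fact N"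
      by (simp add: gbinomial_prod_rev)
    also have "\<dots> \<ge> 0" using a by (intro divide_nonneg_pos prod_nonneg) auto
    finally have "0 \<le> (\<Sum>n\<le>N. (a gchoose n) * (-1) ^ n)" .
    also have "\<dots> = 1 + (\<Sum>n<N. (a gchoose Suc n) * (-1) ^ Suc n)"
      by (subst sum.atMost_shift) simp
    also have "(\<Sum>n<N. (a gchoose Suc n) * (-1) ^ Suc n) = - (\<Sum>n<N. \<bar>a gchoose Suc n\<bar>)"
      by (simp only: sum_negf[symmetric] abs[OF zero_less_Suc] minus_minus)
    finally show ?thesis by simp
  qed
  have s: "summable (\<lambda>n. \<bar>a gchoose Suc n\<bar>)"
    by (rule summableI_nonneg_bounded[OF _ bound]) simp
  then show "summable (\<lambda>n. \<bar>a gchoose n\<bar>)" by (subst summable_Suc_iff[symmetric])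
  show "(\<Sum>n. \<bar>a gchoose Suc n\<bar>) \<le> 1"
    by (rule suminf_le_const[OF s bound])
qed

section \<open>Existence of positive roots\<close>

text \<open>The Cauchy-Schwarz inequality for the semidefinite form of \<open>Q\<close>, applied to
  \<open>v\<close> and \<open>Q v\<close>, with \<open>C\<close> bounding the form at
  \<open>Q v\<close>. Working on an invariant subspace makes it usable on single bundles.\<close>

lemma positive_form_bound:
  fixes Q :: "'h::real_inner \<Rightarrow>\<^sub>L 'h"
  assumes V: "subspace V" and inv: "\<And>v. v \<in> V \<Longrightarrow> Q v \<in> V"
    and sym: "\<And>u v. u \<in> V \<Longrightarrow> v \<in> V \<Longrightarrow> Q u \<bullet> v = u \<bullet> Q v"
    and pos: "\<And>v. v \<in> V \<Longrightarrow> 0 \<le> Q v \<bullet> v"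
    and le: "\<And>v. v \<in> V \<Longrightarrow> Q v \<bullet> v \<le> C * (v \<bullet> v)" and v: "v \<in> V"
  shows "(norm (Q v))\<^sup>2 \<le> C * (Q v \<bullet> v)"
proof -
  have quad: "0 \<le> Q v \<bullet> v + 2 * t * (Q v \<bullet> Q v) + t\<^sup>2 * (Q (Q v) \<bullet> Q v)" for t
  proof -
    have w: "v + t *\<^sub>R Q v \<in> V" using V v inv by (simp add: subspace_add subspace_scale)
    have "Q (v + t *\<^sub>R Q v) \<bullet> (v + t *\<^sub>R Q v)
        = Q v \<bullet> v + 2 * t * (Q v \<bullet> Q v) + t\<^sup>2 * (Q (Q v) \<bullet> Q v)"
      using sym[OF inv[OF v] v]
      by (simp add: blinfun.add_right blinfun.scaleR_right inner_simps power2_eq_square algebra_simps inner_commute)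
    then show ?thesis using pos[OF w] by simp
  qed
  define n2 where "n2 = Q v \<bullet> Q v"
  have QQ: "Q (Q v) \<bullet> Q v \<le> C * n2" "0 \<le> Q (Q v) \<bullet> Q v" using le[OF inv[OF v]] pos[OF inv[OF v]] by (auto simp: n2_def)
  have n2: "n2 \<ge> 0" by (simp add: n2_def)
  have "n2 \<le> C * (Q v \<bullet> v)"
  proof (cases "n2 = 0")
    case True
    show ?thesis
    proof (cases "C \<ge> 0")
      case True then show ?thesis using \<open>n2 = 0\<close> pos[OF v] by simp
    next
      case False
      have "C * (v \<bullet> v) \<le> 0" using False by (simp add: mult_nonpos_nonneg)
      then have "Q v \<bullet> v = 0" using le[OF v] pos[OF v] by linarith
      then show ?thesis using \<open>n2 = 0\<close> by simp
    qed
  next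
    case False
    then have n2p: "n2 > 0" using n2 by simp
    then have C: "C \<ge> 0" using QQ by (meson mult_neg_pos not_le order_trans)
    show ?thesis
    proof (cases "C = 0")
      case True
      \<comment> \<open>For \<open>C = 0\<close> the quadratic term disappears, and a linear
        function of \<open>t\<close> with positive slope cannot stay nonnegative.\<close>
      have "0 \<le> Q v \<bullet> v + 2 * t * n2" for t using quad[of t] QQ True by (simp add: n2_def)
      from this[of "- (Q v \<bullet> v + 1) / (2 * n2)"] show ?thesis using n2p by (simp add: field_simps)
    next
      case False
      then have C: "C > 0" using C by simp
      \<comment> \<open>The value of \<open>t\<close> that minimises the quadratic once its leading
        coefficient is replaced by the bound \<open>C * n2\<close>.\<close>
      have "0 \<le> Q v \<bullet> v + 2 * (-1/C) * n2 + (-1/C)\<^sup>2 * (Q (Q v) \<bullet> Q v)"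
        using quad[of "-1/C"] by (simp add: n2_def)
      also have "\<dots> \<le> Q v \<bullet> v + 2 * (-1/C) * n2 + (-1/C)\<^sup>2 * (C * n2)"
        using QQ(1) by (intro add_left_mono mult_left_mono) auto
      also have "\<dots> = Q v \<bullet> v - n2 / C" using C by (simp add: power2_eq_square field_simps)
      finally show ?thesis using C by (simp add: field_simps)
    qed
  qed
  then show ?thesis by (simp add: n2_def power2_norm_eq_inner)
qed

text \<open>The root is the binomial series of (1 + U)^(1/k). It is positive because the form of
  each power of \<open>U\<close> is bounded by the squared norm and the coefficients after the first
  add up to at most 1 in absolute value. Being a limit of polynomials in \<open>U\<close>, it
  commutes with whatever commutes with \<open>U\<close>.\<close>

lemma positive_root_exists_contraction:
  fixes U :: "'h::{real_inner,banach} \<Rightarrow>\<^sub>L 'h"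
  assumes sym: "\<And>u v. U u \<bullet> v = u \<bullet> U v" and U: "norm U \<le> 1" and k: "k > 0"
  shows "\<exists>S. positive_operator S \<and> bpow S k = id_blinfun + U \<and>
    (\<forall>R. R o\<^sub>L U = U o\<^sub>L R \<longrightarrow> R o\<^sub>L S = S o\<^sub>L R)"
proof -
  define a where "a = 1 / real k"
  have a: "0 < a" "a \<le> 1" using k by (auto simp: a_def)
  define c where "c = (\<lambda>n. a gchoose n)"
  have c: "summable (\<lambda>n. \<bar>c n\<bar>)" unfolding c_def by (rule binomial_coeffs(2)[OF a])
  define S where "S = bseries c U"
  have ser: "(\<lambda>n. c n *\<^sub>R bpow U n) sums S" unfolding S_def by (rule bseries_sums[OF c U])
  have app: "(\<lambda>n. c n *\<^sub>R bpow U n v) sums S v" for v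
    using bounded_linear.sums[OF blinfun.bounded_linear_left ser, of v] by (simp add: blinfun.scaleR_left)
  have fps: "fps_binomial a ^ k = (1 + fps_X :: real fps)"
    using k by (simp add: fps_binomial_power a_def fps_binomial_1)
  have "bpow S k = bseries (\<lambda>n. fps_nth (1 + fps_X :: real fps) n) U"
    using bseries_fps_power[of "fps_binomial a" U k] c U by (simp add: fps S_def c_def)
  also have "\<dots> = id_blinfun + U"
  proof -
    have eq: "id_blinfun + U = (\<Sum>n\<in>{0,1}. fps_nth (1 + fps_X :: real fps) n *\<^sub>R bpow U n)"
      by (rule blinfun_eqI) (simp add: blinfun.add_left)
    have "(\<lambda>n. fps_nth (1 + fps_X :: real fps) n *\<^sub>R bpow U n) sums (id_blinfun + U)"
      unfolding eq by (rule sums_finite) auto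
    then show ?thesis by (simp add: bseries_def sums_iff)
  qed
  finally have pow: "bpow S k = id_blinfun + U" .
  have symn: "bpow U n u \<bullet> v = u \<bullet> bpow U n v" for n u v
  proof (induction n arbitrary: u v)
    case (Suc n)
    have "bpow U (Suc n) u \<bullet> v = bpow U n u \<bullet> U v" by (simp add: sym)
    also have "\<dots> = u \<bullet> bpow U n (U v)" by (rule Suc)
    also have "bpow U n (U v) = bpow U (Suc n) v" unfolding bpow_apply funpow_Suc_right o_apply ..
    finally show ?case .
  qed simp
  have inn: "(\<lambda>n. c n * (bpow U n u \<bullet> v)) sums (S u \<bullet> v)" for u v
    using bounded_linear.sums[OF bounded_linear_inner_left app, of u v] by (simp add: inner_simps)
  have S_sym: "S u \<bullet> v = u \<bullet> S v" for u v
  proof -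
    have "bpow U n v \<bullet> u = bpow U n u \<bullet> v" for n
      by (subst symn) (rule inner_commute)
    then have "(\<lambda>n. c n * (bpow U n u \<bullet> v)) sums (S v \<bullet> u)"
      using inn[of v u] by (simp only:)
    then have "S u \<bullet> v = S v \<bullet> u" by (rule sums_unique2[OF inn])
    then show ?thesis by (metis inner_commute)
  qed
  have S_pos: "0 \<le> S v \<bullet> v" for v
  proof -
    have sh: "(\<lambda>n. c (Suc n) * (bpow U (Suc n) v \<bullet> v)) sums (S v \<bullet> v - v \<bullet> v)"
    proof (subst sums_Suc_iff[of "\<lambda>n. c n * (bpow U n v \<bullet> v)"])
      have "S v \<bullet> v - v \<bullet> v + c 0 * (bpow U 0 v \<bullet> v) = S v \<bullet> v" by (simp add: c_def)
      then show "(\<lambda>n. c n * (bpow U n v \<bullet> v)) sums (S v \<bullet> v - v \<bullet> v + c 0 * (bpow U 0 v \<bullet> v))"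
        using inn[of v v] by (simp only:)
    qed
    have sc: "summable (\<lambda>n. \<bar>c (Suc n)\<bar>)" using c by (subst summable_Suc_iff)
    have lhs: "(\<lambda>n. - \<bar>c (Suc n)\<bar> * (v \<bullet> v)) sums (- (\<Sum>n. \<bar>c (Suc n)\<bar>) * (v \<bullet> v))"
      by (intro sums_mult2 sums_minus summable_sums[OF sc])
    have "- \<bar>c (Suc n)\<bar> * (v \<bullet> v) \<le> c (Suc n) * (bpow U (Suc n) v \<bullet> v)" for n
    proof -
      have "\<bar>bpow U (Suc n) v \<bullet> v\<bar> \<le> norm (bpow U (Suc n) v) * norm v" by (rule Cauchy_Schwarz_ineq2)
      also have "\<dots> \<le> (norm (bpow U (Suc n)) * norm v) * norm v"
        by (intro mult_right_mono norm_blinfun) auto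
      also have "\<dots> \<le> (1 * norm v) * norm v"
        using norm_bpow_le[OF U, of "Suc n"] by (intro mult_right_mono) auto
      finally have "\<bar>bpow U (Suc n) v \<bullet> v\<bar> \<le> v \<bullet> v" by (simp add: dot_square_norm power2_eq_square)
      then have "\<bar>c (Suc n) * (bpow U (Suc n) v \<bullet> v)\<bar> \<le> \<bar>c (Suc n)\<bar> * (v \<bullet> v)"
        unfolding abs_mult by (rule mult_left_mono) simp
      then show ?thesis by linarith
    qed
    then have "- (\<Sum>n. \<bar>c (Suc n)\<bar>) * (v \<bullet> v) \<le> S v \<bullet> v - v \<bullet> v"
      by (rule sums_le[OF _ lhs sh])
    moreover have "(\<Sum>n. \<bar>c (Suc n)\<bar>) * (v \<bullet> v) \<le> 1 * (v \<bullet> v)"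
      unfolding c_def by (intro mult_right_mono binomial_coeffs(3)[OF a]) auto
    ultimately show ?thesis by simp
  qed
  have S_com: "R o\<^sub>L S = S o\<^sub>L R" if R: "R o\<^sub>L U = U o\<^sub>L R" for R
  proof -
    have "(\<lambda>n. R o\<^sub>L (c n *\<^sub>R bpow U n)) sums (R o\<^sub>L S)"
      by (rule bounded_linear.sums[OF blinfun_compose.bounded_linear_right[of R] ser])
    also have "(\<lambda>n. R o\<^sub>L (c n *\<^sub>R bpow U n)) = (\<lambda>n. (c n *\<^sub>R bpow U n) o\<^sub>L R)"
      by (rule ext) (simp only: blinfun_compose.scaleR_left blinfun_compose.scaleR_right bpow_commute[OF R])
    finally have "(\<lambda>n. (c n *\<^sub>R bpow U n) o\<^sub>L R) sums (R o\<^sub>L S)" .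
    moreover have "(\<lambda>n. (c n *\<^sub>R bpow U n) o\<^sub>L R) sums (S o\<^sub>L R)"
      by (rule bounded_linear.sums[OF blinfun_compose.bounded_linear_left[of R] ser])
    ultimately show ?thesis by (rule sums_unique2)
  qed
  show ?thesis
    unfolding positive_operator_def
    by (intro exI[of _ S] conjI allI impI S_sym S_pos S_com pow)
qed

text \<open>Rescaling: \<open>- U\<close> is the identity minus \<open>T / c\<close> and lies
  between 0 and the identity, which \<open>positive_form_bound\<close> converts into
  \<open>norm U \<le> 1\<close>. The commutation clause is what makes uniqueness accessible
  later.\<close>

lemma positive_root_exists:
  fixes T :: "'h::{real_inner,banach} \<Rightarrow>\<^sub>L 'h"
  assumes T: "positive_operator T" and k: "k > 0"
  shows "\<exists>S. positive_operator S \<and> blinfun_apply S ^^ k = blinfun_apply T \<and>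
    (\<forall>R. R o\<^sub>L T = T o\<^sub>L R \<longrightarrow> R o\<^sub>L S = S o\<^sub>L R)"
proof -
  \<comment> \<open>The added 1 keeps \<open>c\<close> positive when \<open>T\<close> is
    zero.\<close>
  define c where "c = norm T + 1"
  have c: "c > 0" by (simp add: c_def add_nonneg_pos)
  define U where "U = (1/c) *\<^sub>R T - id_blinfun"
  have sT: "T u \<bullet> v = u \<bullet> T v" and pT: "0 \<le> T v \<bullet> v" for u v
    using T by (auto simp: positive_operator_def)
  have sym: "U u \<bullet> v = u \<bullet> U v" for u v
    by (simp add: U_def blinfun.diff_left blinfun.scaleR_left inner_simps sT)
  have le: "T v \<bullet> v \<le> c * (v \<bullet> v)" for v
  proof -
    have "T v \<bullet> v \<le> norm (T v) * norm v" by (rule norm_cauchy_schwarz)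
    also have "\<dots> \<le> (norm T * norm v) * norm v" by (intro mult_right_mono norm_blinfun) auto
    also have "\<dots> \<le> c * (v \<bullet> v)"
      unfolding dot_square_norm power2_eq_square mult.assoc by (intro mult_right_mono) (auto simp: c_def)
    finally show ?thesis .
  qed
  have "norm (U v) \<le> 1 * norm v" for v
  proof -
    have "(norm ((- U) v))\<^sup>2 \<le> 1 * ((- U) v \<bullet> v)"
      by (rule positive_form_bound[of UNIV])
        (use le c pT in \<open>auto simp: U_def blinfun.diff_left blinfun.scaleR_left blinfun.minus_left inner_simps sT field_simps\<close>)
    also have "\<dots> \<le> norm (U v) * norm v"
      using norm_cauchy_schwarz[of "- U v" v] by (simp add: blinfun.minus_left)
    finally have "norm (U v) * norm (U v) \<le> norm (U v) * norm v"
      by (simp add: blinfun.minus_left power2_eq_square)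
    then show ?thesis by (cases "U v = 0") auto
  qed
  then have nU: "norm U \<le> 1" by (intro norm_blinfun_bound) auto
  obtain S where S: "positive_operator S" "bpow S k = id_blinfun + U"
      "\<And>R. R o\<^sub>L U = U o\<^sub>L R \<Longrightarrow> R o\<^sub>L S = S o\<^sub>L R"
    using positive_root_exists_contraction[OF sym nU k] by blast
  define r where "r = root k c"
  have r: "r > 0" "r ^ k = c" using c k by (auto simp: r_def)
  define S' where "S' = r *\<^sub>R S"
  have "(blinfun_apply S' ^^ n) v = r ^ n *\<^sub>R (bpow S n v)" for n v
    by (induction n) (simp_all add: S'_def blinfun.scaleR_left blinfun.scaleR_right)
  then have "(blinfun_apply S' ^^ k) v = c *\<^sub>R ((id_blinfun + U) v)" for v
    using S(2) r(2) by metis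
  then have "blinfun_apply S' ^^ k = blinfun_apply T"
    using c by (auto simp: fun_eq_iff U_def blinfun.add_left blinfun.diff_left blinfun.scaleR_left)
  moreover have "positive_operator S'"
    using positive_operatorD[OF S(1)] r(1)
    unfolding positive_operator_def S'_def blinfun.scaleR_left inner_scaleR_left inner_scaleR_right
    by (metis less_imp_le mult_nonneg_nonneg)
  moreover have "R o\<^sub>L S' = S' o\<^sub>L R" if "R o\<^sub>L T = T o\<^sub>L R" for R
  proof -
    have "R (T v) = T (R v)" for v using that by (metis blinfun_apply_blinfun_compose)
    then have "R o\<^sub>L U = U o\<^sub>L R"
      by (intro blinfun_eqI) (simp add: U_def blinfun.diff_left blinfun.scaleR_left blinfun.diff_right blinfun.scaleR_right)
    then have "R o\<^sub>L S = S o\<^sub>L R" by (rule S(3))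
    then show ?thesis by (simp only: S'_def blinfun_compose.scaleR_left blinfun_compose.scaleR_right)
  qed
  ultimately show ?thesis by blast
qed

section \<open>Uniqueness of positive roots\<close>

lemma positive_operator_funpow:
  assumes "positive_operator S"
  shows "(blinfun_apply S ^^ n) u \<bullet> v = u \<bullet> (blinfun_apply S ^^ n) v"
  using assms
  by (induction n arbitrary: u v) (auto simp: positive_operator_def funpow_swap1)

lemma positive_operator_zero:
  assumes S: "positive_operator S" and "S w \<bullet> w = 0"
  shows "S w = 0"
proof -
  have le: "S v \<bullet> v \<le> norm S * (v \<bullet> v)" for v
  proof -
    have "S v \<bullet> v \<le> norm (S v) * norm v" by (rule norm_cauchy_schwarz)
    also have "\<dots> \<le> (norm S * norm v) * norm v" by (intro mult_right_mono norm_blinfun) auto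
    finally show ?thesis by (simp add: dot_square_norm power2_eq_square)
  qed
  have "(norm (S w))\<^sup>2 \<le> norm S * (S w \<bullet> w)"
    by (rule positive_form_bound[of UNIV]) (use S le in \<open>auto simp: positive_operator_def\<close>)
  then show ?thesis using assms by simp
qed

text \<open>By symmetry the squared norm of the m-th power at \<open>w\<close> is the inner product
  of the 2m-th power at \<open>w\<close> with \<open>w\<close>, so a vanishing power can be halved
  until the exponent is 1.\<close>

lemma funpow_selfadjoint_zero:
  assumes S: "positive_operator S" and "(blinfun_apply S ^^ n) w = 0"
  shows "n = 0 \<or> S w = 0"
  using assms(2)
proof (induction n rule: less_induct)
  case (less n)
  show ?case
  proof (cases "n \<le> 1")
    case True then show ?thesis using less.prems by (cases n) auto
  next
    case False
    \<comment> \<open>Half of \<open>n\<close> rounded up: \<open>2 * m\<close> still reaches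
      \<open>n\<close>, and \<open>m\<close> is smaller than \<open>n\<close> because
      \<open>n\<close> is at least 2.\<close>
    define m where "m = (n + 1) div 2"
    have m: "m < n" "m \<noteq> 0" "n \<le> 2 * m" using False by (auto simp: m_def)
    have "(blinfun_apply S ^^ (2 * m)) w = (blinfun_apply S ^^ (2 * m - n)) ((blinfun_apply S ^^ n) w)"
      using m funpow_add[of "2 * m - n" n "blinfun_apply S"] by simp
    also have "\<dots> = 0"
    proof -
      have "(blinfun_apply S ^^ j) 0 = 0" for j by (induction j) auto
      then show ?thesis using less.prems by simp
    qed
    finally have "(blinfun_apply S ^^ m) w \<bullet> (blinfun_apply S ^^ m) w = 0"
      using positive_operator_funpow[OF S, of m "(blinfun_apply S ^^ m) w" w]
      by (simp add: mult_2 funpow_add)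
    then show ?thesis using less.IH[OF m(1)] m(2) by auto
  qed
qed

text \<open>For commuting positive \<open>R\<close>, \<open>S\<close> with \<open>R\<^sup>k = S\<^sup>k\<close>, all summands of
  \<open>\<Sum>i<k. R\<^sup>i S\<^bsup>k-1-i\<^esup>\<close> are positive on \<open>w = (R - S) v\<close> (as \<open>k - 1\<close> is odd, one of the two
  exponents is even), and the sum vanishes there.\<close>

lemma positive_root_unique_commuting:
  fixes R S :: "'h::{real_inner,banach} \<Rightarrow>\<^sub>L 'h"
  assumes R: "positive_operator R" and S: "positive_operator S" and com: "R o\<^sub>L S = S o\<^sub>L R"
    and k: "even k" "k > 0" and eq: "blinfun_apply R ^^ k = blinfun_apply S ^^ k"
  shows "R = S"
proof (rule blinfun_eqI)
  fix v
  define w where "w = R v - S v"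
  let ?R = "\<lambda>n. blinfun_apply R ^^ n" and ?S = "\<lambda>n. blinfun_apply S ^^ n"
  have c1: "R (S x) = S (R x)" for x using com by (metis blinfun_apply_blinfun_compose)
  have c2: "R (?S n x) = ?S n (R x)" for n x by (induction n) (simp_all add: c1)
  have c3: "?R m (?S n x) = ?S n (?R m x)" for m n x by (induction m) (simp_all add: c2)
  have sub: "?R m (x - y) = ?R m x - ?R m y" "?S m (x - y) = ?S m x - ?S m y" for m x y
    by (simp_all flip: bpow_apply add: blinfun.diff_right)
  \<comment> \<open>The factorisation of R^n - S^n with \<open>R - S\<close> split off, by
    telescoping.\<close>
  have "(\<Sum>i<n. ?R i (?S (n - Suc i) w)) = ?R n v - ?S n v" for n
  proof -
    have "(\<Sum>i<n. ?R i (?S (n - Suc i) w)) = (\<Sum>i<n. ?R (Suc i) (?S (n - Suc i) v) - ?R i (?S (n - i) v))"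
    proof (rule sum.cong)
      fix i assume "i \<in> {..<n}"
      then have n: "n - i = Suc (n - Suc i)" by auto
      show "?R i (?S (n - Suc i) w) = ?R (Suc i) (?S (n - Suc i) v) - ?R i (?S (n - i) v)"
        unfolding n w_def by (simp add: sub c2 funpow_swap1)
    qed simp
    also have "\<dots> = ?R n (?S (n - n) v) - ?R 0 (?S (n - 0) v)"
      by (rule sum_lessThan_telescope[of "\<lambda>i. ?R i (?S (n - i) v)" n])
    finally show ?thesis by simp
  qed
  then have "(\<Sum>i<k. ?R i (?S (k - Suc i) w)) = 0" using eq by simp
  then have sum0: "(\<Sum>i<k. ?R i (?S (k - Suc i) w) \<bullet> w) = 0"
    by (simp add: inner_sum_left[symmetric])
  \<comment> \<open>Half of each even power moves to the other side of the inner product by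
    symmetry.\<close>
  have half: "?R (2 * a) (?S (2 * b) z) \<bullet> w = ?S b (?R a z) \<bullet> ?S b (?R a w)" for a b z
  proof -
    have "?R (2 * a) (?S (2 * b) z) = ?R a (?S b (?S b (?R a z)))"
      by (simp only: mult_2 funpow_add o_apply c3)
    then show ?thesis
      by (simp only: positive_operator_funpow[OF R] positive_operator_funpow[OF S, of b "?S b (?R a z)"])
  qed
  have pR: "0 \<le> R y \<bullet> y" and pS: "0 \<le> S y \<bullet> y" for y
    using R S by (auto dest: positive_operatorD)
  have pos: "0 \<le> ?R i (?S j w) \<bullet> w" if "odd (i + j)" for i j
  proof (cases "even i")
    case True
    then have "even i" "odd j" using \<open>odd (i + j)\<close> by auto
    then obtain a b where "i = 2 * a" "j = 2 * b + 1" by (metis evenE oddE)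
    then have "?R i (?S j w) = ?R (2 * a) (?S (2 * b) (S w))"
      by (simp only: Suc_eq_plus1[symmetric] funpow_Suc_right o_apply)
    then have "?R i (?S j w) \<bullet> w = ?S b (?R a (S w)) \<bullet> ?S b (?R a w)"
      by (simp only: half)
    also have "?R a (S w) = S (?R a w)"
      using c3[of a 1 w] by simp
    also have "?S b (S (?R a w)) = S (?S b (?R a w))"
      by (rule funpow_swap1[symmetric])
    finally show ?thesis by (simp only: pS)
  next
    case False
    then have "odd i" "even j" using \<open>odd (i + j)\<close> by auto
    then obtain a b where "i = 2 * a + 1" "j = 2 * b" by (metis evenE oddE)
    then have "?R i (?S j w) = ?R (2 * a) (?S (2 * b) (R w))"
      by (simp only: Suc_eq_plus1[symmetric] funpow_Suc_right o_apply c2)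
    then have "?R i (?S j w) \<bullet> w = ?S b (?R a (R w)) \<bullet> ?S b (?R a w)"
      by (simp only: half)
    also have "?R a (R w) = R (?R a w)"
      by (rule funpow_swap1[symmetric])
    also have "?S b (R (?R a w)) = R (?S b (?R a w))"
      by (rule c2[symmetric])
    finally show ?thesis by (simp only: pR)
  qed
  have zero: "?R i (?S (k - Suc i) w) \<bullet> w = 0" if "i < k" for i
  proof -
    have "\<forall>i\<in>{..<k}. ?R i (?S (k - Suc i) w) \<bullet> w = 0"
    proof (subst sum_nonneg_eq_0_iff[symmetric])
      show "0 \<le> ?R i (?S (k - Suc i) w) \<bullet> w" if "i \<in> {..<k}" for i
        by (rule pos) (use that k in auto)
    qed (use sum0 in simp_all)
    then show ?thesis using that by auto
  qed
  \<comment> \<open>For an odd exponent 2m + 1 the form at \<open>w\<close> is the form of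
    \<open>Q\<close> itself at the m-th power of \<open>w\<close>; if it vanishes, that power lies
    in the kernel of \<open>Q\<close>.\<close>
  have single: "Q w = 0" if Q: "positive_operator Q" and "(blinfun_apply Q ^^ (k - 1)) w \<bullet> w = 0" for Q
  proof -
    have "odd (k - 1)" using k by simp
    then obtain m where m: "k - 1 = 2 * m + 1" by (rule oddE)
    have "2 * m + 1 = m + Suc m" by simp
    then have "(blinfun_apply Q ^^ (k - 1)) w = (blinfun_apply Q ^^ m) (Q ((blinfun_apply Q ^^ m) w))"
      by (simp only: m funpow_add o_apply funpow.simps(2))
    then have "Q ((blinfun_apply Q ^^ m) w) \<bullet> (blinfun_apply Q ^^ m) w = 0"
      using that(2) positive_operator_funpow[OF Q, of m "Q ((blinfun_apply Q ^^ m) w)" w] by simp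
    then have "Q ((blinfun_apply Q ^^ m) w) = 0" by (rule positive_operator_zero[OF Q])
    then have "(blinfun_apply Q ^^ Suc m) w = 0" by simp
    then show ?thesis using funpow_selfadjoint_zero[OF Q] by blast
  qed
  \<comment> \<open>The two extreme summands contain powers of \<open>R\<close> alone and of
    \<open>S\<close> alone. They give \<open>R w = 0\<close> and \<open>S w = 0\<close>, and
    \<open>w\<close> is orthogonal to itself because \<open>w = R v - S v\<close>.\<close>
  have "R w = 0"
  proof (rule single[OF R])
    have "k - Suc (k - 1) = 0" using k by simp
    then show "?R (k - 1) w \<bullet> w = 0" using zero[of "k - 1"] k(2) by simp
  qed
  moreover have "S w = 0"
    by (rule single[OF S]) (use zero[of 0] k(2) in simp)
  moreover have "w \<bullet> w = v \<bullet> R w - v \<bullet> S w"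
    using R S by (subst w_def) (simp add: inner_diff_left positive_operator_def)
  ultimately have "w \<bullet> w = 0" by simp
  then show "R v = S v" by (simp add: w_def)
qed

text \<open>Resolves the definite description in \<open>positive_root\<close>. Any root commutes
  with \<open>T\<close>, hence with the root constructed from the series, so the commuting case of
  uniqueness suffices.\<close>

lemma positive_root_works:
  fixes T :: "'h::{real_inner,banach} \<Rightarrow>\<^sub>L 'h"
  assumes T: "positive_operator T" and k: "even k" "k > 0"
  shows "positive_operator (positive_root k T)"
    and "blinfun_apply (positive_root k T) ^^ k = blinfun_apply T"
    and "R o\<^sub>L T = T o\<^sub>L R \<Longrightarrow> R o\<^sub>L positive_root k T = positive_root k T o\<^sub>L R"
    and "positive_operator S \<Longrightarrow> blinfun_apply S ^^ k = blinfun_apply T \<Longrightarrow> positive_root k T = S"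
proof -
  obtain S0 where S0: "positive_operator S0" "blinfun_apply S0 ^^ k = blinfun_apply T"
     "\<And>R. R o\<^sub>L T = T o\<^sub>L R \<Longrightarrow> R o\<^sub>L S0 = S0 o\<^sub>L R"
    using positive_root_exists[OF T k(2)] by blast
  have uniq: "S = S0" if S: "positive_operator S" "blinfun_apply S ^^ k = blinfun_apply T" for S
  proof -
    have "S (T x) = T (S x)" for x
      by (simp only: S(2)[symmetric] funpow_swap1[of "blinfun_apply S" k x])
    then have "S o\<^sub>L T = T o\<^sub>L S" by (intro blinfun_eqI) simp
    then show ?thesis
      by (intro positive_root_unique_commuting[OF S(1) S0(1) S0(3) k]) (simp_all only: S(2) S0(2))
  qed
  have eq: "positive_root k T = S0"
    unfolding positive_root_def
    by (rule the_equality) (use S0(1,2) in blast, use uniq in blast)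
  show "positive_operator (positive_root k T)"
    "blinfun_apply (positive_root k T) ^^ k = blinfun_apply T"
    unfolding eq by (rule S0)+
  show "R o\<^sub>L positive_root k T = positive_root k T o\<^sub>L R" if "R o\<^sub>L T = T o\<^sub>L R"
    unfolding eq by (rule S0(3)[OF that])
  show "positive_root k T = S" if "positive_operator S" "blinfun_apply S ^^ k = blinfun_apply T"
    unfolding eq by (rule uniq[OF that, symmetric])
qed

section \<open>Finite dimensional subspaces\<close>

lemma finite_dim_subset: "finite_dim V \<Longrightarrow> W \<subseteq> V \<Longrightarrow> finite_dim W"
  unfolding finite_dim_def by blast

lemma dim_zero_subspace [simp]: "dim {0 :: 'a::real_vector} = 0"
proof -
  have "dim (span ({} :: 'a set)) = card ({} :: 'a set)"
    by (rule dim_span_eq_card_independent) (rule independent_empty)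
  then show ?thesis by simp
qed

lemma finite_dim_orthogonal_basis:
  fixes V :: "'h::real_inner set"
  assumes V: "subspace V" "finite_dim V"
  obtains C where "finite C" "pairwise orthogonal C" "0 \<notin> C" "independent C" "span C = V" "C \<subseteq> V" "card C = dim V"
proof -
  obtain S where S: "finite S" "V \<subseteq> span S" using V(2) by (auto simp: finite_dim_def)
  obtain B where B: "B \<subseteq> V" "independent B" "V \<subseteq> span B" by (meson basis_exists)
  have "finite B" using independent_span_bound[OF S(1) B(2)] B(1) S(2) by blast
  then obtain C where C: "finite C" "span C = span B" "pairwise orthogonal C"
    using basis_orthogonal by blast
  define D where "D = C - {0}"
  have sp: "span D = V"
    using C(2) B V(1) by (metis D_def span_delete_0 span_minimal subset_antisym)
  have D: "finite D" "pairwise orthogonal D" "0 \<notin> D"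
    using C pairwise_subset[OF C(3), of D] by (auto simp: D_def)
  moreover have "independent D" using D by (simp add: pairwise_orthogonal_independent)
  moreover have "D \<subseteq> V" using sp span_superset by blast
  moreover have "card D = dim V" using sp \<open>independent D\<close> by (metis dim_span_eq_card_independent)
  ultimately show ?thesis using sp that by blast
qed

lemma orthogonal_projection_exists:
  fixes W :: "'h::real_inner set"
  assumes W: "subspace W" "finite_dim W"
  shows "\<exists>p\<in>W. \<forall>w\<in>W. (x - p) \<bullet> w = 0"
proof -
  obtain C where C: "finite C" "pairwise orthogonal C" "0 \<notin> C" "span C = W" "C \<subseteq> W"
    using finite_dim_orthogonal_basis[OF W] by metis
  define p where "p = (\<Sum>c\<in>C. (x \<bullet> c / (c \<bullet> c)) *\<^sub>R c)"
  have "p \<in> W" unfolding p_def using C(5) W(1) by (intro subspace_sum subspace_scale) auto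
  moreover have "(x - p) \<bullet> w = 0" if "w \<in> W" for w
  proof -
    have "orthogonal (x - p) c" if c: "c \<in> C" for c
    proof -
      have "p \<bullet> c = (\<Sum>b\<in>C. (x \<bullet> b / (b \<bullet> b)) * (b \<bullet> c))" by (simp add: p_def inner_sum_left)
      also have "\<dots> = (\<Sum>b\<in>C. if b = c then x \<bullet> c else 0)"
      proof (rule sum.cong)
        show "(x \<bullet> b / (b \<bullet> b)) * (b \<bullet> c) = (if b = c then x \<bullet> c else 0)" if "b \<in> C" for b
          using C(2,3) that c by (auto simp: pairwise_def orthogonal_def)
      qed simp
      also have "\<dots> = x \<bullet> c" using C(1) c by simp
      finally show ?thesis by (simp add: orthogonal_def inner_diff_left)
    qed
    moreover have "w \<in> span C" using that C(4) by simp
    ultimately have "orthogonal (x - p) w" using orthogonal_to_span by blast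
    then show ?thesis by (simp add: orthogonal_def)
  qed
  ultimately show ?thesis by blast
qed

lemma dim_orthogonal_sum:
  fixes V :: "'i \<Rightarrow> 'h::real_inner set"
  assumes I: "finite I" and V: "\<And>i. i \<in> I \<Longrightarrow> subspace (V i)" "\<And>i. i \<in> I \<Longrightarrow> finite_dim (V i)"
    and orth: "\<And>i j u v. i \<in> I \<Longrightarrow> j \<in> I \<Longrightarrow> i \<noteq> j \<Longrightarrow> u \<in> V i \<Longrightarrow> v \<in> V j \<Longrightarrow> u \<bullet> v = 0"
  shows "dim (span (\<Union>i\<in>I. V i)) = (\<Sum>i\<in>I. dim (V i))"
proof -
  have "\<exists>C. finite C \<and> pairwise orthogonal C \<and> 0 \<notin> C \<and> span C = V i \<and> C \<subseteq> V i \<and> card C = dim (V i)" if "i \<in> I" for i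
    using finite_dim_orthogonal_basis[OF V[OF that]] by metis
  then obtain C where C: "\<And>i. i \<in> I \<Longrightarrow> finite (C i) \<and> pairwise orthogonal (C i) \<and> 0 \<notin> C i \<and> span (C i) = V i \<and> C i \<subseteq> V i \<and> card (C i) = dim (V i)"
    by metis
  define D where "D = (\<Union>i\<in>I. C i)"
  have "pairwise orthogonal D"
    unfolding pairwise_def orthogonal_def
  proof (intro ballI impI)
    fix u v assume uv: "u \<in> D" "v \<in> D" "u \<noteq> v"
    then obtain i j where ij: "i \<in> I" "u \<in> C i" "j \<in> I" "v \<in> C j" by (auto simp: D_def)
    show "u \<bullet> v = 0"
    proof (cases "i = j")
      case True then show ?thesis using C[OF ij(1)] ij uv(3) by (auto simp: pairwise_def orthogonal_def)
    next
      case False then show ?thesis using orth[OF ij(1,3)] C[OF ij(1)] C[OF ij(3)] ij by blast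
    qed
  qed
  moreover have "0 \<notin> D" using C by (auto simp: D_def)
  ultimately have ind: "independent D" by (rule pairwise_orthogonal_independent)
  have "span D = span (\<Union>i\<in>I. V i)"
  proof (rule span_eq[THEN iffD2], rule conjI)
    show "D \<subseteq> span (\<Union>i\<in>I. V i)"
    proof
      fix d assume "d \<in> D"
      then obtain i where "i \<in> I" "d \<in> C i" by (auto simp: D_def)
      then show "d \<in> span (\<Union>i\<in>I. V i)" using C[of i] by (intro span_base) blast
    qed
    show "(\<Union>i\<in>I. V i) \<subseteq> span D"
    proof (rule UN_least)
      fix i assume i: "i \<in> I"
      have "C i \<subseteq> D" using i by (auto simp: D_def)
      then have "span (C i) \<subseteq> span D" by (rule span_mono)
      then show "V i \<subseteq> span D" using C[OF i] by simp
    qed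
  qed
  then have "dim (span (\<Union>i\<in>I. V i)) = card D" using ind by (metis dim_span_eq_card_independent)
  also have "card D = (\<Sum>i\<in>I. card (C i))"
    unfolding D_def
  proof (rule card_UN_disjoint[OF I])
    show "\<forall>i\<in>I. finite (C i)" using C by blast
    show "\<forall>i\<in>I. \<forall>j\<in>I. i \<noteq> j \<longrightarrow> C i \<inter> C j = {}"
    proof (intro ballI impI, rule ccontr)
      fix i j assume ij: "i \<in> I" "j \<in> I" "i \<noteq> j" and "C i \<inter> C j \<noteq> {}"
      then obtain c where c: "c \<in> C i" "c \<in> C j" by blast
      then have "c \<bullet> c = 0" using orth[OF ij] C[OF ij(1)] C[OF ij(2)] by blast
      then show False using c C[OF ij(1)] by simp
    qed
  qed
  also have "\<dots> = (\<Sum>i\<in>I. dim (V i))" using C by (intro sum.cong) auto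
  finally show ?thesis .
qed

section \<open>Dimension over the scalar field\<close>

text \<open>\<open>J\<close> is skew, so \<open>J v\<close> is orthogonal to \<open>v\<close>, and
  the plane spanned by the two is \<open>J\<close>-invariant. Its orthogonal complement in
  \<open>V\<close> is again \<open>J\<close>-invariant and has dimension smaller by 2.\<close>

lemma even_dim_complex:
  fixes J :: "'h::real_inner \<Rightarrow>\<^sub>L 'h"
  assumes J2: "\<And>v. J (J v) = - v" and iso: "\<And>u v. J u \<bullet> J v = u \<bullet> v"
    and "subspace V" "finite_dim V" "\<And>v. v \<in> V \<Longrightarrow> J v \<in> V"
  shows "even (dim V)"
  using assms(3-)
proof (induction "dim V" arbitrary: V rule: less_induct)
  case less
  show ?case
  proof (cases "V \<subseteq> {0}")
    case True
    then have "V = {0}" using subspace_0[OF less.prems(1)] by auto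
    then show ?thesis by simp
  next
    case False
    then obtain v where v: "v \<in> V" "v \<noteq> 0" by blast
    have skew: "J u \<bullet> w = - (u \<bullet> J w)" for u w using iso[of u "J w"] by (simp add: J2)
    have vJ: "v \<bullet> J v = 0" using skew[of v v] by (simp add: inner_commute)
    have Jv0: "J v \<noteq> 0" using iso[of v v] v(2) by auto
    define P where "P = span {v, J v}"
    define W where "W = {w \<in> V. w \<bullet> v = 0 \<and> w \<bullet> J v = 0}"
    have PV: "P \<subseteq> V" unfolding P_def using v less.prems by (intro span_minimal) auto
    have ind: "independent {v, J v}"
      by (rule pairwise_orthogonal_independent) (use v(2) vJ Jv0 in \<open>auto simp: pairwise_def orthogonal_def inner_commute\<close>)
    have vnJ: "v \<noteq> J v" using vJ v(2) by auto
    have dimP: "dim P = 2" unfolding P_def using dim_span_eq_card_independent[OF ind] vnJ by simp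
    have subP: "subspace P" and fdP: "finite_dim P" unfolding P_def finite_dim_def
      by (simp, intro exI[of _ "{v, J v}"]) simp
    have subW: "subspace W" using less.prems(1) by (auto simp: W_def subspace_def inner_left_distrib)
    have fdW: "finite_dim W" using less.prems(2) by (rule finite_dim_subset) (auto simp: W_def)
    have JW: "J w \<in> W" if "w \<in> W" for w
      using that less.prems(3)[of w] by (simp add: W_def skew J2)
    have PW: "u \<bullet> w = 0" if "u \<in> P" "w \<in> W" for u w
    proof -
      have "orthogonal w u"
        using that(1) unfolding P_def by (rule orthogonal_to_span) (use that(2) in \<open>auto simp: W_def orthogonal_def\<close>)
      then show ?thesis by (simp add: orthogonal_def inner_commute)
    qed
    have sp: "span (P \<union> W) = V"
    proof
      show "span (P \<union> W) \<subseteq> V" using PV less.prems(1) by (intro span_minimal) (auto simp: W_def)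
      show "V \<subseteq> span (P \<union> W)"
      proof
        fix x assume x: "x \<in> V"
        obtain p where p: "p \<in> P" "\<And>w. w \<in> P \<Longrightarrow> (x - p) \<bullet> w = 0"
          using orthogonal_projection_exists[OF subP fdP] by blast
        have "v \<in> P" "J v \<in> P" by (auto simp: P_def span_base)
        then have "x - p \<in> W" using p x PV less.prems(1) by (auto simp: W_def subspace_diff)
        then have "p + (x - p) \<in> span (P \<union> W)" using p(1) by (intro span_add span_base) auto
        then show "x \<in> span (P \<union> W)" by simp
      qed
    qed
    have "dim (span (\<Union>b\<in>UNIV. if b then P else W)) = (\<Sum>b\<in>UNIV. dim (if b then P else W))"
    proof (rule dim_orthogonal_sum)
      show "subspace (if b then P else W)" "finite_dim (if b then P else W)" for b
        using subP fdP subW fdW by auto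
      show "u \<bullet> w = 0" if "a \<noteq> b" "u \<in> (if a then P else W)" "w \<in> (if b then P else W)" for a b u w
        using that PW[of u w] PW[of w u] by (cases a; cases b) (auto simp: inner_commute)
    qed auto
    moreover have "(\<Union>b\<in>UNIV. if b then P else W) = P \<union> W" by (auto simp: UNIV_bool)
    ultimately have "dim (span (P \<union> W)) = dim P + dim W" by (simp add: UNIV_bool)
    then have dims: "dim V = 2 + dim W" by (simp only: sp dimP)
    then have "even (dim W)" using less.hyps[OF _ subW fdW JW] by simp
    then show ?thesis using dims by simp
  qed
qed

lemma hilbert_scalars_cases:
  assumes "hilbert_scalars J"
  obtains "J = id_blinfun" "scalar_degree J = 1"
  | "\<And>v. J (J v) = - v" "\<And>u v. J u \<bullet> J v = u \<bullet> v" "scalar_degree J = 2"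
proof (cases "J = id_blinfun")
  case True then show ?thesis using that(1) by (simp add: scalar_degree_def)
next
  case False
  then have "J o\<^sub>L J = - id_blinfun" "\<forall>u v. J u \<bullet> J v = u \<bullet> v" using assms by (auto simp: hilbert_scalars_def)
  then have "J (J v) = - v" for v
    by (metis blinfun_apply_blinfun_compose blinfun.minus_left blinfun_apply_id_blinfun id_apply)
  then show ?thesis using that(2) \<open>\<forall>u v. J u \<bullet> J v = u \<bullet> v\<close> False by (simp add: scalar_degree_def)
qed

text \<open>Makes the truncating division in \<open>hdim\<close> exact, so that \<open>hdim\<close>
  adds up over orthogonal sums and vanishes only on the zero space.\<close>

lemma scalar_degree_dvd_dim:
  assumes J: "hilbert_scalars J" and V: "subspace V" "finite_dim V" "\<And>v. v \<in> V \<Longrightarrow> J v \<in> V"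
  shows "scalar_degree J dvd dim V"
  using J
proof (cases rule: hilbert_scalars_cases)
  case 1 then show ?thesis by simp
next
  case 2 then show ?thesis using even_dim_complex[OF 2(1,2) V] by simp
qed

lemma scalar_degree_pos: "scalar_degree J > 0" by (simp add: scalar_degree_def)

lemma hdim_zero [simp]: "hdim J {0} = 0"
proof -
  have "finite_dim {0::'a}" unfolding finite_dim_def by (intro exI[of _ "{}"]) simp
  then show ?thesis by (simp add: hdim_def zero_enat_def)
qed

lemma finite_dim_if_hdim: "hdim J V = enat n \<Longrightarrow> finite_dim V"
  by (simp add: hdim_def split: if_splits)

lemma hdim_eq_0:
  assumes J: "hilbert_scalars J" and V: "subspace V" "\<And>v. v \<in> V \<Longrightarrow> J v \<in> V" and "hdim J V = 0"
  shows "V = {0}"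
proof -
  have fd: "finite_dim V" using assms(4) by (auto simp: zero_enat_def intro: finite_dim_if_hdim)
  then have "dim V div scalar_degree J = 0" using assms(4) by (simp add: hdim_def zero_enat_def)
  then have "dim V = 0"
    using scalar_degree_dvd_dim[OF J V(1) fd V(2)] scalar_degree_pos[of J] by (metis dvd_div_eq_0_iff)
  moreover obtain C where "finite C" "span C = V" "card C = dim V"
    using finite_dim_orthogonal_basis[OF V(1) fd] by metis
  ultimately show ?thesis by (metis card_0_eq span_empty)
qed

lemma hdim_orthogonal_sum:
  fixes V :: "'i \<Rightarrow> 'h::real_inner set"
  assumes J: "hilbert_scalars J" and I: "finite I"
    and V: "\<And>i. i \<in> I \<Longrightarrow> subspace (V i)" "\<And>i. i \<in> I \<Longrightarrow> finite_dim (V i)"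
      "\<And>i v. i \<in> I \<Longrightarrow> v \<in> V i \<Longrightarrow> J v \<in> V i"
    and orth: "\<And>i j u v. i \<in> I \<Longrightarrow> j \<in> I \<Longrightarrow> i \<noteq> j \<Longrightarrow> u \<in> V i \<Longrightarrow> v \<in> V j \<Longrightarrow> u \<bullet> v = 0"
    and fd: "finite_dim (span (\<Union>i\<in>I. V i))"
  shows "hdim J (span (\<Union>i\<in>I. V i)) = (\<Sum>i\<in>I. hdim J (V i))"
proof -
  define d where "d = scalar_degree J"
  have d: "d > 0" by (simp add: d_def scalar_degree_pos)
  have "dim (V i) = d * (dim (V i) div d)" if "i \<in> I" for i
    using scalar_degree_dvd_dim[OF J V(1)[OF that] V(2)[OF that] V(3)[OF that]] by (simp add: d_def)
  then have "(\<Sum>i\<in>I. dim (V i)) = (\<Sum>i\<in>I. d * (dim (V i) div d))"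
    by (rule sum.cong[OF refl])
  then have "dim (span (\<Union>i\<in>I. V i)) = (\<Sum>i\<in>I. d * (dim (V i) div d))"
    using dim_orthogonal_sum[OF I V(1,2) orth] by simp
  then have eq: "dim (span (\<Union>i\<in>I. V i)) div d = (\<Sum>i\<in>I. dim (V i) div d)"
    using d by (simp flip: sum_distrib_left)
  have "hdim J (span (\<Union>i\<in>I. V i)) = enat (\<Sum>i\<in>I. dim (V i) div d)"
    unfolding hdim_def if_P[OF fd] by (simp only: eq d_def[symmetric])
  also have "\<dots> = (\<Sum>i\<in>I. enat (dim (V i) div d))"
    by (simp only: of_nat_eq_enat[symmetric] of_nat_sum)
  also have "\<dots> = (\<Sum>i\<in>I. hdim J (V i))"
    by (rule sum.cong) (simp_all add: V(2) hdim_def d_def)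
  finally show ?thesis .
qed

section \<open>Compact operators that are bounded below\<close>

lemma orthonormal_sequence_exists:
  fixes V :: "'h::real_inner set"
  assumes V: "subspace V" and inf: "\<not> finite_dim V"
  shows "\<exists>x :: nat \<Rightarrow> 'h. \<forall>n. x n \<in> V \<and> norm (x n) = 1 \<and> (\<forall>i<n. x i \<bullet> x n = 0)"
proof (rule dependent_wellorder_choice[where P = "\<lambda>x n r. r \<in> V \<and> norm r = 1 \<and> (\<forall>i<n. x i \<bullet> r = 0)"])
  fix x :: "nat \<Rightarrow> 'h" and n
  assume IH: "\<And>y. y < n \<Longrightarrow> x y \<in> V \<and> norm (x y) = 1 \<and> (\<forall>i<y. x i \<bullet> x y = 0)"
  define W where "W = span (x ` {..<n})"
  have W: "subspace W" "finite_dim W" by (auto simp: W_def finite_dim_def)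
  have WV: "W \<subseteq> V" unfolding W_def using IH V by (intro span_minimal) auto
  have "\<not> V \<subseteq> W" using inf W(2) finite_dim_subset by blast
  then obtain y where y: "y \<in> V" "y \<notin> W" by blast
  obtain p where p: "p \<in> W" "\<And>w. w \<in> W \<Longrightarrow> (y - p) \<bullet> w = 0"
    using orthogonal_projection_exists[OF W] by blast
  define r where "r = (1 / norm (y - p)) *\<^sub>R (y - p)"
  have np: "norm (y - p) \<noteq> 0" using y p by auto
  have "r \<in> V" unfolding r_def using V y p WV by (intro subspace_scale subspace_diff) auto
  moreover have "norm r = 1" using np by (simp add: r_def)
  moreover have "x i \<bullet> r = 0" if "i < n" for i
    using p(2)[of "x i"] that by (simp add: r_def W_def span_base inner_commute)
  ultimately show "\<exists>r. r \<in> V \<and> norm r = 1 \<and> (\<forall>i<n. x i \<bullet> r = 0)" by blast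
qed auto

text \<open>An infinite orthonormal sequence in \<open>V\<close> would have images at mutual
  distance at least \<theta>, and no subsequence of them could be Cauchy.\<close>

lemma compact_bounded_below_finite_dim:
  fixes T :: "'h::real_inner \<Rightarrow>\<^sub>L 'h"
  assumes T: "compact_operator T" and V: "subspace V" and \<theta>: "\<theta> > 0"
    and below: "\<And>v. v \<in> V \<Longrightarrow> norm v = 1 \<Longrightarrow> \<theta> \<le> norm (T v)"
  shows "finite_dim V"
proof (rule ccontr)
  assume "\<not> finite_dim V"
  then obtain x :: "nat \<Rightarrow> 'h" where x: "\<And>n. x n \<in> V" "\<And>n. norm (x n) = 1" "\<And>i n. i < n \<Longrightarrow> x i \<bullet> x n = 0"
    using orthonormal_sequence_exists[OF V] by metis
  have below': "\<theta> * norm v \<le> norm (T v)" if "v \<in> V" for v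
  proof (cases "v = 0")
    case False
    have "\<theta> \<le> norm (T ((1 / norm v) *\<^sub>R v))"
      using below[of "(1 / norm v) *\<^sub>R v"] that V False by (simp add: subspace_scale)
    then show ?thesis using False by (simp add: blinfun.scaleR_right field_simps)
  qed simp
  have "T (x n) \<in> closure (T ` cball 0 1)" for n
    by (intro subsetD[OF closure_subset] imageI) (simp add: x(2))
  moreover have "seq_compact (closure (T ` cball 0 1))"
    using T by (simp add: compact_operator_def compact_eq_seq_compact_metric)
  ultimately obtain l r where r: "strict_mono (r :: nat \<Rightarrow> nat)" "((\<lambda>n. blinfun_apply T (x n)) \<circ> r) \<longlonglongrightarrow> l"
    by (auto elim!: seq_compactE)
  then have "Cauchy (\<lambda>n. T (x (r n)))" by (auto simp: o_def intro: LIMSEQ_imp_Cauchy)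
  then obtain N where N: "\<And>m n. m \<ge> N \<Longrightarrow> n \<ge> N \<Longrightarrow> dist (T (x (r m))) (T (x (r n))) < \<theta>"
    using \<theta> unfolding Cauchy_def by blast
  define a b where "a = x (r N)" and "b = x (r (Suc N))"
  have lt: "r N < r (Suc N)" using r(1) by (simp add: strict_mono_def)
  have "(norm (a - b))\<^sup>2 = 2"
    using x(2)[of "r N"] x(2)[of "r (Suc N)"] x(3)[OF lt]
    by (simp add: a_def b_def power2_norm_eq_inner inner_diff_left inner_diff_right inner_commute norm_eq_1)
  then have "1 \<le> norm (a - b)" using power2_le_imp_le[of 1 "norm (a - b)"] by simp
  then have "\<theta> * 1 \<le> \<theta> * norm (a - b)" using \<theta> by (intro mult_left_mono) auto
  also have "\<dots> \<le> norm (T (a - b))"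
    using x V by (intro below') (auto simp: a_def b_def subspace_diff)
  also have "\<dots> < \<theta>" using N[of N "Suc N"] by (simp add: a_def b_def dist_norm blinfun.diff_right)
  finally show False by simp
qed

section \<open>Positive operators: Rayleigh quotients and eigenvectors\<close>

lemma norm_bound_form: "(S :: 'h::real_inner \<Rightarrow>\<^sub>L 'h) v \<bullet> v \<le> norm S * (v \<bullet> v)"
proof -
  have "S v \<bullet> v \<le> norm (S v) * norm v" by (rule norm_cauchy_schwarz)
  also have "\<dots> \<le> (norm S * norm v) * norm v" by (intro mult_right_mono norm_blinfun) auto
  finally show ?thesis by (simp add: dot_square_norm power2_eq_square)
qed

lemma form_lower_bound_scale:
  fixes S :: "'h::real_inner \<Rightarrow>\<^sub>L 'h"
  assumes "subspace V" and "\<And>v. v \<in> V \<Longrightarrow> norm v = 1 \<Longrightarrow> c \<le> S v \<bullet> v" and "v \<in> V"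
  shows "c * (v \<bullet> v) \<le> S v \<bullet> v"
proof (cases "v = 0")
  case False
  have "c \<le> S ((1 / norm v) *\<^sub>R v) \<bullet> ((1 / norm v) *\<^sub>R v)"
    using assms False by (intro assms(2)) (auto simp: subspace_scale)
  also have "\<dots> = (S v \<bullet> v) / (norm v)\<^sup>2"
    by (simp add: blinfun.scaleR_right power2_eq_square field_simps)
  finally show ?thesis using False by (simp add: field_simps power2_norm_eq_inner)
qed simp

text \<open>Approximate eigenvectors at the bottom of the spectrum of \<open>S\<close> on \<open>V\<close> are approximate
  eigenvectors of \<open>S\<^sup>m\<close>.\<close>

lemma power_lower_bound:
  fixes S :: "'h::real_inner \<Rightarrow>\<^sub>L 'h"
  assumes S: "positive_operator S" and V: "subspace V" and inv: "\<And>v. v \<in> V \<Longrightarrow> S v \<in> V"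
    and m: "m > 0" and c: "c \<ge> 0"
    and below: "\<And>v. v \<in> V \<Longrightarrow> norm v = 1 \<Longrightarrow> c ^ m \<le> norm ((blinfun_apply S ^^ m) v)"
    and v: "v \<in> V" "norm v = 1"
  shows "c \<le> S v \<bullet> v"
proof -
  define R where "R = (\<lambda>v. S v \<bullet> v) ` {v \<in> V. norm v = 1}"
  define s where "s = Inf R"
  have R: "R \<noteq> {}" "bdd_below R"
    using v positive_operatorD(2)[OF S] by (auto simp: R_def bdd_below_def)
  have s_le: "s \<le> S w \<bullet> w" if "w \<in> V" "norm w = 1" for w
    unfolding s_def by (rule cInf_lower[OF _ R(2)]) (use that in \<open>auto simp: R_def\<close>)
  have s0: "0 \<le> s" unfolding s_def
    by (rule cInf_greatest[OF R(1)]) (use positive_operatorD(2)[OF S] in \<open>auto simp: R_def\<close>)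
  have "\<exists>w\<in>V. norm w = 1 \<and> S w \<bullet> w < s + inverse (real (Suc n))" for n
    using cInf_less_iff[OF R, of "s + inverse (real (Suc n))"] by (auto simp: R_def s_def)
  then obtain w where w: "\<And>n. w n \<in> V" "\<And>n. norm (w n) = 1" "\<And>n. S (w n) \<bullet> w n < s + inverse (real (Suc n))"
    by metis
  \<comment> \<open>Positive on \<open>V\<close> because \<open>s\<close> is the infimum of the
    Rayleigh quotient, so \<open>positive_form_bound\<close> controls \<open>norm (Q (w n))\<close>
    by the excess of the quotient of \<open>w n\<close> over \<open>s\<close>.\<close>
  define Q where "Q = S - s *\<^sub>R id_blinfun"
  have Q: "Q x = S x - s *\<^sub>R x" for x by (simp add: Q_def blinfun.diff_left blinfun.scaleR_left)
  have Qb: "(norm (Q x))\<^sup>2 \<le> norm S * (Q x \<bullet> x)" if "x \<in> V" for x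
  proof (rule positive_form_bound[OF V _ _ _ _ that])
    show "Q x \<in> V" if "x \<in> V" for x unfolding Q using V inv that by (intro subspace_diff subspace_scale) auto
    show "Q x \<bullet> y = x \<bullet> Q y" for x y
      using positive_operatorD(1)[OF S, of x y] by (simp add: Q inner_diff_left inner_diff_right)
    show "0 \<le> Q x \<bullet> x" if "x \<in> V" for x
      using form_lower_bound_scale[OF V s_le that] by (simp add: Q inner_diff_left)
    show "Q x \<bullet> x \<le> norm S * (x \<bullet> x)" for x
    proof -
      have "0 \<le> s * (x \<bullet> x)" using s0 by simp
      then show ?thesis using norm_bound_form[of S x] by (simp add: Q inner_diff_left)
    qed
  qed
  have Qw: "(\<lambda>n. Q (w n)) \<longlonglongrightarrow> 0"
  proof -
    have "(\<lambda>n. (norm (Q (w n)))\<^sup>2) \<longlonglongrightarrow> 0"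
    proof (rule tendsto_sandwich[OF _ _ tendsto_const])
      show "\<forall>\<^sub>F n in sequentially. (norm (Q (w n)))\<^sup>2 \<le> norm S * inverse (real (Suc n))"
      proof (rule always_eventually, rule allI)
        fix n
        have "Q (w n) \<bullet> w n = S (w n) \<bullet> w n - s" using w(2)[of n] by (simp add: Q inner_diff_left norm_eq_1)
        then have "Q (w n) \<bullet> w n \<le> inverse (real (Suc n))" using w(3)[of n] by linarith
        then have "norm S * (Q (w n) \<bullet> w n) \<le> norm S * inverse (real (Suc n))" by (intro mult_left_mono) auto
        then show "(norm (Q (w n)))\<^sup>2 \<le> norm S * inverse (real (Suc n))" using Qb[OF w(1), of n] by linarith
      qed
      show "(\<lambda>n. norm S * inverse (real (Suc n))) \<longlonglongrightarrow> 0"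
        by (rule tendsto_mult_right_zero[OF LIMSEQ_inverse_real_of_nat])
    qed simp
    then have "(\<lambda>n. sqrt ((norm (Q (w n)))\<^sup>2)) \<longlonglongrightarrow> sqrt 0" by (rule tendsto_real_sqrt)
    then show ?thesis by (simp add: tendsto_norm_zero_iff)
  qed
  have pow: "(\<lambda>n. (blinfun_apply S ^^ j) (w n) - s ^ j *\<^sub>R w n) \<longlonglongrightarrow> 0" for j
  proof (induction j)
    case (Suc j)
    have "(\<lambda>n. S ((blinfun_apply S ^^ j) (w n) - s ^ j *\<^sub>R w n) + s ^ j *\<^sub>R Q (w n)) \<longlonglongrightarrow> S 0 + s ^ j *\<^sub>R 0"
      by (intro tendsto_add tendsto_scaleR tendsto_const Qw blinfun.tendsto Suc)
    moreover have "S ((blinfun_apply S ^^ j) (w n) - s ^ j *\<^sub>R w n) + s ^ j *\<^sub>R Q (w n)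
        = (blinfun_apply S ^^ Suc j) (w n) - s ^ Suc j *\<^sub>R w n" for n
      by (simp add: Q blinfun.diff_right blinfun.scaleR_right scaleR_diff_right mult.commute)
    ultimately show ?case by simp
  qed simp
  have lim: "(\<lambda>n. norm ((blinfun_apply S ^^ m) (w n) - s ^ m *\<^sub>R w n) + s ^ m) \<longlonglongrightarrow> norm (0::'h) + s ^ m"
    by (intro tendsto_add tendsto_norm pow tendsto_const)
  have "c ^ m \<le> norm ((blinfun_apply S ^^ m) (w n) - s ^ m *\<^sub>R w n) + s ^ m" for n
  proof -
    have "c ^ m \<le> norm ((blinfun_apply S ^^ m) (w n))" using below w by blast
    also have "\<dots> \<le> norm ((blinfun_apply S ^^ m) (w n) - s ^ m *\<^sub>R w n) + norm (s ^ m *\<^sub>R w n)"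
      by (metis norm_triangle_sub add.commute)
    also have "norm (s ^ m *\<^sub>R w n) = s ^ m" using w(2)[of n] s0 by simp
    finally show ?thesis .
  qed
  then have "c ^ m \<le> norm (0::'h) + s ^ m" by (intro LIMSEQ_le_const[OF lim] exI allI impI)
  then have "c ^ m \<le> s ^ m" by simp
  then have "c \<le> s" using s0 m power_le_imp_le_base[of c "m - 1" s] by simp
  then show ?thesis using s_le[OF v] by linarith
qed

text \<open>The sequence \<open>\<parallel>S\<^sup>m u\<parallel>\<close> is log-convex.\<close>

lemma power_jensen:
  fixes S :: "'h::real_inner \<Rightarrow>\<^sub>L 'h"
  assumes S: "positive_operator S" and u: "norm u = 1"
  shows "(S u \<bullet> u) ^ m \<le> norm ((blinfun_apply S ^^ m) u)"
proof -
  define b where "b j = norm ((blinfun_apply S ^^ j) u)" for j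
  have b0: "b j \<ge> 0" for j by (simp add: b_def)
  have conv: "b (Suc j) * b (Suc j) \<le> b j * b (Suc (Suc j))" for j
  proof -
    let ?x = "(blinfun_apply S ^^ j) u"
    have "b (Suc j) * b (Suc j) = S ?x \<bullet> S ?x" by (simp add: b_def dot_square_norm power2_eq_square)
    also have "\<dots> = ?x \<bullet> S (S ?x)" by (rule positive_operatorD(1)[OF S])
    also have "\<dots> \<le> norm ?x * norm (S (S ?x))" by (rule norm_cauchy_schwarz)
    finally show ?thesis by (simp add: b_def)
  qed
  \<comment> \<open>Log-convexity makes the quotients of consecutive terms increase, and the first
    of them is \<open>b 1\<close> since \<open>u\<close> is a unit vector.\<close>
  have step: "b 1 * b j \<le> b (Suc j)" for j
  proof (induction j)
    case 0 show ?case by (simp add: b_def u)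
  next
    case (Suc j)
    show ?case
    proof (cases "b j = 0")
      case True
      then have "b (Suc j) = 0" by (simp add: b_def)
      then show ?thesis using b0 by simp
    next
      case False
      have "(b 1 * b (Suc j)) * b j = (b 1 * b j) * b (Suc j)" by simp
      also have "\<dots> \<le> b (Suc j) * b (Suc j)" using Suc b0 by (intro mult_right_mono) auto
      also have "\<dots> \<le> b (Suc (Suc j)) * b j" using conv[of j] by (simp add: mult.commute)
      finally show ?thesis using False b0[of j] by simp
    qed
  qed
  have a: "0 \<le> S u \<bullet> u" by (rule positive_operatorD(2)[OF S])
  have a1: "S u \<bullet> u \<le> b 1" using norm_cauchy_schwarz[of "S u" u] u by (simp add: b_def)
  have "(S u \<bullet> u) ^ m \<le> b m"
  proof (induction m)
    case 0 show ?case by (simp add: b_def u)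
  next
    case (Suc m)
    have "(S u \<bullet> u) ^ Suc m \<le> b 1 * b m" unfolding power_Suc using Suc a a1 b0 by (intro mult_mono) auto
    also have "\<dots> \<le> b (Suc m)" by (rule step)
    finally show ?case .
  qed
  then show ?thesis by (simp add: b_def)
qed

section \<open>Spectral decomposition on a finite dimensional invariant subspace\<close>

text \<open>A sequence maximising the Rayleigh quotient on the unit sphere of \<open>V\<close>
  consists of approximate eigenvectors for the supremum \<open>s\<close>. If \<open>s\<close> is
  positive, a convergent subsequence of the images under \<open>L\<close> makes the sequence itself
  converge along it.\<close>

lemma compact_positive_eigenvector:
  fixes L :: "'h::real_inner \<Rightarrow>\<^sub>L 'h"
  assumes L: "positive_operator L" "compact_operator L"
    and V: "subspace V" "closed V" "\<And>v. v \<in> V \<Longrightarrow> L v \<in> V" and nz: "V \<noteq> {0}"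
  shows "\<exists>v\<in>V. norm v = 1 \<and> (\<exists>\<rho>\<ge>0. L v = \<rho> *\<^sub>R v)"
proof -
  define R where "R = (\<lambda>v. L v \<bullet> v) ` {v \<in> V. norm v = 1}"
  define s where "s = Sup R"
  obtain v0 where v0: "v0 \<in> V" "v0 \<noteq> 0" using nz subspace_0[OF V(1)] by blast
  define v1 where "v1 = (1 / norm v0) *\<^sub>R v0"
  have v1: "v1 \<in> V" "norm v1 = 1" using v0 V(1) by (auto simp: v1_def subspace_scale)
  have pos: "0 \<le> L v \<bullet> v" for v by (rule positive_operatorD(2)[OF L(1)])
  have R: "R \<noteq> {}" "bdd_above R"
  proof -
    show "R \<noteq> {}" using v1 by (auto simp: R_def)
    have "L v \<bullet> v \<le> norm L" if "norm v = 1" for v using norm_bound_form[of L v] that by (simp add: norm_eq_1)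
    then show "bdd_above R" by (auto simp: R_def bdd_above_def)
  qed
  have le_s: "L w \<bullet> w \<le> s" if "w \<in> V" "norm w = 1" for w
    unfolding s_def by (rule cSup_upper[OF _ R(2)]) (use that in \<open>auto simp: R_def\<close>)
  have s0: "0 \<le> s" using le_s[OF v1] pos[of v1] by linarith
  define Q where "Q = s *\<^sub>R id_blinfun - L"
  have Q: "Q x = s *\<^sub>R x - L x" for x by (simp add: Q_def blinfun.diff_left blinfun.scaleR_left)
  have Qb: "(norm (Q x))\<^sup>2 \<le> s * (Q x \<bullet> x)" if "x \<in> V" for x
  proof (rule positive_form_bound[OF V(1) _ _ _ _ that])
    show "Q x \<in> V" if "x \<in> V" for x unfolding Q using V that by (intro subspace_diff subspace_scale) auto
    show "Q x \<bullet> y = x \<bullet> Q y" for x y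
      using positive_operatorD(1)[OF L(1), of x y] by (simp add: Q inner_diff_left inner_diff_right)
    show "0 \<le> Q x \<bullet> x" if "x \<in> V" for x
    proof -
      have "- s * (x \<bullet> x) \<le> (- L) x \<bullet> x"
        by (rule form_lower_bound_scale[OF V(1) _ that]) (simp add: blinfun.minus_left le_s)
      then show ?thesis by (simp add: Q inner_diff_left blinfun.minus_left)
    qed
    show "Q x \<bullet> x \<le> s * (x \<bullet> x)" for x using pos[of x] by (simp add: Q inner_diff_left)
  qed
  have "\<exists>w\<in>V. norm w = 1 \<and> s - inverse (real (Suc n)) < L w \<bullet> w" for n
    using less_cSup_iff[OF R, of "s - inverse (real (Suc n))"] by (auto simp: R_def s_def)
  then obtain w where w: "\<And>n. w n \<in> V" "\<And>n. norm (w n) = 1" "\<And>n. s - inverse (real (Suc n)) < L (w n) \<bullet> w n"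
    by metis
  show ?thesis
  proof (cases "s = 0")
    \<comment> \<open>If the quotient vanishes on \<open>V\<close>, every unit vector of
      \<open>V\<close> is in the kernel.\<close>
    case True
    have "(norm (Q v1))\<^sup>2 \<le> 0" using Qb[OF v1(1)] True by simp
    then have "L v1 = 0 *\<^sub>R v1" using True by (simp add: Q)
    then show ?thesis using v1 by blast
  next
    case False
    then have sp: "s > 0" using s0 by simp
    have Qw: "(\<lambda>n. Q (w n)) \<longlonglongrightarrow> 0"
    proof -
      have "(\<lambda>n. (norm (Q (w n)))\<^sup>2) \<longlonglongrightarrow> 0"
      proof (rule tendsto_sandwich[OF _ _ tendsto_const])
        show "\<forall>\<^sub>F n in sequentially. (norm (Q (w n)))\<^sup>2 \<le> s * inverse (real (Suc n))"
        proof (rule always_eventually, rule allI)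
          fix n
          have "Q (w n) \<bullet> w n = s - L (w n) \<bullet> w n" using w(2)[of n] by (simp add: Q inner_diff_left norm_eq_1)
          then have "Q (w n) \<bullet> w n \<le> inverse (real (Suc n))" using w(3)[of n] by linarith
          then have "s * (Q (w n) \<bullet> w n) \<le> s * inverse (real (Suc n))" using s0 by (intro mult_left_mono) auto
          then show "(norm (Q (w n)))\<^sup>2 \<le> s * inverse (real (Suc n))" using Qb[OF w(1), of n] by linarith
        qed
        show "(\<lambda>n. s * inverse (real (Suc n))) \<longlonglongrightarrow> 0"
          by (rule tendsto_mult_right_zero[OF LIMSEQ_inverse_real_of_nat])
      qed simp
      then have "(\<lambda>n. sqrt ((norm (Q (w n)))\<^sup>2)) \<longlonglongrightarrow> sqrt 0" by (rule tendsto_real_sqrt)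
      then show ?thesis by (simp add: tendsto_norm_zero_iff)
    qed
    have "L (w n) \<in> closure (L ` cball 0 1)" for n
      by (intro subsetD[OF closure_subset] imageI) (simp add: w(2))
    moreover have "seq_compact (closure (L ` cball 0 1))"
      using L(2) by (simp add: compact_operator_def compact_eq_seq_compact_metric)
    ultimately obtain y r where r: "strict_mono (r :: nat \<Rightarrow> nat)" "((\<lambda>n. blinfun_apply L (w n)) \<circ> r) \<longlonglongrightarrow> y"
      by (auto elim!: seq_compactE)
    have Lw: "(\<lambda>n. L (w (r n))) \<longlonglongrightarrow> y" using r(2) by (simp add: o_def)
    have Qr: "(\<lambda>n. Q (w (r n))) \<longlonglongrightarrow> 0" using LIMSEQ_subseq_LIMSEQ[OF Qw r(1)] by (simp add: o_def)
    define z where "z = (1 / s) *\<^sub>R y"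
    have "(\<lambda>n. (1 / s) *\<^sub>R (Q (w (r n)) + L (w (r n)))) \<longlonglongrightarrow> (1 / s) *\<^sub>R (0 + y)"
      by (intro tendsto_intros Qr Lw)
    moreover have "(1 / s) *\<^sub>R (Q (w (r n)) + L (w (r n))) = w (r n)" for n
      using sp by (simp add: Q)
    ultimately have wz: "(\<lambda>n. w (r n)) \<longlonglongrightarrow> z" by (simp add: z_def)
    have "z \<in> V" by (rule closed_sequentially[OF V(2) _ wz]) (simp add: w)
    moreover have "norm z = 1"
      using tendsto_norm[OF wz] w(2) by (simp add: LIMSEQ_const_iff)
    moreover have "L z = s *\<^sub>R z"
    proof -
      have "(\<lambda>n. L (w (r n))) \<longlonglongrightarrow> L z" by (intro blinfun.tendsto tendsto_const wz)
      then have "L z = y" using Lw LIMSEQ_unique by blast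
      then show ?thesis using sp by (simp add: z_def)
    qed
    ultimately show ?thesis using s0 by blast
  qed
qed

definition eigenspace :: "('h::real_normed_vector \<Rightarrow>\<^sub>L 'h) \<Rightarrow> real \<Rightarrow> 'h set" where
  "eigenspace L \<rho> = {v. L v = \<rho> *\<^sub>R v}"

lemma subspace_eigenspace: "subspace (eigenspace L \<rho>)"
  by (auto simp: eigenspace_def subspace_def blinfun.add_right blinfun.scaleR_right scaleR_add_right)

lemma eigenspace_orthogonal:
  assumes "positive_operator L" "u \<in> eigenspace L \<rho>" "v \<in> eigenspace L \<mu>" "\<rho> \<noteq> \<mu>"
  shows "u \<bullet> v = 0"
proof -
  have "\<rho> * (u \<bullet> v) = \<mu> * (u \<bullet> v)"
    using positive_operatorD(1)[OF assms(1), of u v] assms(2,3) by (simp add: eigenspace_def)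
  then show ?thesis using assms(4) by simp
qed

text \<open>If the eigenspaces did not span \<open>V\<close>, their orthogonal complement in
  \<open>V\<close> would be invariant and contain a further eigenvector. Injectivity on
  \<open>V\<close> excludes the eigenvalue 0, so every eigenvalue is the exponential of a real
  number. \<open>K\<close> is finite since one eigenvector for each exponent gives an orthogonal,
  hence independent, family in \<open>V\<close>.\<close>

lemma finite_dim_spectral:
  fixes L :: "'h::real_inner \<Rightarrow>\<^sub>L 'h"
  assumes J: "hilbert_scalars J" and L: "positive_operator L" "compact_operator L" "L o\<^sub>L J = J o\<^sub>L L"
    and V: "closed_subspace J V" "finite_dim V" "\<And>v. v \<in> V \<Longrightarrow> L v \<in> V" and inj: "\<And>v. v \<in> V \<Longrightarrow> L v = 0 \<Longrightarrow> v = 0"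
  defines "K \<equiv> {\<kappa>. V \<inter> eigenspace L (exp \<kappa>) \<noteq> {0}}"
  shows "finite K" and "hdim J V = (\<Sum>\<kappa>\<in>K. hdim J (V \<inter> eigenspace L (exp \<kappa>)))"
proof -
  have sV: "subspace V" and cV: "closed V" and JV: "\<And>v. v \<in> V \<Longrightarrow> J v \<in> V"
    using V(1) by (auto simp: closed_subspace_def)
  let ?E = "\<lambda>\<kappa>. V \<inter> eigenspace L (exp \<kappa>)"
  have sE: "subspace (?E \<kappa>)" for \<kappa> using sV subspace_eigenspace by (rule subspace_inter)
  have fE: "finite_dim (?E \<kappa>)" for \<kappa> using V(2) by (rule finite_dim_subset) auto
  have JE: "J v \<in> ?E \<kappa>" if "v \<in> ?E \<kappa>" for v \<kappa>
  proof -
    have "L (J v) = J (L v)" using L(3) by (metis blinfun_apply_blinfun_compose)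
    then show ?thesis using that JV by (auto simp: eigenspace_def blinfun.scaleR_right)
  qed
  have orth: "u \<bullet> v = 0" if "\<kappa> \<noteq> \<mu>" "u \<in> ?E \<kappa>" "v \<in> ?E \<mu>" for \<kappa> \<mu> u v
    using eigenspace_orthogonal[OF L(1), of u "exp \<kappa>" v "exp \<mu>"] that by auto
  have "\<exists>e. e \<in> ?E \<kappa> \<and> e \<noteq> 0" if "\<kappa> \<in> K" for \<kappa> using that subspace_0[OF sE[of \<kappa>]] unfolding K_def by blast
  then obtain e where e: "\<And>\<kappa>. \<kappa> \<in> K \<Longrightarrow> e \<kappa> \<in> ?E \<kappa> \<and> e \<kappa> \<noteq> 0" by metis
  have injE: "inj_on e K"
  proof (rule inj_onI, rule ccontr)
    fix \<kappa> \<mu> assume k: "\<kappa> \<in> K" "\<mu> \<in> K" "e \<kappa> = e \<mu>" "\<kappa> \<noteq> \<mu>"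
    then have "e \<kappa> \<bullet> e \<kappa> = 0" using orth[of \<kappa> \<mu> "e \<kappa>" "e \<mu>"] e[of \<kappa>] e[of \<mu>] by simp
    then show False using e[of \<kappa>] k(1) by simp
  qed
  have "independent (e ` K)"
  proof (rule pairwise_orthogonal_independent)
    show "pairwise orthogonal (e ` K)"
      unfolding pairwise_def orthogonal_def
    proof (intro ballI impI)
      fix x y assume "x \<in> e ` K" "y \<in> e ` K" "x \<noteq> y"
      then obtain \<kappa> \<mu> where "x = e \<kappa>" "y = e \<mu>" "\<kappa> \<in> K" "\<mu> \<in> K" "\<kappa> \<noteq> \<mu>" by auto
      then show "x \<bullet> y = 0" using orth[of \<kappa> \<mu> "e \<kappa>" "e \<mu>"] e[of \<kappa>] e[of \<mu>] by simp
    qed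
    show "0 \<notin> e ` K"
    proof
      assume "0 \<in> e ` K"
      then obtain \<kappa> where "0 = e \<kappa>" "\<kappa> \<in> K" by (rule imageE)
      then show False using e[of \<kappa>] by simp
    qed
  qed
  moreover obtain S where S: "finite S" "V \<subseteq> span S" using V(2) by (auto simp: finite_dim_def)
  moreover have "e ` K \<subseteq> span S"
  proof
    fix x assume "x \<in> e ` K"
    then obtain \<kappa> where "x = e \<kappa>" "\<kappa> \<in> K" by (rule imageE)
    then show "x \<in> span S" using e[of \<kappa>] S(2) by (simp add: subset_iff)
  qed
  ultimately have "finite (e ` K)" using independent_span_bound by blast
  then show finK: "finite K" using injE by (rule finite_imageD)
  define W where "W = span (\<Union>\<kappa>\<in>K. ?E \<kappa>)"
  have WV: "W \<subseteq> V" unfolding W_def using sV by (intro span_minimal) auto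
  have "W = V"
  proof (rule ccontr)
    assume "W \<noteq> V"
    then obtain x where x: "x \<in> V" "x \<notin> W" using WV by blast
    have sW: "subspace W" and fW: "finite_dim W" using WV V(2) by (auto simp: W_def intro: finite_dim_subset)
    obtain p where p: "p \<in> W" "\<And>w. w \<in> W \<Longrightarrow> (x - p) \<bullet> w = 0"
      using orthogonal_projection_exists[OF sW fW] by blast
    define C where "C = V \<inter> (\<Inter>w\<in>W. {v. v \<bullet> w = 0})"
    have sC: "subspace C" using sV by (auto simp: C_def subspace_def inner_left_distrib)
    have "closed {v. v \<bullet> w = 0}" for w :: 'h
      by (intro closed_Collect_eq continuous_intros)
    then have "closed (\<Inter>w\<in>W. {v. v \<bullet> w = 0})" by (intro closed_INT ballI)
    then have cC: "closed C" unfolding C_def using cV by (rule closed_Int[rotated])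
    have LW: "L w \<in> W" if "w \<in> W" for w
      using that unfolding W_def
    proof (induction rule: span_induct_alt)
      case base show ?case by (simp add: span_0)
    next
      case (step c x y)
      then obtain \<kappa> where \<kappa>: "\<kappa> \<in> K" "x \<in> ?E \<kappa>" by blast
      then have "L x = exp \<kappa> *\<^sub>R x" by (simp add: eigenspace_def)
      moreover have "x \<in> span (\<Union>\<kappa>\<in>K. ?E \<kappa>)" using \<kappa> by (intro span_base) blast
      ultimately show ?case using step(2) by (auto simp: blinfun.add_right blinfun.scaleR_right intro!: span_add span_scale)
    qed
    have LC: "L v \<in> C" if "v \<in> C" for v
    proof -
      have "L v \<bullet> w = 0" if "w \<in> W" for w
        using positive_operatorD(1)[OF L(1), of v w] LW[OF that] \<open>v \<in> C\<close> by (simp add: C_def)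
      then show ?thesis using that V(3) by (auto simp: C_def)
    qed
    have "x - p \<in> C" using x p WV sV by (auto simp: C_def subspace_diff)
    moreover have "x - p \<noteq> 0" using x p by auto
    ultimately have "C \<noteq> {0}" by blast
    from compact_positive_eigenvector[OF L(1,2) sC cC LC this]
    obtain v \<rho> where v: "v \<in> C" "norm v = 1" "\<rho> \<ge> 0" "L v = \<rho> *\<^sub>R v" by auto
    have v0: "v \<noteq> 0" using v(2) by auto
    have vV: "v \<in> V" using v(1) by (simp add: C_def)
    have "\<rho> \<noteq> 0"
    proof
      assume "\<rho> = 0"
      then have "L v = 0" by (simp add: v(4))
      then show False using inj[OF vV] v0 by blast
    qed
    then have ex: "exp (ln \<rho>) = \<rho>" using v(3) by simp
    have vE: "v \<in> ?E (ln \<rho>)" using vV by (simp add: eigenspace_def ex v(4))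
    have "?E (ln \<rho>) \<noteq> {0}"
    proof
      assume "?E (ln \<rho>) = {0}"
      with vE have "v \<in> {0}" by (rule subst[rotated])
      then show False using v0 by simp
    qed
    then have "ln \<rho> \<in> K" unfolding K_def by (rule CollectI)
    then have "v \<in> (\<Union>\<kappa>\<in>K. ?E \<kappa>)" using vE by (rule UN_I)
    then have "v \<in> W" unfolding W_def by (rule span_base)
    moreover have "\<forall>w\<in>W. v \<bullet> w = 0" using v(1) by (simp add: C_def)
    ultimately have "v \<bullet> v = 0" by (rule bspec[rotated])
    then show False using v0 by simp
  qed
  then have "hdim J V = hdim J (span (\<Union>\<kappa>\<in>K. ?E \<kappa>))" by (simp add: W_def)
  also have "\<dots> = (\<Sum>\<kappa>\<in>K. hdim J (?E \<kappa>))"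
  proof (rule hdim_orthogonal_sum[where V = ?E, OF J finK sE fE JE])
    show "finite_dim (span (\<Union>\<kappa>\<in>K. ?E \<kappa>))" using \<open>W = V\<close> V(2) by (simp add: W_def)
    show "u \<bullet> v = 0" if "i \<noteq> j" "u \<in> ?E i" "v \<in> ?E j" for i j u v using orth[OF that] .
  qed
  finally show "hdim J V = (\<Sum>\<kappa>\<in>K. hdim J (?E \<kappa>))" .
qed

section \<open>Iterates and the Lyapunov operator\<close>

lemma lyapunov_approx_gram:
  fixes A :: "'x \<Rightarrow> 'h::{real_inner, banach} \<Rightarrow>\<^sub>L 'h"
  shows "lyapunov_approx f A x n = positive_root (2 * n) (gram (iterate f A n x))"
  by (simp add: lyapunov_approx_def gram_def)

lemma gram_commuteI:
  fixes R :: "'h::{real_inner, banach} \<Rightarrow>\<^sub>L 'h"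
  assumes "\<And>u v. gram C (R u) \<bullet> v = R (gram C u) \<bullet> v"
  shows "R o\<^sub>L gram C = gram C o\<^sub>L R"
proof (rule blinfun_eqI)
  fix u
  have "gram C (R u) = R (gram C u)" using assms by (intro vector_eq_rdot[THEN iffD1]) blast
  then show "(R o\<^sub>L gram C) u = (gram C o\<^sub>L R) u" by simp
qed

text \<open>Equivariant families of selfadjoint operators. Selfadjointness lets them pass the
  adjoint of an iterate as well, so they commute with the Gram operator of every iterate.\<close>

definition reducing :: "('x \<Rightarrow> 'x) \<Rightarrow> ('x \<Rightarrow> 'h::real_inner \<Rightarrow>\<^sub>L 'h) \<Rightarrow> ('x \<Rightarrow> 'h \<Rightarrow>\<^sub>L 'h) \<Rightarrow> bool" where
  "reducing f A Q \<longleftrightarrow> (\<forall>x u v. Q x u \<bullet> v = u \<bullet> Q x v) \<and> (\<forall>x v. A x (Q x v) = Q (f x) (A x v))"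

lemma reducing_square: "reducing f A H \<Longrightarrow> reducing f A (\<lambda>x. H x o\<^sub>L H x)"
  by (simp add: reducing_def)

lemma lower_bound_scale:
  fixes T :: "'h::real_normed_vector \<Rightarrow>\<^sub>L 'h"
  assumes "subspace V" "\<And>v. v \<in> V \<Longrightarrow> norm v = 1 \<Longrightarrow> \<theta> \<le> norm (T v)" "v \<in> V"
  shows "\<theta> * norm v \<le> norm (T v)"
proof (cases "v = 0")
  case False
  have "\<theta> \<le> norm (T ((1 / norm v) *\<^sub>R v))"
    using assms False by (intro assms(2)) (auto simp: subspace_scale)
  then show ?thesis using False by (simp add: blinfun.scaleR_right field_simps)
qed simp

lemma domination_scale:
  fixes T :: "'h::real_normed_vector \<Rightarrow>\<^sub>L 'h"
  assumes V: "subspace V1" "subspace V2"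
    and le: "\<And>u v. u \<in> V2 \<Longrightarrow> v \<in> V1 \<Longrightarrow> norm u = 1 \<Longrightarrow> norm v = 1 \<Longrightarrow> norm (T u) \<le> \<alpha> * norm (T v)"
    and u: "u \<in> V2" and v: "v \<in> V1"
  shows "norm (T u) * norm v \<le> \<alpha> * norm (T v) * norm u"
proof (cases "u = 0 \<or> v = 0")
  case False
  then have nz: "norm u > 0" "norm v > 0" by auto
  have "norm (T ((1 / norm u) *\<^sub>R u)) \<le> \<alpha> * norm (T ((1 / norm v) *\<^sub>R v))"
    using V u v nz by (intro le) (auto simp: subspace_scale)
  then have "norm (T u) / norm u \<le> \<alpha> * (norm (T v) / norm v)"
    using nz by (simp add: blinfun.scaleR_right)
  then show ?thesis using nz by (simp add: field_simps)
qed auto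

section \<open>Composition with compact operators\<close>

lemma compact_operatorI:
  fixes T :: "'h::real_normed_vector \<Rightarrow>\<^sub>L 'h"
  assumes "compact K" "T ` cball 0 1 \<subseteq> K"
  shows "compact_operator T"
proof -
  have "closure (T ` cball 0 1) \<subseteq> K"
    by (rule closure_minimal[OF assms(2) compact_imp_closed[OF assms(1)]])
  then have "K \<inter> closure (T ` cball 0 1) = closure (T ` cball 0 1)" by (rule Int_absorb1)
  moreover have "compact (K \<inter> closure (T ` cball 0 1))" by (rule compact_Int_closed[OF assms(1) closed_closure])
  ultimately show ?thesis by (simp only: compact_operator_def)
qed

lemma compact_operator_compose_left:
  fixes T :: "'h::real_normed_vector \<Rightarrow>\<^sub>L 'h"
  assumes "compact_operator T"
  shows "compact_operator (C o\<^sub>L T)"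
proof (rule compact_operatorI)
  show "compact (C ` closure (T ` cball 0 1))"
    using assms unfolding compact_operator_def
    by (intro compact_continuous_image linear_continuous_on blinfun.bounded_linear_right)
  show "(C o\<^sub>L T) ` cball 0 1 \<subseteq> C ` closure (T ` cball 0 1)"
    using closure_subset[of "T ` cball 0 1"] by auto
qed

lemma compact_operator_compose_right:
  fixes T :: "'h::real_normed_vector \<Rightarrow>\<^sub>L 'h"
  assumes "compact_operator T"
  shows "compact_operator (T o\<^sub>L C)"
proof (rule compact_operatorI)
  \<comment> \<open>Radius of a ball that contains the image of the unit ball under
    \<open>C\<close>, kept positive when \<open>C\<close> is zero.\<close>
  let ?c = "norm C + 1"
  have c: "?c > 0" by (simp add: add_nonneg_pos)
  show "compact ((\<lambda>y. ?c *\<^sub>R y) ` closure (T ` cball 0 1))"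
    using assms unfolding compact_operator_def by (rule compact_scaling)
  show "(T o\<^sub>L C) ` cball 0 1 \<subseteq> (\<lambda>y. ?c *\<^sub>R y) ` closure (T ` cball 0 1)"
  proof (rule image_subsetI)
    fix v :: 'h assume v: "v \<in> cball 0 1"
    have "norm (C v) \<le> norm C * norm v" by (rule norm_blinfun)
    also have "\<dots> \<le> norm C * 1" using v by (intro mult_left_mono) auto
    finally have "norm (C v) \<le> ?c" by simp
    then have "(1 / ?c) *\<^sub>R C v \<in> cball 0 1" using c by simp
    then have "T ((1 / ?c) *\<^sub>R C v) \<in> closure (T ` cball 0 1)" by (intro subsetD[OF closure_subset] imageI)
    moreover have "(T o\<^sub>L C) v = ?c *\<^sub>R T ((1 / ?c) *\<^sub>R C v)" using c by (simp add: blinfun.scaleR_right)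
    ultimately show "(T o\<^sub>L C) v \<in> (\<lambda>y. ?c *\<^sub>R y) ` closure (T ` cball 0 1)" by (rule rev_image_eqI)
  qed
qed

context
  fixes f :: "'x \<Rightarrow> 'x" and A :: "'x \<Rightarrow> 'h::{real_inner, banach} \<Rightarrow>\<^sub>L 'h"
begin

lemma positive_lyapunov_approx: "n > 0 \<Longrightarrow> positive_operator (lyapunov_approx f A x n)"
  unfolding lyapunov_approx_gram by (rule positive_root_works(1)[OF positive_gram]) auto

lemma lyapunov_approx_power:
  "n > 0 \<Longrightarrow> blinfun_apply (lyapunov_approx f A x n) ^^ (2 * n) = blinfun_apply (gram (iterate f A n x))"
  unfolding lyapunov_approx_gram by (rule positive_root_works(2)[OF positive_gram]) auto

lemma lyapunov_approx_commute:
  "n > 0 \<Longrightarrow> R o\<^sub>L gram (iterate f A n x) = gram (iterate f A n x) o\<^sub>L R \<Longrightarrow>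
    R o\<^sub>L lyapunov_approx f A x n = lyapunov_approx f A x n o\<^sub>L R"
  unfolding lyapunov_approx_gram by (rule positive_root_works(3)[OF positive_gram]) auto

text \<open>The bridge from roots to dynamics: the n-th power of the approximant is the modulus of
  the n-th iterate, hence has the same norms.\<close>

lemma norm_lyapunov_approx_power:
  assumes "n > 0"
  shows "norm ((blinfun_apply (lyapunov_approx f A x n) ^^ n) v) = norm (iterate f A n x v)"
proof -
  let ?S = "lyapunov_approx f A x n"
  have "(blinfun_apply ?S ^^ n) v \<bullet> (blinfun_apply ?S ^^ n) v = (blinfun_apply ?S ^^ n) ((blinfun_apply ?S ^^ n) v) \<bullet> v"
    by (rule positive_operator_funpow[OF positive_lyapunov_approx[OF assms], symmetric])
  also have "(blinfun_apply ?S ^^ n) ((blinfun_apply ?S ^^ n) v) = (blinfun_apply ?S ^^ (2 * n)) v"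
    by (simp only: mult_2 funpow_add o_apply)
  also have "(blinfun_apply ?S ^^ (2 * n)) v = gram (iterate f A n x) v"
    by (simp only: lyapunov_approx_power[OF assms])
  finally show ?thesis by (simp add: gram_inner norm_eq_sqrt_inner)
qed

lemma iterate_add: "iterate f A (m + n) x = iterate f A m ((f ^^ n) x) o\<^sub>L iterate f A n x"
proof (induction m)
  case (Suc m)
  have "(f ^^ (m + n)) x = (f ^^ m) ((f ^^ n) x)" by (simp only: funpow_add o_apply)
  then show ?case using Suc by (intro blinfun_eqI) simp
qed (auto intro: blinfun_eqI)

lemma iterate_invariant:
  assumes "\<And>x v. v \<in> E x \<Longrightarrow> A x v \<in> E (f x)" and "v \<in> E x"
  shows "iterate f A n x v \<in> E ((f ^^ n) x)"
  using assms(2) by (induction n) (auto intro: assms(1))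

lemma reducing_iterate:
  assumes "reducing f A Q"
  shows "iterate f A n x (Q x v) = Q ((f ^^ n) x) (iterate f A n x v)"
  using assms by (induction n) (auto simp: reducing_def)

text \<open>Equivariance carries the operator along the orbit, symmetry moves it across the inner
  product there, and equivariance brings it back to \<open>x\<close>.\<close>

lemma reducing_gram:
  assumes Q: "reducing f A Q"
  shows "Q x o\<^sub>L gram (iterate f A n x) = gram (iterate f A n x) o\<^sub>L Q x"
proof (rule gram_commuteI)
  fix u v
  let ?C = "iterate f A n x" and ?y = "(f ^^ n) x"
  have sym: "Q y a \<bullet> b = a \<bullet> Q y b" for y a b using Q by (auto simp: reducing_def)
  have "gram ?C (Q x u) \<bullet> v = Q ?y (?C u) \<bullet> ?C v" by (simp only: gram_inner reducing_iterate[OF Q])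
  also have "\<dots> = ?C u \<bullet> ?C (Q x v)" by (simp only: sym reducing_iterate[OF Q])
  also have "\<dots> = gram ?C u \<bullet> Q x v" by (simp only: gram_inner)
  also have "\<dots> = Q x (gram ?C u) \<bullet> v" by (simp only: sym)
  finally show "gram ?C (Q x u) \<bullet> v = Q x (gram ?C u) \<bullet> v" .
qed

lemma reducing_lyapunov_approx:
  "reducing f A Q \<Longrightarrow> n > 0 \<Longrightarrow> Q x o\<^sub>L lyapunov_approx f A x n = lyapunov_approx f A x n o\<^sub>L Q x"
  by (rule lyapunov_approx_commute[OF _ reducing_gram])

lemma scalars_iterate:
  assumes "\<And>x. A x o\<^sub>L J = J o\<^sub>L A x"
  shows "iterate f A n x (J v) = J (iterate f A n x v)"
proof (induction n)
  case (Suc n)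
  have "A y (J v) = J (A y v)" for y v using assms[of y] by (metis blinfun_apply_blinfun_compose)
  then show ?case using Suc by simp
qed simp

text \<open>A complex structure is skew instead of symmetric, so \<open>reducing_gram\<close> does
  not cover it; the two signs cancel.\<close>

lemma scalars_gram:
  assumes J: "hilbert_scalars J" and A: "\<And>x. A x o\<^sub>L J = J o\<^sub>L A x"
  shows "J o\<^sub>L gram (iterate f A n x) = gram (iterate f A n x) o\<^sub>L J"
  using J
proof (cases rule: hilbert_scalars_cases)
  case 1 then show ?thesis by (auto intro: blinfun_eqI)
next
  case 2
  let ?C = "iterate f A n x"
  have skew: "J u \<bullet> w = - (u \<bullet> J w)" for u w using 2(2)[of u "J w"] by (simp add: 2(1))
  show ?thesis
  proof (rule gram_commuteI)
    fix u v
    have "gram ?C (J u) \<bullet> v = J (?C u) \<bullet> ?C v" by (simp only: gram_inner scalars_iterate[OF A])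
    also have "\<dots> = - (?C u \<bullet> ?C (J v))" by (simp only: skew scalars_iterate[OF A])
    also have "\<dots> = J (gram ?C u) \<bullet> v" by (simp only: gram_inner[symmetric] skew)
    finally show "gram ?C (J u) \<bullet> v = J (gram ?C u) \<bullet> v" .
  qed
qed

section \<open>The Lyapunov operator as a limit\<close>

text \<open>At index 0 a zeroth root would be taken, about which \<open>positive_root\<close> says
  nothing. All limits therefore run over successors.\<close>

lemma lyapunov_approx_tendsto:
  "convergent (lyapunov_approx f A x) \<Longrightarrow> (\<lambda>n. lyapunov_approx f A x (Suc n)) \<longlonglongrightarrow> lyapunov_operator f A x"
  unfolding lyapunov_operator_def
  by (rule LIMSEQ_Suc) (rule convergent_LIMSEQ_iff[THEN iffD1])

lemma lyapunov_operator_commute: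
  assumes conv: "convergent (lyapunov_approx f A x)"
    and com: "\<And>n. n > 0 \<Longrightarrow> R o\<^sub>L lyapunov_approx f A x n = lyapunov_approx f A x n o\<^sub>L R"
  shows "R o\<^sub>L lyapunov_operator f A x = lyapunov_operator f A x o\<^sub>L R"
proof -
  note lim = lyapunov_approx_tendsto[OF conv]
  have "(\<lambda>n. R o\<^sub>L lyapunov_approx f A x (Suc n)) \<longlonglongrightarrow> (R o\<^sub>L lyapunov_operator f A x)"
    by (intro blinfun_compose.tendsto tendsto_const lim)
  also have "(\<lambda>n. R o\<^sub>L lyapunov_approx f A x (Suc n)) = (\<lambda>n. lyapunov_approx f A x (Suc n) o\<^sub>L R)"
    by (rule ext) (rule com[OF zero_less_Suc])
  finally have "(\<lambda>n. lyapunov_approx f A x (Suc n) o\<^sub>L R) \<longlonglongrightarrow> (R o\<^sub>L lyapunov_operator f A x)" .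
  moreover have "(\<lambda>n. lyapunov_approx f A x (Suc n) o\<^sub>L R) \<longlonglongrightarrow> (lyapunov_operator f A x o\<^sub>L R)"
    by (intro blinfun_compose.tendsto tendsto_const lim)
  ultimately show ?thesis by (rule LIMSEQ_unique)
qed

lemma positive_lyapunov_operator:
  assumes conv: "convergent (lyapunov_approx f A x)"
  shows "positive_operator (lyapunov_operator f A x)"
proof -
  note lim = lyapunov_approx_tendsto[OF conv]
  let ?S = "\<lambda>n. lyapunov_approx f A x (Suc n)" and ?L = "lyapunov_operator f A x"
  have l: "(\<lambda>n. ?S n u \<bullet> v) \<longlonglongrightarrow> ?L u \<bullet> v" for u v
    by (intro tendsto_inner blinfun.tendsto tendsto_const lim)
  have r: "(\<lambda>n. u \<bullet> ?S n v) \<longlonglongrightarrow> u \<bullet> ?L v" for u v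
    by (intro tendsto_inner blinfun.tendsto tendsto_const lim)
  have "?L u \<bullet> v = u \<bullet> ?L v" for u v
  proof (rule LIMSEQ_unique[OF l])
    have "(\<lambda>n. ?S n u \<bullet> v) = (\<lambda>n. u \<bullet> ?S n v)"
      by (rule ext) (rule positive_operatorD(1)[OF positive_lyapunov_approx[OF zero_less_Suc]])
    then show "(\<lambda>n. ?S n u \<bullet> v) \<longlonglongrightarrow> u \<bullet> ?L v" using r[of u v] by (simp only:)
  qed
  moreover have "0 \<le> ?L v \<bullet> v" for v
    by (rule LIMSEQ_le_const[OF l])
      (use positive_operatorD(2)[OF positive_lyapunov_approx[OF zero_less_Suc]] in blast)
  ultimately show ?thesis unfolding positive_operator_def by (intro conjI allI)
qed

text \<open>The subsequence \<open>r\<close> admits bounds that are available only at multiples of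
  the block length of a domination.\<close>

lemma lyapunov_operator_lower_bound:
  assumes conv: "convergent (lyapunov_approx f A x)"
    and r: "strict_mono (r :: nat \<Rightarrow> nat)" and lim: "c \<longlonglongrightarrow> c'"
    and bound: "\<And>n. c n \<le> lyapunov_approx f A x (Suc (r n)) v \<bullet> v"
  shows "c' \<le> lyapunov_operator f A x v \<bullet> v"
proof (rule LIMSEQ_le[OF lim])
  have "(\<lambda>n. lyapunov_approx f A x (Suc n) v \<bullet> v) \<longlonglongrightarrow> lyapunov_operator f A x v \<bullet> v"
    by (intro tendsto_inner blinfun.tendsto tendsto_const lyapunov_approx_tendsto[OF conv])
  from LIMSEQ_subseq_LIMSEQ[OF this r]
  show "(\<lambda>n. lyapunov_approx f A x (Suc (r n)) v \<bullet> v) \<longlonglongrightarrow> lyapunov_operator f A x v \<bullet> v"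
    by (simp add: o_def)
  show "\<exists>N. \<forall>n\<ge>N. c n \<le> lyapunov_approx f A x (Suc (r n)) v \<bullet> v" using bound by blast
qed

section \<open>Domination orders the exponents\<close>

lemma dominatedD:
  assumes "dominated J f A UNIV l \<alpha> E1 E2"
  shows "subspace (E1 x)" "subspace (E2 x)" "closed_subspace J (E1 x)" "closed_subspace J (E2 x)"
    and "v \<in> E1 x \<Longrightarrow> A x v \<in> E1 (f x)" "v \<in> E2 x \<Longrightarrow> A x v \<in> E2 (f x)"
    and "E1 x \<inter> E2 x = {0}"
    and "hdim J (E1 x) = hdim J (E1 y)" "hdim J (E2 x) = hdim J (E2 y)"
    and "\<exists>\<theta>>0. \<forall>x. \<forall>v\<in>E1 x. norm v = 1 \<longrightarrow> \<theta> \<le> norm (A x v)"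
    and "u \<in> E2 x \<Longrightarrow> v \<in> E1 x \<Longrightarrow> norm u = 1 \<Longrightarrow> norm v = 1 \<Longrightarrow>
      norm (iterate f A l x u) \<le> \<alpha> * norm (iterate f A l x v)"
proof -
  note d = assms[unfolded dominated_def]
  note d1 = conjunct1[OF d] and d2 = conjunct1[OF conjunct2[OF d]]
    and d3 = conjunct1[OF conjunct2[OF conjunct2[OF d]]] and d4 = conjunct2[OF conjunct2[OF conjunct2[OF d]]]
  show c: "closed_subspace J (E1 x)" "closed_subspace J (E2 x)" and "E1 x \<inter> E2 x = {0}"
    using bspec[OF d1 UNIV_I[of x]] by simp_all
  then show "subspace (E1 x)" "subspace (E2 x)" by (simp_all add: closed_subspace_def)
  show "v \<in> E1 x \<Longrightarrow> A x v \<in> E1 (f x)" "v \<in> E2 x \<Longrightarrow> A x v \<in> E2 (f x)"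
    using bspec[OF d2 UNIV_I[of x]] by (simp_all add: image_subset_iff)
  from d3 obtain e1 e2 where "\<And>x. hdim J (E1 x) = e1" "\<And>x. hdim J (E2 x) = e2" by auto
  then show "hdim J (E1 x) = hdim J (E1 y)" "hdim J (E2 x) = hdim J (E2 y)" by simp_all
  from d4 obtain \<theta> where \<theta>: "\<theta> > 0" "\<forall>x\<in>UNIV. (\<forall>v\<in>E1 x. norm v = 1 \<longrightarrow> \<theta> \<le> norm (A x v)) \<and>
      (\<forall>u\<in>E2 x. \<forall>v\<in>E1 x. norm u = 1 \<longrightarrow> norm v = 1 \<longrightarrow> norm (iterate f A l x u) \<le> \<alpha> * norm (iterate f A l x v))"
    by (elim conjE exE) (rule that)
  show "\<exists>\<theta>>0. \<forall>x. \<forall>v\<in>E1 x. norm v = 1 \<longrightarrow> \<theta> \<le> norm (A x v)"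
    using \<theta> by (intro exI[of _ \<theta>]) simp
  show "u \<in> E2 x \<Longrightarrow> v \<in> E1 x \<Longrightarrow> norm u = 1 \<Longrightarrow> norm v = 1 \<Longrightarrow>
      norm (iterate f A l x u) \<le> \<alpha> * norm (iterate f A l x v)"
    using \<theta>(2) by simp
qed

lemma iterate_lower_bound:
  assumes inv: "\<And>x v. v \<in> E x \<Longrightarrow> A x v \<in> E (f x)" and \<theta>: "\<theta> \<ge> 0"
    and le: "\<And>x v. v \<in> E x \<Longrightarrow> \<theta> * norm v \<le> norm (A x v)" and v: "v \<in> E x"
  shows "\<theta> ^ n * norm v \<le> norm (iterate f A n x v)"
proof (induction n)
  case (Suc n)
  have "\<theta> ^ Suc n * norm v \<le> \<theta> * norm (iterate f A n x v)" using Suc \<theta> by (simp add: mult.assoc mult_left_mono)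
  also have "\<dots> \<le> norm (A ((f ^^ n) x) (iterate f A n x v))"
    by (rule le, rule iterate_invariant[where E = E, OF inv v])
  finally show ?case by simp
qed simp

text \<open>Induction over blocks of length \<open>l\<close>. The homogeneous form of domination on
  one block has to be divided by the norm of the image of \<open>v\<close>, which the lower bound on
  \<open>E1\<close> keeps away from 0.\<close>

lemma dominated_iterate:
  assumes dom: "dominated J f A UNIV l \<alpha> E1 E2" and \<alpha>: "\<alpha> \<ge> 0" and u: "u \<in> E2 x" and v: "v \<in> E1 x"
  shows "norm (iterate f A (n * l) x u) * norm v \<le> \<alpha> ^ n * norm (iterate f A (n * l) x v) * norm u"
proof (cases "v = 0")
  case False
  note d = dominatedD[OF dom]
  obtain \<theta> where \<theta>: "\<theta> > 0" "\<And>x v. v \<in> E1 x \<Longrightarrow> norm v = 1 \<Longrightarrow> \<theta> \<le> norm (A x v)" using d(10) by blast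
  have \<theta>': "\<theta> * norm v \<le> norm (A x v)" if "v \<in> E1 x" for x v
    by (rule lower_bound_scale[OF d(1) \<theta>(2) that])
  show ?thesis
  proof (induction n)
    case 0 show ?case by (simp add: mult.commute)
  next
    case (Suc n)
    define y where "y = (f ^^ (n * l)) x"
    define u' v' where "u' = iterate f A (n * l) x u" and "v' = iterate f A (n * l) x v"
    have u': "u' \<in> E2 y" unfolding u'_def y_def by (rule iterate_invariant[where E = E2, OF d(6) u])
    have v': "v' \<in> E1 y" unfolding v'_def y_def by (rule iterate_invariant[where E = E1, OF d(5) v])
    have "0 < \<theta> ^ (n * l) * norm v" using \<theta>(1) False by simp
    also have "\<dots> \<le> norm v'" unfolding v'_def
      by (rule iterate_lower_bound[where E = E1, OF d(5) less_imp_le[OF \<theta>(1)] \<theta>' v])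
    finally have nv': "norm v' > 0" .
    let ?T = "iterate f A l y"
    have "norm (?T u') * norm v' \<le> \<alpha> * norm (?T v') * norm u'"
      by (rule domination_scale[OF d(1,2) d(11) u' v'])
    then have "norm (?T u') * norm v' * norm v \<le> \<alpha> * norm (?T v') * norm u' * norm v"
      by (intro mult_right_mono) auto
    also have "\<dots> = \<alpha> * norm (?T v') * (norm u' * norm v)" by (simp only: mult.assoc)
    also have "\<dots> \<le> \<alpha> * norm (?T v') * (\<alpha> ^ n * norm v' * norm u)"
      using Suc \<alpha> unfolding u'_def v'_def by (intro mult_left_mono) auto
    also have "\<dots> = (\<alpha> ^ Suc n * norm (?T v') * norm u) * norm v'" by simp
    finally have "(norm (?T u') * norm v) * norm v' \<le> (\<alpha> ^ Suc n * norm (?T v') * norm u) * norm v'"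
      by (simp add: mult_ac)
    then have "norm (?T u') * norm v \<le> \<alpha> ^ Suc n * norm (?T v') * norm u" using nv' by simp
    moreover have "iterate f A (Suc n * l) x w = ?T (iterate f A (n * l) x w)" for w
      by (simp only: mult_Suc iterate_add y_def blinfun_apply_blinfun_compose)
    ultimately show ?case by (simp only: u'_def v'_def)
  qed
qed simp

text \<open>Iterates expand vectors of \<open>E1\<close> by at least \<theta> per step.
  \<open>power_lower_bound\<close> extracts the root of this estimate as a bound on Rayleigh
  quotients, which survives the limit. So the Lyapunov operator is injective on a dominating bundle,
  and the exponents there are finite.\<close>

lemma dominated_lyapunov_lower_bound:
  assumes dom: "dominated J f A UNIV l \<alpha> E1 E2" and conv: "convergent (lyapunov_approx f A x)"
    and inv: "\<And>n v. n > 0 \<Longrightarrow> v \<in> E1 x \<Longrightarrow> lyapunov_approx f A x n v \<in> E1 x"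
  shows "\<exists>\<theta>>0. \<forall>v\<in>E1 x. norm v = 1 \<longrightarrow> \<theta> \<le> lyapunov_operator f A x v \<bullet> v"
proof -
  note d = dominatedD[OF dom]
  obtain \<theta> where \<theta>: "\<theta> > 0" "\<And>x v. v \<in> E1 x \<Longrightarrow> norm v = 1 \<Longrightarrow> \<theta> \<le> norm (A x v)" using d(10) by blast
  have \<theta>': "\<theta> * norm v \<le> norm (A x v)" if "v \<in> E1 x" for x v
    by (rule lower_bound_scale[OF d(1) \<theta>(2) that])
  have "\<theta> \<le> lyapunov_operator f A x v \<bullet> v" if v: "v \<in> E1 x" "norm v = 1" for v
  proof (rule lyapunov_operator_lower_bound[OF conv, where r = "\<lambda>n. n" and c = "\<lambda>_. \<theta>"])
    fix n
    show "\<theta> \<le> lyapunov_approx f A x (Suc n) v \<bullet> v"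
    proof (rule power_lower_bound[OF positive_lyapunov_approx[OF zero_less_Suc] d(1) inv[OF zero_less_Suc] zero_less_Suc])
      show "\<theta> ^ Suc n \<le> norm ((blinfun_apply (lyapunov_approx f A x (Suc n)) ^^ Suc n) w)"
        if "w \<in> E1 x" "norm w = 1" for w
        unfolding norm_lyapunov_approx_power[OF zero_less_Suc]
        using iterate_lower_bound[where E = E1 and n = "Suc n", OF d(5) less_imp_le[OF \<theta>(1)] \<theta>' that(1)] that(2) by (simp only: mult_1_right)
    qed (use \<theta>(1) v in auto)
  qed (auto simp: strict_mono_def)
  then show ?thesis using \<theta>(1) by blast
qed

text \<open>At the times that are multiples of \<open>l\<close>, \<open>power_jensen\<close> bounds
  a power of the Rayleigh quotient of \<open>u\<close> by the growth of \<open>u\<close>. Domination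
  compares this with the growth of every unit vector of \<open>E1\<close>, and
  \<open>power_lower_bound\<close> converts that into a bound on the quotient of \<open>v\<close>.
  In the limit the quotients are the eigenvalues.\<close>

lemma dominated_eigenvalues:
  assumes dom: "dominated J f A UNIV l \<alpha> E1 E2" and \<alpha>: "\<alpha> > 0" and conv: "convergent (lyapunov_approx f A x)"
    and inv: "\<And>n v. n > 0 \<Longrightarrow> v \<in> E1 x \<Longrightarrow> lyapunov_approx f A x n v \<in> E1 x"
    and u: "u \<in> E2 x" "u \<noteq> 0" "lyapunov_operator f A x u = \<rho> *\<^sub>R u"
    and v: "v \<in> E1 x" "v \<noteq> 0" "lyapunov_operator f A x v = \<tau> *\<^sub>R v"
  shows "\<rho> ^ l \<le> \<alpha> * \<tau> ^ l"
proof -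
  note d = dominatedD[OF dom]
  let ?L = "lyapunov_operator f A x"
  define u1 where "u1 = (1 / norm u) *\<^sub>R u"
  define v1 where "v1 = (1 / norm v) *\<^sub>R v"
  have u1: "u1 \<in> E2 x" "norm u1 = 1" "?L u1 = \<rho> *\<^sub>R u1"
    using u d(2) by (auto simp: u1_def subspace_scale blinfun.scaleR_right)
  have v1: "v1 \<in> E1 x" "norm v1 = 1" "?L v1 = \<tau> *\<^sub>R v1"
    using v d(1) by (auto simp: v1_def subspace_scale blinfun.scaleR_right)
  have Lu: "?L u1 \<bullet> u1 = \<rho>" and Lv: "?L v1 \<bullet> v1 = \<tau>" using u1 v1 by (simp_all add: norm_eq_1)
  have \<rho>: "\<rho> \<ge> 0" using positive_operatorD(2)[OF positive_lyapunov_operator[OF conv], of u1] Lu by simp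
  have dom1: "norm (iterate f A (n * l) x u1) \<le> \<alpha> ^ n * norm (iterate f A (n * l) x w)" if "w \<in> E1 x" "norm w = 1" for n w
    using dominated_iterate[OF dom less_imp_le[OF \<alpha>] u1(1) that(1), of n] u1(2) that(2) by simp
  show ?thesis
  proof (cases "l = 0")
    \<comment> \<open>Domination over zero steps compares the unit vectors themselves and forces
      \<alpha> to be at least 1.\<close>
    case True
    then show ?thesis using dom1[OF v1(1,2), of 1] u1(2) v1(2) by simp
  next
    case False
    then have l: "l > 0" by simp
    \<comment> \<open>The domination constant per single step.\<close>
    define \<gamma> where "\<gamma> = root l \<alpha>"
    have \<gamma>: "\<gamma> > 0" "\<gamma> ^ l = \<alpha>" using l \<alpha> by (auto simp: \<gamma>_def)
    \<comment> \<open>Approximants are indexed by successors, so \<open>Suc (r n)\<close> is the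
      time \<open>Suc n * l\<close>.\<close>
    define r where "r n = Suc n * l - 1" for n
    have Sr: "Suc (r n) = Suc n * l" for n using l by (simp add: r_def)
    have r: "strict_mono r"
    proof (rule strict_monoI_Suc)
      show "r n < r (Suc n)" for n using Sr[of n] Sr[of "Suc n"] l by simp
    qed
    define c where "c n = lyapunov_approx f A x (Suc (r n)) u1 \<bullet> u1 / \<gamma>" for n
    have lim: "c \<longlonglongrightarrow> \<rho> / \<gamma>"
    proof -
      have "(\<lambda>n. lyapunov_approx f A x (Suc n) u1 \<bullet> u1) \<longlonglongrightarrow> \<rho>"
        unfolding Lu[symmetric]
        by (intro tendsto_inner blinfun.tendsto tendsto_const lyapunov_approx_tendsto[OF conv])
      from LIMSEQ_subseq_LIMSEQ[OF this r]
      have "(\<lambda>n. lyapunov_approx f A x (Suc (r n)) u1 \<bullet> u1 / \<gamma>) \<longlonglongrightarrow> \<rho> / \<gamma>"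
        using \<gamma>(1) by (intro tendsto_divide tendsto_const) (auto simp: o_def)
      then show ?thesis by (simp only: c_def[abs_def])
    qed
    have "\<rho> / \<gamma> \<le> ?L v1 \<bullet> v1"
    proof (rule lyapunov_operator_lower_bound[OF conv r lim])
      fix n
      let ?S = "lyapunov_approx f A x (Suc (r n))"
      have S: "positive_operator ?S" by (rule positive_lyapunov_approx[OF zero_less_Suc])
      have nrm: "norm ((blinfun_apply ?S ^^ Suc (r n)) w) = norm (iterate f A (Suc n * l) x w)" for w
        by (simp only: norm_lyapunov_approx_power[OF zero_less_Suc]) (simp only: Sr)
      show "c n \<le> ?S v1 \<bullet> v1"
      proof (rule power_lower_bound[OF S d(1) inv[OF zero_less_Suc] zero_less_Suc _ _ v1(1,2)])
        show "0 \<le> c n" using positive_operatorD(2)[OF S, of u1] \<gamma>(1) by (simp add: c_def)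
        fix w assume w: "w \<in> E1 x" "norm w = 1"
        have "(?S u1 \<bullet> u1) ^ Suc (r n) \<le> norm ((blinfun_apply ?S ^^ Suc (r n)) u1)"
          by (rule power_jensen[OF S u1(2)])
        also have "\<dots> = norm (iterate f A (Suc n * l) x u1)"
          by (rule nrm)
        also have "\<dots> \<le> \<alpha> ^ Suc n * norm (iterate f A (Suc n * l) x w)" by (rule dom1[OF w])
        also have "norm (iterate f A (Suc n * l) x w) = norm ((blinfun_apply ?S ^^ Suc (r n)) w)"
          by (rule nrm[symmetric])
        also have "\<alpha> ^ Suc n = \<gamma> ^ Suc (r n)"
          unfolding Sr \<gamma>(2)[symmetric] power_mult[symmetric] by (simp only: mult.commute)
        finally have "(?S u1 \<bullet> u1) ^ Suc (r n) / \<gamma> ^ Suc (r n) \<le> norm ((blinfun_apply ?S ^^ Suc (r n)) w)"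
          using \<gamma>(1) by (simp only: pos_divide_le_eq zero_less_power mult.commute)
        then show "c n ^ Suc (r n) \<le> norm ((blinfun_apply ?S ^^ Suc (r n)) w)"
          unfolding c_def power_divide .
      qed
    qed
    then have "\<rho> \<le> \<gamma> * \<tau>" using \<gamma>(1) Lv by (simp add: field_simps)
    then have "\<rho> ^ l \<le> (\<gamma> * \<tau>) ^ l" using \<rho> by (rule power_mono)
    then show ?thesis by (simp add: power_mult_distrib \<gamma>(2))
  qed
qed

section \<open>Perturbation by a reducing family\<close>

text \<open>Equivariance moves all factors \<open>C\<close> back along the orbit to the starting
  point.\<close>

lemma iterate_perturbed:
  assumes "reducing f A C"
  shows "iterate f (\<lambda>x. A x o\<^sub>L C x) n x v = iterate f A n x ((blinfun_apply (C x) ^^ n) v)"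
proof (induction n)
  case (Suc n)
  have "iterate f (\<lambda>x. A x o\<^sub>L C x) (Suc n) x v
      = A ((f ^^ n) x) (C ((f ^^ n) x) (iterate f A n x ((blinfun_apply (C x) ^^ n) v)))"
    by (simp add: Suc)
  also have "\<dots> = A ((f ^^ n) x) (iterate f A n x (C x ((blinfun_apply (C x) ^^ n) v)))"
    by (simp only: reducing_iterate[OF assms])
  finally show ?case by simp
qed simp

text \<open>The factor is given as a square so that its product with the commuting positive root is
  positive: its form at \<open>v\<close> is the form of the root at \<open>H x v\<close>. The 2n-th
  power of the product is the Gram operator of the perturbed iterate, and uniqueness of positive
  roots identifies the two.\<close>

lemma perturbed_lyapunov_approx:
  assumes H: "reducing f A H" and n: "n > 0"
  defines "C \<equiv> \<lambda>x. H x o\<^sub>L H x"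
  shows "lyapunov_approx f (\<lambda>x. A x o\<^sub>L C x) x n = C x o\<^sub>L lyapunov_approx f A x n"
proof -
  let ?S = "lyapunov_approx f A x n" and ?T = "gram (iterate f A n x)"
  let ?T' = "gram (iterate f (\<lambda>x. A x o\<^sub>L C x) n x)"
  have C: "reducing f A C" unfolding C_def by (rule reducing_square[OF H])
  have symH: "H x u \<bullet> v = u \<bullet> H x v" and symC: "C x u \<bullet> v = u \<bullet> C x v" for u v
    using H C by (auto simp: reducing_def)
  have HS: "H x (?S v) = ?S (H x v)" for v
    using reducing_lyapunov_approx[OF H n, of x] by (metis blinfun_apply_blinfun_compose)
  have CS: "C x (?S v) = ?S (C x v)" for v by (simp add: C_def HS)
  have CT: "C x (?T v) = ?T (C x v)" for v
    using reducing_gram[OF C, of x n] by (metis blinfun_apply_blinfun_compose)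
  have S: "positive_operator ?S" by (rule positive_lyapunov_approx[OF n])
  have pos: "positive_operator (C x o\<^sub>L ?S)"
    unfolding positive_operator_def
  proof (intro conjI allI)
    show "(C x o\<^sub>L ?S) u \<bullet> v = u \<bullet> (C x o\<^sub>L ?S) v" for u v
      by (simp only: blinfun_apply_blinfun_compose symC positive_operatorD(1)[OF S] CS)
    have "(C x o\<^sub>L ?S) v \<bullet> v = ?S (H x v) \<bullet> H x v" for v
      by (simp only: C_def blinfun_apply_blinfun_compose symH HS[symmetric])
    then show "0 \<le> (C x o\<^sub>L ?S) v \<bullet> v" for v using positive_operatorD(2)[OF S] by simp
  qed
  have powS: "(blinfun_apply (C x) ^^ j) (?S v) = ?S ((blinfun_apply (C x) ^^ j) v)" for j v
    by (induction j) (simp_all add: CS)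
  have pow: "(blinfun_apply (C x o\<^sub>L ?S) ^^ j) v = (blinfun_apply (C x) ^^ j) ((blinfun_apply ?S ^^ j) v)" for j v
    by (induction j) (simp_all add: powS)
  have powsym: "(blinfun_apply (C x) ^^ j) u \<bullet> v = u \<bullet> (blinfun_apply (C x) ^^ j) v" for j u v
  proof (induction j arbitrary: u v)
    case (Suc j)
    have "(blinfun_apply (C x) ^^ Suc j) u \<bullet> v = u \<bullet> (blinfun_apply (C x) ^^ j) (C x v)"
      by (simp only: funpow.simps o_apply symC Suc)
    also have "(blinfun_apply (C x) ^^ j) (C x v) = (blinfun_apply (C x) ^^ Suc j) v"
      by (simp only: funpow_Suc_right o_apply)
    finally show ?case .
  qed simp
  have powT: "(blinfun_apply (C x) ^^ j) (?T v) = ?T ((blinfun_apply (C x) ^^ j) v)" for j v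
    by (induction j) (simp_all add: CT)
  have "?T' u \<bullet> v = (blinfun_apply (C x) ^^ (2 * n)) (?T u) \<bullet> v" for u v
  proof -
    have "?T' u \<bullet> v = ?T ((blinfun_apply (C x) ^^ n) u) \<bullet> (blinfun_apply (C x) ^^ n) v"
      by (simp only: gram_inner iterate_perturbed[OF C])
    also have "\<dots> = (blinfun_apply (C x) ^^ n) ((blinfun_apply (C x) ^^ n) (?T u)) \<bullet> v"
      by (simp only: powsym powT[symmetric])
    finally show ?thesis by (simp only: mult_2 funpow_add o_apply)
  qed
  then have "?T' u = (blinfun_apply (C x) ^^ (2 * n)) (?T u)" for u
    by (intro vector_eq_rdot[THEN iffD1]) blast
  then have "blinfun_apply (C x o\<^sub>L ?S) ^^ (2 * n) = blinfun_apply ?T'"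
    by (intro ext) (simp only: pow lyapunov_approx_power[OF n])
  then show ?thesis
    unfolding lyapunov_approx_gram[of f "\<lambda>x. A x o\<^sub>L C x"]
    using n by (intro positive_root_works(4)[OF positive_gram _ _ pos]) auto
qed

lemma perturbed_convergent:
  assumes H: "reducing f A H"
  defines "C \<equiv> \<lambda>x. H x o\<^sub>L H x"
  assumes inv: "C' o\<^sub>L C x = id_blinfun"
  shows "convergent (lyapunov_approx f (\<lambda>x. A x o\<^sub>L C x) x) \<longleftrightarrow> convergent (lyapunov_approx f A x)"
    and "convergent (lyapunov_approx f A x) \<Longrightarrow>
      lyapunov_operator f (\<lambda>x. A x o\<^sub>L C x) x = C x o\<^sub>L lyapunov_operator f A x"
proof -
  let ?a = "lyapunov_approx f A x" and ?b = "lyapunov_approx f (\<lambda>x. A x o\<^sub>L C x) x"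
  have ab: "?b (Suc n) = C x o\<^sub>L ?a (Suc n)" for n
    unfolding C_def by (rule perturbed_lyapunov_approx[OF H zero_less_Suc])
  have ba: "?a (Suc n) = C' o\<^sub>L ?b (Suc n)" for n
  proof (rule blinfun_eqI)
    fix v
    have "C' (C x w) = w" for w using inv by (metis blinfun_apply_blinfun_compose blinfun_apply_id_blinfun id_apply)
    then show "?a (Suc n) v = (C' o\<^sub>L ?b (Suc n)) v" by (simp add: ab)
  qed
  have fwd: "?b \<longlonglongrightarrow> (C x o\<^sub>L T)" if "?a \<longlonglongrightarrow> T" for T
  proof -
    have "(\<lambda>n. ?a (Suc n)) \<longlonglongrightarrow> T" using that by (rule LIMSEQ_Suc)
    then have "(\<lambda>n. ?b (Suc n)) \<longlonglongrightarrow> (C x o\<^sub>L T)"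
      unfolding ab by (intro blinfun_compose.tendsto tendsto_const)
    then show ?thesis by (rule LIMSEQ_imp_Suc)
  qed
  have bwd: "?a \<longlonglongrightarrow> (C' o\<^sub>L T)" if "?b \<longlonglongrightarrow> T" for T
  proof -
    have "(\<lambda>n. ?b (Suc n)) \<longlonglongrightarrow> T" using that by (rule LIMSEQ_Suc)
    then have "(\<lambda>n. ?a (Suc n)) \<longlonglongrightarrow> (C' o\<^sub>L T)"
      unfolding ba by (intro blinfun_compose.tendsto tendsto_const)
    then show ?thesis by (rule LIMSEQ_imp_Suc)
  qed
  show "convergent ?b \<longleftrightarrow> convergent ?a" using fwd bwd unfolding convergent_def by blast
  assume "convergent ?a"
  then have "?a \<longlonglongrightarrow> lyapunov_operator f A x" unfolding lyapunov_operator_def by (rule convergent_LIMSEQ_iff[THEN iffD1])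
  then show "lyapunov_operator f (\<lambda>x. A x o\<^sub>L C x) x = C x o\<^sub>L lyapunov_operator f A x"
    unfolding lyapunov_operator_def[of f "\<lambda>x. A x o\<^sub>L C x"] by (intro limI fwd)
qed

end

lemma dominatedI:
  fixes A :: "'x \<Rightarrow> 'h::real_inner \<Rightarrow>\<^sub>L 'h"
  assumes "\<And>x. closed_subspace J (E1 x)" "\<And>x. closed_subspace J (E2 x)" "\<And>x. E1 x \<inter> E2 x = {0}"
    and "\<And>x v. v \<in> E1 x \<Longrightarrow> A x v \<in> E1 (f x)" "\<And>x v. v \<in> E2 x \<Longrightarrow> A x v \<in> E2 (f x)"
    and "\<And>x y. hdim J (E1 x) = hdim J (E1 y)" "\<And>x y. hdim J (E2 x) = hdim J (E2 y)"
    and "\<theta> > 0" "\<And>x v. v \<in> E1 x \<Longrightarrow> norm v = 1 \<Longrightarrow> \<theta> \<le> norm (A x v)"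
    and "\<And>x u v. u \<in> E2 x \<Longrightarrow> v \<in> E1 x \<Longrightarrow> norm u = 1 \<Longrightarrow> norm v = 1 \<Longrightarrow>
      norm (iterate f A l x u) \<le> \<alpha> * norm (iterate f A l x v)"
  shows "dominated J f A UNIV l \<alpha> E1 E2"
  unfolding dominated_def
proof (intro conjI ballI)
  show "\<exists>d1 d2. \<forall>x\<in>UNIV. hdim J (E1 x) = d1 \<and> hdim J (E2 x) = d2"
  proof (intro exI ballI conjI)
    show "hdim J (E1 x) = hdim J (E1 undefined)" "hdim J (E2 x) = hdim J (E2 undefined)" for x
      by (rule assms(6), rule assms(7))
  qed
  show "\<exists>\<theta>>0. \<forall>x\<in>UNIV. (\<forall>v\<in>E1 x. norm v = 1 \<longrightarrow> \<theta> \<le> norm (A x v)) \<and>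
      (\<forall>u\<in>E2 x. \<forall>v\<in>E1 x. norm u = 1 \<longrightarrow> norm v = 1 \<longrightarrow> norm (iterate f A l x u) \<le> \<alpha> * norm (iterate f A l x v))"
    by (intro exI[of _ \<theta>] conjI ballI impI assms(8-10))
  show "A x ` E1 x \<subseteq> E1 (f x)" "A x ` E2 x \<subseteq> E2 (f x)" for x
    by (rule image_subsetI, rule assms(4), assumption) (rule image_subsetI, rule assms(5), assumption)
qed (rule assms(1-3))+

lemma dominated_finite_dim:
  fixes A :: "'x \<Rightarrow> 'h::{real_inner, banach} \<Rightarrow>\<^sub>L 'h"
  assumes "dominated J f A UNIV l \<alpha> E1 E2" and "compact_operator (A x)"
  shows "finite_dim (E1 x)"
proof -
  obtain \<theta> where "\<theta> > 0" "\<And>x v. v \<in> E1 x \<Longrightarrow> norm v = 1 \<Longrightarrow> \<theta> \<le> norm (A x v)"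
    using dominatedD(10)[OF assms(1)] by blast
  then show ?thesis by (rule compact_bounded_below_finite_dim[OF assms(2) dominatedD(1)[OF assms(1)]])
qed

section \<open>Oseledets--Ruelle splittings are orthogonal\<close>

lemma oseledets_eigenspace:
  "oseledets f A x \<kappa> = eigenspace (lyapunov_operator f A x) (if \<kappa> = -\<infinity> then 0 else exp (real_of_ereal \<kappa>))"
  by (simp add: oseledets_def eigenspace_def)

lemma oseledets_ereal: "oseledets f A x (ereal \<kappa>) = eigenspace (lyapunov_operator f A x) (exp \<kappa>)"
  by (simp add: oseledets_eigenspace)

lemma closure_span_orthogonal:
  assumes "\<And>a b. a \<in> S \<Longrightarrow> b \<in> T \<Longrightarrow> a \<bullet> b = 0" and u: "u \<in> closure (span S)" and v: "v \<in> closure (span T)"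
  shows "u \<bullet> (v :: 'h::real_inner) = 0"
proof -
  have one: "u \<bullet> b = 0" if b: "\<And>a. a \<in> S \<Longrightarrow> a \<bullet> b = 0" and u: "u \<in> closure (span S)" for S :: "'h set" and u b
  proof -
    have "S \<subseteq> {u. u \<bullet> b = 0}" using b by (intro subsetI CollectI)
    moreover have "subspace {u. u \<bullet> b = 0}" by (auto simp: subspace_def inner_left_distrib)
    ultimately have "span S \<subseteq> {u. u \<bullet> b = 0}" by (rule span_minimal)
    moreover have "closed {u. u \<bullet> b = 0}" by (intro closed_Collect_eq continuous_intros)
    ultimately have "closure (span S) \<subseteq> {u. u \<bullet> b = 0}" by (rule closure_minimal)
    then show ?thesis using u by (simp add: subset_iff)
  qed
  have "b \<bullet> u = 0" if "b \<in> T" for b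
    using one[of S b u] assms(1) that u by (simp add: inner_commute)
  then show ?thesis using one[of T u v] v by (simp add: inner_commute)
qed

text \<open>The way from Oseledets points to all points: the set where \<open>g\<close> does not
  vanish is open and null, hence empty.\<close>

lemma continuous_zero_if_AE_zero:
  fixes g :: "'x::topological_space \<Rightarrow> real"
  assumes sets: "sets M = sets borel" and pos: "\<And>U. open U \<Longrightarrow> U \<noteq> {} \<Longrightarrow> 0 < emeasure M U"
    and AE: "AE x in M. g x = 0" and g: "continuous_on UNIV g"
  shows "g x = 0"
proof (rule ccontr)
  assume "g x \<noteq> 0"
  define U where "U = {x. g x \<noteq> 0}"
  have "open U" unfolding U_def by (intro open_Collect_neq g continuous_on_const)
  moreover have "U \<noteq> {}" using \<open>g x \<noteq> 0\<close> by (auto simp: U_def)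
  ultimately have "0 < emeasure M U" by (rule pos)
  moreover have "space M = UNIV" using sets_eq_imp_space_eq[OF sets] by simp
  moreover have "U \<in> sets M" using \<open>open U\<close> sets by simp
  moreover have "AE x in M. x \<notin> U" using AE by (simp add: U_def)
  ultimately show False by (simp add: AE_iff_measurable[of U])
qed

section \<open>Orthogonal projections onto invariant bundles\<close>

text \<open>Symmetry is part of \<open>reducing\<close>; idempotence follows from the other two
  clauses, and invariance of \<open>V\<close> under the cocycle from equivariance.\<close>

definition bundle_projection ::
    "('x \<Rightarrow> 'x) \<Rightarrow> ('x \<Rightarrow> 'h::real_inner \<Rightarrow>\<^sub>L 'h) \<Rightarrow> ('x \<Rightarrow> 'h set) \<Rightarrow> ('x \<Rightarrow> 'h \<Rightarrow>\<^sub>L 'h) \<Rightarrow> bool" where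
  "bundle_projection f A V Q \<longleftrightarrow>
     reducing f A Q \<and> (\<forall>x v. Q x v \<in> V x) \<and> (\<forall>x. \<forall>v\<in>V x. Q x v = v)"

lemma bundle_projectionD:
  assumes "bundle_projection f A V Q"
  shows "reducing f A Q" "Q x v \<in> V x" "v \<in> V x \<Longrightarrow> Q x v = v" "Q x u \<bullet> v = u \<bullet> Q x v" "A x (Q x v) = Q (f x) (A x v)"
    "Q x (Q x v) = Q x v"
  using assms by (simp_all add: bundle_projection_def reducing_def)

lemma oseledets_pointsD:
  assumes "x \<in> oseledets_points J f M A"
  shows "has_multiplicities J f A (multiplicity J f M A) x" "ruelle_point f A x" "convergent (lyapunov_approx f A x)"
    "compact_operator (lyapunov_operator f A x)"
    "hdim J (oseledets f A x (ereal \<kappa>)) = multiplicity J f M A \<kappa>"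
proof -
  have "has_multiplicities J f A (multiplicity J f M A) ((f ^^ 0) x)"
    using assms unfolding oseledets_points_def by blast
  then show h: "has_multiplicities J f A (multiplicity J f M A) x" by simp
  then show "ruelle_point f A x" "convergent (lyapunov_approx f A x)" "compact_operator (lyapunov_operator f A x)"
    "hdim J (oseledets f A x (ereal \<kappa>)) = multiplicity J f M A \<kappa>"
    by (simp_all add: has_multiplicities_def ruelle_point_def)
qed

lemma oseledets_points_exist:
  assumes M: "prob_space M" and AE: "AE x in M. x \<in> oseledets_points J f M A"
  obtains x where "x \<in> oseledets_points J f M A"
proof -
  have "oseledets_points J f M A \<noteq> {}"
  proof
    assume "oseledets_points J f M A = {}"
    then have "AE x in M. False" using AE by simp
    then show False using prob_space.AE_const[OF M, of False] by simp
  qed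
  then show ?thesis using that by blast
qed

lemma bundle_sum_orthogonal:
  assumes "\<And>i v. i \<in> I \<Longrightarrow> v \<in> E i x \<Longrightarrow> u \<bullet> v = 0" and "v \<in> bundle_sum E I x"
  shows "u \<bullet> (v :: 'h::real_inner) = 0"
proof -
  have "orthogonal u v"
    by (rule orthogonal_to_span[OF assms(2)[unfolded bundle_sum_def]])
      (use assms(1) in \<open>auto simp: orthogonal_def\<close>)
  then show ?thesis by (simp add: orthogonal_def)
qed

context
  fixes J :: "'h::{real_inner, banach} \<Rightarrow>\<^sub>L 'h" and f :: "'x::topological_space \<Rightarrow> 'x" and M :: "'x measure"
    and A :: "'x \<Rightarrow> 'h \<Rightarrow>\<^sub>L 'h" and k :: nat and G :: "nat \<Rightarrow> ereal set" and E :: "nat \<Rightarrow> 'x \<Rightarrow> 'h set"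
  assumes ext: "extended_oseledets_ruelle J f M A k G E"
begin

lemma ext_facts:
  shows ext_AE: "AE x in M. x \<in> oseledets_points J f M A"
    and ext_groups: "(\<Union>i<k. G i) = insert (-\<infinity>) (ereal ` exponents J f M A)"
    and ext_disjoint: "disjoint_family_on G {..<k}"
    and ext_bundle: "x \<in> oseledets_points J f M A \<Longrightarrow> i < k \<Longrightarrow> E i x = closure (span (\<Union>\<kappa>\<in>G i. oseledets f A x \<kappa>))"
    and ext_closed_subspace: "i < k \<Longrightarrow> closed_subspace J (E i x)"
    and ext_direct: "direct_decomposition k (\<lambda>i. E i x)"
    and ext_continuous: "continuous_splitting k E"
    and ext_dominated: "\<exists>l \<alpha>. 0 < \<alpha> \<and> \<alpha> < 1 \<and> (\<forall>i j. i < j \<longrightarrow> j < k \<longrightarrow> dominated J f A UNIV l \<alpha> (E i) (E j))"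
  using ext unfolding extended_oseledets_ruelle_def by (simp_all only: simp_thms)

lemma ext_subspace: "i < k \<Longrightarrow> subspace (E i x)"
  using ext_closed_subspace[of i x] by (simp add: closed_subspace_def)

text \<open>Groups do not contain plus infinity, where \<open>real_of_ereal\<close> is 0 and the
  value would collide with that of the exponent 0. On the remaining extended reals the map is
  injective.\<close>

lemma ext_group_distinct:
  assumes "i < k" "j < k" "i \<noteq> j" "\<kappa> \<in> G i" "\<mu> \<in> G j"
  shows "(if \<kappa> = -\<infinity> then 0 else exp (real_of_ereal \<kappa>)) \<noteq> (if \<mu> = -\<infinity> then 0 else exp (real_of_ereal \<mu>))"
proof -
  have "G i \<inter> G j = {}" using ext_disjoint assms(1-3) by (auto simp: disjoint_family_on_def)
  then have "\<kappa> \<noteq> \<mu>" using assms(4,5) by blast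
  moreover have "\<kappa> = -\<infinity> \<or> \<kappa> \<in> range ereal" if "\<kappa> \<in> G i" "i < k" for \<kappa> i
  proof -
    have "\<kappa> \<in> (\<Union>i<k. G i)" using that by blast
    then have "\<kappa> \<in> insert (-\<infinity>) (ereal ` exponents J f M A)" by (simp only: ext_groups)
    then show ?thesis by blast
  qed
  then have "\<kappa> = -\<infinity> \<or> \<kappa> \<in> range ereal" "\<mu> = -\<infinity> \<or> \<mu> \<in> range ereal"
    using assms(1,2,4,5) by blast+
  ultimately show ?thesis by (cases \<kappa>; cases \<mu>) auto
qed

lemma ext_orthogonal_at:
  assumes x: "x \<in> oseledets_points J f M A" and ij: "i < k" "j < k" "i \<noteq> j" and u: "u \<in> E i x" and v: "v \<in> E j x"
  shows "u \<bullet> v = 0"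
proof (rule closure_span_orthogonal)
  show "u \<in> closure (span (\<Union>\<kappa>\<in>G i. oseledets f A x \<kappa>))" using ext_bundle[OF x ij(1)] u by simp
  show "v \<in> closure (span (\<Union>\<kappa>\<in>G j. oseledets f A x \<kappa>))" using ext_bundle[OF x ij(2)] v by simp
  fix a b assume "a \<in> (\<Union>\<kappa>\<in>G i. oseledets f A x \<kappa>)" "b \<in> (\<Union>\<kappa>\<in>G j. oseledets f A x \<kappa>)"
  then obtain \<kappa> \<mu> where k: "\<kappa> \<in> G i" "a \<in> oseledets f A x \<kappa>" "\<mu> \<in> G j" "b \<in> oseledets f A x \<mu>" by auto
  show "a \<bullet> b = 0"
    by (rule eigenspace_orthogonal[OF positive_lyapunov_operator[OF oseledets_pointsD(3)[OF x]]
          k(2,4)[unfolded oseledets_eigenspace] ext_group_distinct[OF ij k(1,3)]])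
qed

text \<open>The projections in \<open>continuous_splitting\<close> are given without any symmetry.
  Two scalar identities hold at Oseledets points, mutual orthogonality of the components and their
  adding up to the vector, and extend by continuity to every point. All further properties are then
  derived from these two at each point separately.\<close>

theorem ext_orthogonal_splitting:
  assumes sets: "sets M = sets borel" and pos: "\<And>U. open U \<Longrightarrow> U \<noteq> {} \<Longrightarrow> 0 < emeasure M U" and k: "k \<ge> 2"
  obtains P :: "nat \<Rightarrow> 'x \<Rightarrow> 'h \<Rightarrow>\<^sub>L 'h"
    where "\<And>i v. i < k \<Longrightarrow> continuous_on UNIV (\<lambda>x. P i x v)" "\<And>i. i < k \<Longrightarrow> bundle_projection f A (E i) (P i)"
    "\<And>x v. (\<Sum>i<k. P i x v) = v"
    "\<And>i j x u v. i < k \<Longrightarrow> j < k \<Longrightarrow> i \<noteq> j \<Longrightarrow> u \<in> E i x \<Longrightarrow> v \<in> E j x \<Longrightarrow> u \<bullet> v = 0"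
proof -
  let ?W = "\<lambda>i. bundle_sum E ({..<k} - {i})"
  obtain P :: "nat \<Rightarrow> 'x \<Rightarrow> 'h \<Rightarrow>\<^sub>L 'h"
    where P: "\<forall>i<k. continuous_on UNIV (\<lambda>x. blinfun_apply (P i x)) \<and> (\<forall>x v. P i x v \<in> E i x \<and> v - P i x v \<in> ?W i x)"
    using ext_continuous unfolding continuous_splitting_def by blast
  have cont: "continuous_on UNIV (\<lambda>x. blinfun_apply (P i x))" and PE: "P i x v \<in> E i x" and PW: "v - P i x v \<in> ?W i x"
    if "i < k" for i x v using P that by simp_all
  have sW: "subspace (?W i x)" for i x by (simp add: bundle_sum_def)
  have EW: "E i x \<subseteq> ?W j x" if "i < k" "i \<noteq> j" for i j x
  proof
    fix v assume "v \<in> E i x"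
    moreover have "i \<in> {..<k} - {j}" using that by simp
    ultimately show "v \<in> ?W j x" unfolding bundle_sum_def by (intro span_base UN_I)
  qed
  have at_points: "P i x v \<bullet> P j x w = 0 \<and> (\<Sum>i<k. P i x v) = v"
    if x: "x \<in> oseledets_points J f M A" and ij: "i < k" "j < k" "i \<noteq> j" for x i j v w
  proof
    show "P i x v \<bullet> P j x w = 0"
      by (rule ext_orthogonal_at[OF x ij PE[OF ij(1)] PE[OF ij(2)]])
    have orthW: "u \<bullet> w = 0" if "i < k" "u \<in> E i x" "w \<in> ?W i x" for i u w
    proof (rule bundle_sum_orthogonal[OF _ that(3)])
      fix j v assume "j \<in> {..<k} - {i}" "v \<in> E j x"
      then show "u \<bullet> v = 0" using ext_orthogonal_at[OF x that(1) _ _ that(2), of j v] by simp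
    qed
    have fix_E: "P i x u = u" if "i < k" "u \<in> E i x" for i u
    proof -
      have "u - P i x u \<in> E i x" using that PE ext_subspace by (intro subspace_diff) auto
      then have "(u - P i x u) \<bullet> (u - P i x u) = 0" by (rule orthW[OF that(1) _ PW[OF that(1)]])
      then show ?thesis by simp
    qed
    have kill: "P i x u = 0" if "i < k" "u \<in> ?W i x" for i u
    proof -
      have "u - (u - P i x u) \<in> ?W i x" using that(2) PW[OF that(1)] by (rule subspace_diff[OF sW])
      then have "P i x u \<in> ?W i x" by simp
      then have "P i x u \<bullet> P i x u = 0" by (rule orthW[OF that(1) PE[OF that(1)]])
      then show ?thesis by simp
    qed
    \<comment> \<open>The part of \<open>v\<close> missed by the components. It lies in every
      complement \<open>?W i\<close>, hence is orthogonal to every \<open>E i\<close>; as it also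
      lies in the span of some of them, it is 0.\<close>
    define w where "w = v - (\<Sum>i<k. P i x v)"
    have Pw: "P i x w = 0" if i: "i < k" for i
    proof -
      have "P i x (\<Sum>j<k. P j x v) = (\<Sum>j<k. P i x (P j x v))" by (simp add: blinfun.sum_right)
      also have "\<dots> = (\<Sum>j<k. if j = i then P i x v else 0)"
      proof (rule sum.cong)
        fix j assume "j \<in> {..<k}"
        then have j: "j < k" by simp
        show "P i x (P j x v) = (if j = i then P i x v else 0)"
        proof (cases "j = i")
          case True then show ?thesis using fix_E[OF i PE[OF i]] by simp
        next
          case False then show ?thesis using kill[OF i subsetD[OF EW[OF j False] PE[OF j]]] by simp
        qed
      qed simp
      also have "\<dots> = P i x v" using i by simp
      finally show ?thesis by (simp add: w_def blinfun.diff_right)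
    qed
    have wW: "w \<in> ?W i x" if "i < k" for i using PW[OF that, where x = x and v = w] Pw[OF that] by simp
    have "w \<bullet> w = 0"
    proof (rule bundle_sum_orthogonal[OF _ wW[of 0]])
      fix j u assume "j \<in> {..<k} - {0}" "u \<in> E j x"
      then show "w \<bullet> u = 0" using orthW[of j u w] wW[of j] by (simp add: inner_commute)
    qed (use k in simp)
    then show "(\<Sum>i<k. P i x v) = v" by (simp add: w_def)
  qed
  have cont_apply: "continuous_on UNIV (\<lambda>x. P i x v)" if "i < k" for i v
    using cont[OF that] by (rule continuous_on_product_then_coordinatewise)
  have Porth: "P i x v \<bullet> P j x w = 0" if ij: "i < k" "j < k" "i \<noteq> j" for i j x v w
  proof (rule continuous_zero_if_AE_zero[OF sets pos, where g = "\<lambda>x. P i x v \<bullet> P j x w"])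
    show "AE x in M. P i x v \<bullet> P j x w = 0"
      using ext_AE by eventually_elim (rule conjunct1[OF at_points[OF _ ij]])
    show "continuous_on UNIV (\<lambda>x. P i x v \<bullet> P j x w)" using ij by (intro continuous_on_inner cont_apply)
  qed
  have Psum: "(\<Sum>i<k. P i x v) = v" for x v
  proof -
    let ?r = "\<lambda>x. (\<Sum>i<k. P i x v) - v"
    have "?r x \<bullet> ?r x = 0"
    proof (rule continuous_zero_if_AE_zero[OF sets pos, where g = "\<lambda>x. ?r x \<bullet> ?r x"])
      show "AE x in M. ?r x \<bullet> ?r x = 0"
      proof (use ext_AE in eventually_elim)
        fix x assume x: "x \<in> oseledets_points J f M A"
        have "(\<Sum>i<k. P i x v) = v" by (rule conjunct2[OF at_points[OF x, of 0 1]]) (use k in auto)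
        then show "?r x \<bullet> ?r x = 0" by simp
      qed
      show "continuous_on UNIV (\<lambda>x. ?r x \<bullet> ?r x)"
        by (intro continuous_on_inner continuous_on_diff continuous_on_sum continuous_on_const cont_apply) simp_all
    qed
    then show ?thesis by simp
  qed
  \<comment> \<open>Uniqueness in the direct decomposition compares the components of
    \<open>v\<close> with the decomposition whose only nonzero entry is \<open>v\<close>
    itself.\<close>
  have fix_E: "P i x v = v" if i: "i < k" and v: "v \<in> E i x" for i x v
  proof -
    define \<Phi> where "\<Phi> w \<longleftrightarrow> (\<forall>i<k. w i \<in> E i x) \<and> (\<forall>i\<ge>k. w i = 0) \<and> v = (\<Sum>i<k. w i)" for w
    have "\<exists>!w. \<Phi> w" using ext_direct[of x] by (simp add: direct_decomposition_def \<Phi>_def)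
    then obtain w0 where w0: "\<And>w. \<Phi> w \<Longrightarrow> w = w0" by auto
    have "\<Phi> (\<lambda>j. if j < k then P j x v else 0)"
      using PE Psum[of x v] by (simp add: \<Phi>_def)
    moreover have "\<Phi> (\<lambda>j. if j = i then v else 0)"
    proof -
      have "0 \<in> E j x" if "j < k" for j using ext_subspace[OF that] by (rule subspace_0)
      moreover have "v = (\<Sum>j<k. if j = i then v else 0)" using i by simp
      ultimately show ?thesis using i v by (simp add: \<Phi>_def)
    qed
    ultimately have "(\<lambda>j. if j < k then P j x v else 0) = (\<lambda>j. if j = i then v else 0)"
      by (rule trans[OF w0 w0[symmetric]])
    then have "(if i < k then P i x v else 0) = (if i = i then v else 0)" by (rule fun_cong)
    then show ?thesis using i by simp
  qed
  have orth: "u \<bullet> v = 0" if "i < k" "j < k" "i \<noteq> j" "u \<in> E i x" "v \<in> E j x" for i j x u v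
    using Porth[OF that(1-3), of x u v] fix_E[OF that(1,4)] fix_E[OF that(2,5)] by simp
  \<comment> \<open>Invariance of a group is read off from any domination in which it takes part;
    \<open>k \<ge> 2\<close> provides one.\<close>
  have inv: "A x v \<in> E i (f x)" if i: "i < k" and v: "v \<in> E i x" for i x v
  proof -
    obtain l \<alpha> where dom: "\<And>i j. i < j \<Longrightarrow> j < k \<Longrightarrow> dominated J f A UNIV l \<alpha> (E i) (E j)"
      using ext_dominated by blast
    show ?thesis
    proof (cases "i = 0")
      case True then show ?thesis using dominatedD(5)[OF dom[of 0 1]] k v by simp
    next
      case False then show ?thesis using dominatedD(6)[OF dom[of 0 i]] i v by simp
    qed
  qed
  have kill: "P i x v = 0" if "i < k" "j < k" "i \<noteq> j" "v \<in> E j x" for i j x v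
  proof -
    have "v = (\<Sum>l<k. P l x v)" by (rule Psum[symmetric])
    also have "\<dots> = P i x v + (\<Sum>l\<in>{..<k} - {i}. P l x v)" by (rule sum.remove) (use that(1) in auto)
    finally have "v = P i x v + (\<Sum>l\<in>{..<k} - {i}. P l x v)" .
    then have "v \<bullet> P i x v = (P i x v + (\<Sum>l\<in>{..<k} - {i}. P l x v)) \<bullet> P i x v"
      by (rule arg_cong)
    then have "v \<bullet> P i x v = P i x v \<bullet> P i x v + (\<Sum>l\<in>{..<k} - {i}. P l x v) \<bullet> P i x v"
      by (simp only: inner_left_distrib)
    moreover have "(\<Sum>l\<in>{..<k} - {i}. P l x v) \<bullet> P i x v = 0"
      unfolding inner_sum_left by (intro sum.neutral ballI Porth) (use that(1) in auto)
    moreover have "v \<bullet> P i x v = 0" using orth[OF that(1-3) PE[OF that(1)] that(4)] by (simp add: inner_commute)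
    ultimately show ?thesis by simp
  qed
  have sym: "P i x u \<bullet> v = u \<bullet> P i x v" if i: "i < k" for i x u v
  proof -
    have half: "P i x u \<bullet> v = P i x u \<bullet> P i x v" for u v
    proof -
      have "P i x u \<bullet> v = P i x u \<bullet> (\<Sum>l<k. P l x v)" by (simp only: Psum)
      also have "\<dots> = (\<Sum>l<k. if l = i then P i x u \<bullet> P i x v else 0)"
        unfolding inner_sum_right
      proof (rule sum.cong)
        fix l assume "l \<in> {..<k}"
        then show "P i x u \<bullet> P l x v = (if l = i then P i x u \<bullet> P i x v else 0)"
          using Porth[OF i, of l x u v] by simp
      qed simp
      finally show ?thesis using i by simp
    qed
    show ?thesis using half[of u v] half[of v u] by (simp add: inner_commute)
  qed
  have eq: "A x (P i x v) = P i (f x) (A x v)" if i: "i < k" for i x v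
  proof -
    have "P i (f x) (A x v) = P i (f x) (A x (\<Sum>l<k. P l x v))" by (simp only: Psum)
    also have "\<dots> = (\<Sum>l<k. P i (f x) (A x (P l x v)))" by (simp only: blinfun.sum_right)
    also have "\<dots> = (\<Sum>l<k. if l = i then A x (P i x v) else 0)"
    proof (rule sum.cong)
      fix l assume "l \<in> {..<k}"
      then have l: "l < k" by simp
      show "P i (f x) (A x (P l x v)) = (if l = i then A x (P i x v) else 0)"
      proof (cases "l = i")
        case True
        show ?thesis unfolding True by (simp only: fix_E[OF i inv[OF i PE[OF i]]] simp_thms if_True)
      next
        case False
        then have "P i (f x) (A x (P l x v)) = 0" by (intro kill[OF i l _ inv[OF l PE[OF l]]]) simp
        then show ?thesis using False by simp
      qed
    qed simp
    finally show ?thesis using i by simp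
  qed
  have bp: "bundle_projection f A (E i) (P i)" if i: "i < k" for i
    unfolding bundle_projection_def reducing_def
    by (intro conjI allI ballI sym[OF i] eq[OF i] PE[OF i] fix_E[OF i])
  show ?thesis by (rule that[of P]) (fact cont_apply, fact bp, fact Psum, fact orth)
qed

end

section \<open>Sums of bundles\<close>

lemma bundle_projection_sum:
  fixes P :: "nat \<Rightarrow> 'x \<Rightarrow> 'h::real_inner \<Rightarrow>\<^sub>L 'h"
  assumes I: "finite I" and bp: "\<And>i. i \<in> I \<Longrightarrow> bundle_projection f A (E i) (P i)"
    and orth: "\<And>i j x u v. i \<in> I \<Longrightarrow> j \<in> I \<Longrightarrow> i \<noteq> j \<Longrightarrow> u \<in> E i x \<Longrightarrow> v \<in> E j x \<Longrightarrow> u \<bullet> v = 0"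
  shows "bundle_projection f A (bundle_sum E I) (\<lambda>x. \<Sum>i\<in>I. P i x)"
  unfolding bundle_projection_def reducing_def blinfun.sum_left
proof (intro conjI allI ballI)
  show "(\<Sum>i\<in>I. P i x u) \<bullet> v = u \<bullet> (\<Sum>i\<in>I. P i x v)" for x u v
    unfolding inner_sum_left inner_sum_right by (intro sum.cong refl bundle_projectionD(4)[OF bp])
  show "A x (\<Sum>i\<in>I. P i x v) = (\<Sum>i\<in>I. P i (f x) (A x v))" for x v
    unfolding blinfun.sum_right by (intro sum.cong refl bundle_projectionD(5)[OF bp])
  show "(\<Sum>i\<in>I. P i x v) \<in> bundle_sum E I x" for x v
    unfolding bundle_sum_def by (intro span_sum span_base) (rule UN_I, assumption, rule bundle_projectionD(2)[OF bp])
  fix x v assume "v \<in> bundle_sum E I x"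
  then show "(\<Sum>i\<in>I. P i x v) = v"
    unfolding bundle_sum_def
  proof (induction rule: span_induct_alt)
    case base show ?case by simp
  next
    case (step c w z)
    then obtain j where j: "j \<in> I" "w \<in> E j x" by blast
    have "P i x w = (if i = j then w else 0)" if i: "i \<in> I" for i
    proof (cases "i = j")
      case True then show ?thesis using bundle_projectionD(3)[OF bp[OF j(1)] j(2)] by simp
    next
      case False
      have "P i x w \<bullet> P i x w = w \<bullet> P i x (P i x w)" by (rule bundle_projectionD(4)[OF bp[OF i]])
      also have "\<dots> = P i x w \<bullet> w" by (simp only: bundle_projectionD(6)[OF bp[OF i]] inner_commute)
      also have "\<dots> = 0" by (rule orth[OF i j(1) False bundle_projectionD(2)[OF bp[OF i]] j(2)])
      finally show ?thesis using False by simp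
    qed
    then have "(\<Sum>i\<in>I. P i x w) = (\<Sum>i\<in>I. if i = j then w else 0)" by (rule sum.cong[OF refl])
    then have "(\<Sum>i\<in>I. P i x w) = w" using I j(1) by simp
    moreover have "(\<Sum>i\<in>I. P i x (c *\<^sub>R w + z)) = c *\<^sub>R (\<Sum>i\<in>I. P i x w) + (\<Sum>i\<in>I. P i x z)"
      by (simp only: blinfun.add_right blinfun.scaleR_right sum.distrib scaleR_sum_right)
    ultimately show ?case using step(2) by (simp only:)
  qed
qed

lemma bundle_projection_closed:
  fixes Q :: "'x \<Rightarrow> 'h::real_inner \<Rightarrow>\<^sub>L 'h"
  assumes "bundle_projection f A V Q"
  shows "closed (V x)"
proof -
  have "V x = {v. Q x v = v}" 
  proof (intro set_eqI iffI CollectI)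
    show "v \<in> V x" if "v \<in> {v. Q x v = v}" for v
      using bundle_projectionD(2)[OF assms, of x v] that by simp
  qed (rule bundle_projectionD(3)[OF assms])
  moreover have "closed {v. Q x v = v}" by (intro closed_Collect_eq continuous_intros)
  ultimately show ?thesis by simp
qed

lemma bundle_sums_orthogonal:
  fixes E :: "nat \<Rightarrow> 'x \<Rightarrow> 'h::real_inner set"
  assumes "\<And>i j u v. i \<in> I \<Longrightarrow> j \<in> K \<Longrightarrow> u \<in> E i x \<Longrightarrow> v \<in> E j x \<Longrightarrow> u \<bullet> v = 0"
    and "u \<in> bundle_sum E I x" "v \<in> bundle_sum E K x"
  shows "u \<bullet> v = 0"
proof -
  have uv: "u \<in> closure (span (\<Union>i\<in>I. E i x))" "v \<in> closure (span (\<Union>j\<in>K. E j x))"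
    by (rule subsetD[OF closure_subset assms(2)[unfolded bundle_sum_def]],
        rule subsetD[OF closure_subset assms(3)[unfolded bundle_sum_def]])
  have "a \<bullet> b = 0" if ab: "a \<in> (\<Union>i\<in>I. E i x)" "b \<in> (\<Union>j\<in>K. E j x)" for a b
  proof -
    obtain i j where "i \<in> I" "a \<in> E i x" "j \<in> K" "b \<in> E j x" using ab by auto
    then show ?thesis by (intro assms(1)[of i j])
  qed
  then show ?thesis by (rule closure_span_orthogonal[OF _ uv])
qed

lemma subspace_closure:
  fixes S :: "'h::real_normed_vector set"
  assumes S: "subspace S"
  shows "subspace (closure S)"
  unfolding subspace_def
proof (intro conjI ballI allI)
  show "0 \<in> closure S" using subspace_0[OF S] by (rule subsetD[OF closure_subset])
  fix u c assume "u \<in> closure S"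
  then obtain a where a: "\<And>n. a n \<in> S" "a \<longlonglongrightarrow> u" unfolding closure_sequential by auto
  have "(\<lambda>n. c *\<^sub>R a n) \<longlonglongrightarrow> c *\<^sub>R u" by (intro tendsto_intros a)
  then show "c *\<^sub>R u \<in> closure S" unfolding closure_sequential
    using subspace_scale[OF S a(1)] by (intro exI[of _ "\<lambda>n. c *\<^sub>R a n"]) simp
  fix v assume "v \<in> closure S"
  then obtain b where b: "\<And>n. b n \<in> S" "b \<longlonglongrightarrow> v" unfolding closure_sequential by auto
  have "(\<lambda>n. a n + b n) \<longlonglongrightarrow> u + v" by (intro tendsto_intros a b)
  then show "u + v \<in> closure S" unfolding closure_sequential
    using subspace_add[OF S a(1) b(1)] by (intro exI[of _ "\<lambda>n. a n + b n"]) simp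
qed

text \<open>A sum of closed subspaces can fail to be closed; closedness of this one comes later from
  the projection onto it.\<close>

lemma ext_bundle_sum:
  fixes A :: "'x::topological_space \<Rightarrow> 'h::{real_inner, banach} \<Rightarrow>\<^sub>L 'h"
  assumes ext: "extended_oseledets_ruelle J f M A k G E" and x: "x \<in> oseledets_points J f M A"
    and I: "I \<subseteq> {..<k}" and cl: "closed (bundle_sum E I x)"
  shows "bundle_sum E I x = closure (span (\<Union>\<kappa>\<in>(\<Union>i\<in>I. G i). oseledets f A x \<kappa>))"
proof
  let ?S = "\<lambda>i. \<Union>\<kappa>\<in>G i. oseledets f A x \<kappa>"
  have E: "E i x = closure (span (?S i))" if "i \<in> I" for i
    by (intro ext_bundle[OF ext x]) (use that I in auto)
  have "E i x \<subseteq> closure (span (\<Union>\<kappa>\<in>(\<Union>i\<in>I. G i). oseledets f A x \<kappa>))" if "i \<in> I" for i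
    unfolding E[OF that] using that by (intro closure_mono span_mono) blast
  then show "bundle_sum E I x \<subseteq> closure (span (\<Union>\<kappa>\<in>(\<Union>i\<in>I. G i). oseledets f A x \<kappa>))"
    unfolding bundle_sum_def by (intro span_minimal UN_least subspace_closure subspace_span)
  have S: "?S i \<subseteq> E i x" if "i \<in> I" for i
    unfolding E[OF that] by (rule subset_trans[OF span_superset closure_subset])
  have "(\<Union>\<kappa>\<in>(\<Union>i\<in>I. G i). oseledets f A x \<kappa>) \<subseteq> (\<Union>i\<in>I. E i x)"
  proof
    fix v assume "v \<in> (\<Union>\<kappa>\<in>(\<Union>i\<in>I. G i). oseledets f A x \<kappa>)"
    then obtain i \<kappa> where i: "i \<in> I" "\<kappa> \<in> G i" "v \<in> oseledets f A x \<kappa>" by auto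
    then have "v \<in> ?S i" by (intro UN_I)
    then show "v \<in> (\<Union>i\<in>I. E i x)" using S[OF i(1)] i(1) by (intro UN_I[of i]) (auto dest: subsetD)
  qed
  then have "span (\<Union>\<kappa>\<in>(\<Union>i\<in>I. G i). oseledets f A x \<kappa>) \<subseteq> bundle_sum E I x"
    unfolding bundle_sum_def by (rule span_mono)
  then show "closure (span (\<Union>\<kappa>\<in>(\<Union>i\<in>I. G i). oseledets f A x \<kappa>)) \<subseteq> bundle_sum E I x"
    by (rule closure_minimal[OF _ cl])
qed

text \<open>Strong convergence of bounded operators is uniform on compact sets.\<close>

lemma strong_compose_compact_tendsto:
  fixes D :: "'x::topological_space \<Rightarrow> 'h::real_normed_vector \<Rightarrow>\<^sub>L 'h"
  assumes T: "compact_operator T" and D: "\<And>v. ((\<lambda>x. D x v) \<longlongrightarrow> blinfun_apply D0 v) F" and C: "\<And>x. norm (D x) \<le> C" "norm D0 \<le> C"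
  shows "((\<lambda>x. D x o\<^sub>L T) \<longlongrightarrow> (D0 o\<^sub>L T)) F"
proof (rule tendstoI)
  fix e :: real assume e: "0 < e"
  have C0: "C \<ge> 0" using C(2) norm_ge_zero[of D0] by linarith
  \<comment> \<open>Mesh of a finite net in the compact image: an operator of norm at most
    \<open>C\<close> moves points at distance less than \<open>d\<close> apart by at most
    \<open>e / 4\<close>.\<close>
  define d where "d = e / (4 * (C + 1))"
  have d: "d > 0" using e C0 by (simp add: d_def)
  have Cd: "C * d \<le> e / 4" using e C0 by (simp add: d_def field_simps)
  obtain Y where Y: "finite Y" "closure (T ` cball 0 1) \<subseteq> (\<Union>y\<in>Y. ball y d)"
  proof (rule compactE_image[of "closure (T ` cball 0 1)" "closure (T ` cball 0 1)" "\<lambda>y. ball y d"])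
    show "compact (closure (T ` cball 0 1))" using T by (simp only: compact_operator_def)
    show "closure (T ` cball 0 1) \<subseteq> (\<Union>y\<in>closure (T ` cball 0 1). ball y d)"
      using d by (intro subsetI) (rule UN_I, assumption, simp)
  qed auto
  have "\<forall>\<^sub>F x in F. \<forall>y\<in>Y. dist (D x y) (D0 y) < e / 4"
    using Y(1) e by (intro eventually_ball_finite ballI tendstoD[OF D]) auto
  then show "\<forall>\<^sub>F x in F. dist (D x o\<^sub>L T) (D0 o\<^sub>L T) < e"
  proof eventually_elim
    case (elim x)
    have unit: "norm (((D x o\<^sub>L T) - (D0 o\<^sub>L T)) v) \<le> 3 * e / 4" if v: "norm v \<le> 1" for v
    proof -
      have "T v \<in> closure (T ` cball 0 1)" by (intro subsetD[OF closure_subset] imageI) (simp add: v)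
      then obtain y where y: "y \<in> Y" "dist y (T v) < d" using Y(2) by (auto dest: subsetD)
      have b: "norm (R (T v - y)) \<le> e / 4" if "norm R \<le> C" for R :: "'h \<Rightarrow>\<^sub>L 'h"
      proof -
        have "norm (R (T v - y)) \<le> norm R * norm (T v - y)" by (rule norm_blinfun)
        also have "\<dots> \<le> C * d" using that y(2) C0 by (intro mult_mono) (auto simp: dist_norm norm_minus_commute)
        finally show ?thesis using Cd by linarith
      qed
      have "((D x o\<^sub>L T) - (D0 o\<^sub>L T)) v = D x (T v - y) - D0 (T v - y) + (D x y - D0 y)"
        by (simp add: blinfun.diff_left blinfun.diff_right)
      also have "norm \<dots> \<le> norm (D x (T v - y)) + norm (D0 (T v - y)) + norm (D x y - D0 y)"
        by (meson norm_triangle_ineq norm_triangle_ineq4 add_mono order_refl order_trans)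
      also have "\<dots> \<le> e / 4 + e / 4 + e / 4"
        using b[OF C(1)] b[OF C(2)] elim y(1) by (intro add_mono) (auto simp: dist_norm intro: less_imp_le)
      finally show ?thesis by simp
    qed
    have "norm ((D x o\<^sub>L T) - (D0 o\<^sub>L T)) \<le> 3 * e / 4"
    proof (intro norm_blinfun_bound)
      fix v
      show "norm (((D x o\<^sub>L T) - (D0 o\<^sub>L T)) v) \<le> 3 * e / 4 * norm v"
      proof (cases "v = 0")
        case False
        have "norm (((D x o\<^sub>L T) - (D0 o\<^sub>L T)) ((1 / norm v) *\<^sub>R v)) \<le> 3 * e / 4"
          by (rule unit) (use False in simp)
        then show ?thesis using False by (simp add: blinfun.scaleR_right field_simps)
      qed simp
    qed (use e in simp)
    then show ?case using e by (simp add: dist_norm)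
  qed
qed

text \<open>\<open>U\<close> and \<open>U'\<close> are upper segments of one and the same set, so
  one contains the other, and nonzero weights with equal finite totals leave no room for a
  difference. This locates the cuts between the unstable, center and stable exponents.\<close>

lemma upper_sets_eq:
  fixes w :: "real \<Rightarrow> enat"
  assumes eq: "U \<union> R = U' \<union> R'" and fin: "finite U" "finite U'"
    and up: "\<And>u r. u \<in> U \<Longrightarrow> r \<in> R \<Longrightarrow> r < u" "\<And>u r. u \<in> U' \<Longrightarrow> r \<in> R' \<Longrightarrow> r < u"
    and w: "\<And>u. u \<in> U \<Longrightarrow> w u \<noteq> 0" "\<And>u. u \<in> U' \<Longrightarrow> w u \<noteq> 0"
    and sum: "sum w U = sum w U'" and finw: "sum w U \<noteq> \<infinity>"
  shows "U = U'"
proof -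
  have le: "U \<subseteq> U'" if eq: "U \<union> R = U' \<union> R'" and fin: "finite U" "finite U'"
    and up: "\<And>u r. u \<in> U \<Longrightarrow> r \<in> R \<Longrightarrow> r < u" "\<And>u r. u \<in> U' \<Longrightarrow> r \<in> R' \<Longrightarrow> r < u"
    and w: "\<And>u. u \<in> U \<Longrightarrow> w u \<noteq> 0"
    and sum: "sum w U = sum w U'" and finw: "sum w U \<noteq> \<infinity>" for U U' R R' :: "real set"
  proof (rule ccontr)
    assume "\<not> U \<subseteq> U'"
    then obtain p where p: "p \<in> U" "p \<notin> U'" by blast
    then have pR: "p \<in> R'" using eq by blast
    \<comment> \<open>\<open>p\<close> lies below all of \<open>U'\<close>, so no element of
      \<open>U'\<close> can belong to \<open>R\<close>, which lies below \<open>p\<close>.\<close>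
    have "U' \<subseteq> U"
    proof
      fix q assume q: "q \<in> U'"
      then have "p < q" using up(2) pR by blast
      moreover have "q \<in> U \<or> q \<in> R" using q eq by blast
      ultimately show "q \<in> U" using up(1)[OF p(1), of q] by auto
    qed
    then have "sum w U = sum w (U - U') + sum w U'" using fin(1) by (rule sum.subset_diff)
    then have "sum w U + 0 = sum w U + sum w (U - U')" using sum by (simp add: add.commute)
    then have "sum w (U - U') = 0" using finw by (metis enat_add_left_cancel)
    moreover have "finite (U - U')" "p \<in> U - U'" using fin p by auto
    ultimately have "w p = 0" by (simp add: sum_eq_0_iff)
    then show False using w p by blast
  qed
  show ?thesis
  proof
    show "U \<subseteq> U'" by (rule le[OF eq fin up w(1) sum finw])
    show "U' \<subseteq> U" by (rule le[OF eq[symmetric] fin(2,1) up(2,1) w(2) sum[symmetric]]) (use finw sum in simp_all)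
  qed
qed

section \<open>Moving exponents from the unstable to the center bundle\<close>

text \<open>The situation with a nonzero center bundle. \<open>Ku\<close>, \<open>Kc\<close> and
  \<open>Ks\<close> are the real exponents carried by the three bundles, and minus infinity sits in
  the stable one. Both dominations have the same block length, as in
  \<open>partially_hyperbolic\<close>.\<close>

locale center_unstable_splitting =
  fixes J :: "'h::{real_inner, banach} \<Rightarrow>\<^sub>L 'h" and f :: "'x::t2_space \<Rightarrow> 'x" and M :: "'x measure"
    and A :: "'x \<Rightarrow> 'h \<Rightarrow>\<^sub>L 'h" and Eu Ec Es :: "'x \<Rightarrow> 'h set" and Pu Pc Ps :: "'x \<Rightarrow> 'h \<Rightarrow>\<^sub>L 'h"
    and Ku Kc Ks :: "real set" and l :: nat and \<alpha> \<beta> :: real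
  assumes J: "hilbert_scalars J" and sets_M: "sets M = sets borel" and prob_M: "prob_space M"
    and f_cont: "continuous_on UNIV f" and compact_X: "compact (UNIV :: 'x set)" and A: "A \<in> C0I J M"
    and projections: "bundle_projection f A Eu Pu" "bundle_projection f A Ec Pc" "bundle_projection f A Es Ps"
    and P_cont: "continuous_on UNIV (\<lambda>x. Pu x v)" "continuous_on UNIV (\<lambda>x. Pc x v)" "continuous_on UNIV (\<lambda>x. Ps x v)"
    and P_sum: "Pu x v + Pc x v + Ps x v = v"
    and P_orth: "v \<in> Eu x \<Longrightarrow> Pc x v = 0" "v \<in> Eu x \<Longrightarrow> Ps x v = 0" "v \<in> Ec x \<Longrightarrow> Pu x v = 0"
      "v \<in> Ec x \<Longrightarrow> Ps x v = 0" "v \<in> Es x \<Longrightarrow> Pu x v = 0" "v \<in> Es x \<Longrightarrow> Pc x v = 0"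
    and dom_uc: "dominated J f A UNIV l \<alpha> Eu Ec" and dom_cs: "dominated J f A UNIV l \<beta> Ec Es"
    and \<alpha>: "0 < \<alpha>" "\<alpha> < 1" and \<beta>: "0 < \<beta>" "\<beta> < 1"
    and nonzero: "Eu x \<noteq> {0}" "Ec x \<noteq> {0}"
    and AE_points: "AE x in M. x \<in> oseledets_points J f M A"
    and exponents: "exponents J f M A = Ku \<union> Kc \<union> Ks" "Ku \<inter> Kc = {}" "Ku \<inter> Ks = {}" "Kc \<inter> Ks = {}"
    and signs: "\<kappa> \<in> Ku \<Longrightarrow> 0 < \<kappa>" "\<kappa> \<in> Ks \<Longrightarrow> \<kappa> < 0"
    and bundles: "x \<in> oseledets_points J f M A \<Longrightarrow> Eu x = closure (span (\<Union>\<kappa>\<in>ereal ` Ku. oseledets f A x \<kappa>))"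
      "x \<in> oseledets_points J f M A \<Longrightarrow> Ec x = closure (span (\<Union>\<kappa>\<in>ereal ` Kc. oseledets f A x \<kappa>))"
      "x \<in> oseledets_points J f M A \<Longrightarrow> Es x = closure (span (\<Union>\<kappa>\<in>insert (-\<infinity>) (ereal ` Ks). oseledets f A x \<kappa>))"
begin

abbreviation "L \<equiv> lyapunov_operator f A"
abbreviation "m \<equiv> multiplicity J f M A"
abbreviation "points \<equiv> oseledets_points J f M A"
abbreviation "eig V y \<kappa> \<equiv> V y \<inter> eigenspace (L y) (exp \<kappa>)"

text \<open>Unlike \<open>Ku\<close>, \<open>Kc\<close>, \<open>Ks\<close>, it depends on the point
  and makes sense at every Ruelle point, so that points not yet known to be Oseledets points can be
  examined.\<close>

definition spectrum :: "('x \<Rightarrow> 'h set) \<Rightarrow> 'x \<Rightarrow> real set" where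
  "spectrum V y = {\<kappa>. eig V y \<kappa> \<noteq> {0}}"

definition D :: "real \<Rightarrow> real \<Rightarrow> 'x \<Rightarrow> 'h \<Rightarrow>\<^sub>L 'h" where
  "D a b x = exp a *\<^sub>R Pu x + exp b *\<^sub>R Pc x + Ps x"

definition B :: "real \<Rightarrow> real \<Rightarrow> 'x \<Rightarrow> 'h \<Rightarrow>\<^sub>L 'h" where
  "B a b x = A x o\<^sub>L D a b x"

lemmas Pu = bundle_projectionD[OF projections(1)]
lemmas Pc = bundle_projectionD[OF projections(2)]
lemmas Ps = bundle_projectionD[OF projections(3)]
lemmas uc = dominatedD[OF dom_uc]
lemmas cs = dominatedD[OF dom_cs]

lemma A_facts: "continuous_on UNIV A" "compact_operator (A x)" "A x o\<^sub>L J = J o\<^sub>L A x"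
  using A by (simp_all add: C0I_def)

lemma D_apply: "D a b x v = exp a *\<^sub>R Pu x v + exp b *\<^sub>R Pc x v + Ps x v"
  by (simp add: D_def blinfun.add_left blinfun.scaleR_left)

lemma P_D: "Pu x (D a b x v) = exp a *\<^sub>R Pu x v" "Pc x (D a b x v) = exp b *\<^sub>R Pc x v" "Ps x (D a b x v) = Ps x v"
  by (simp_all add: D_apply blinfun.add_right blinfun.scaleR_right Pu(6) Pc(6) Ps(6)
      P_orth(1,2)[OF Pu(2)] P_orth(3,4)[OF Pc(2)] P_orth(5,6)[OF Ps(2)])

lemma eq_by_projections:
  assumes "Pu x v = Pu x w" "Pc x v = Pc x w" "Ps x v = Ps x w"
  shows "v = w"
proof -
  have "v = Pu x v + Pc x v + Ps x v" by (rule P_sum[symmetric])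
  also have "\<dots> = w" by (simp only: assms P_sum)
  finally show ?thesis .
qed

text \<open>The shifts act as a group under addition: halving them gives the square root demanded by
  \<open>perturbed_lyapunov_approx\<close>, negating them the inverse.\<close>

lemma D_D: "D a b x (D a' b' x v) = D (a + a') (b + b') x v"
  by (rule eq_by_projections[of x]) (simp_all add: P_D exp_add)

lemma D_zero: "D 0 0 x = id_blinfun"
  by (rule blinfun_eqI) (simp add: D_apply P_sum)

text \<open>The original cocycle is the case of zero shifts, so statements about \<open>B\<close>
  for admissible shifts cover \<open>A\<close> as well.\<close>

lemma B_zero: "B 0 0 = A"
  by (rule ext, rule blinfun_eqI) (simp add: B_def D_zero)

lemma reducing_D: "reducing f A (D a b)"
  unfolding reducing_def D_apply
  by (simp add: inner_add_left inner_add_right Pu(4) Pc(4) Ps(4) blinfun.add_right blinfun.scaleR_right Pu(5) Pc(5) Ps(5))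

lemma D_square: "D (a / 2) (b / 2) x o\<^sub>L D (a / 2) (b / 2) x = D a b x"
  by (rule blinfun_eqI) (simp add: D_D)

lemma D_inverse: "D (- a) (- b) x o\<^sub>L D a b x = id_blinfun"
  by (rule blinfun_eqI) (simp add: D_D D_zero)

lemma B_square: "B a b = (\<lambda>x. A x o\<^sub>L (D (a / 2) (b / 2) x o\<^sub>L D (a / 2) (b / 2) x))"
  by (simp add: B_def D_square fun_eq_iff)

lemma convergent_B: "convergent (lyapunov_approx f (B a b) y) \<longleftrightarrow> convergent (lyapunov_approx f A y)"
  unfolding B_square
  by (rule perturbed_convergent(1)[OF reducing_D, where C' = "D (- a) (- b) y"]) (simp only: D_square D_inverse)

lemma lyapunov_operator_B:
  assumes "convergent (lyapunov_approx f A y)"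
  shows "lyapunov_operator f (B a b) y = D a b y o\<^sub>L L y"
proof -
  have "lyapunov_operator f (B a b) y = (D (a / 2) (b / 2) y o\<^sub>L D (a / 2) (b / 2) y) o\<^sub>L L y"
    unfolding B_square
    by (rule perturbed_convergent(2)[OF reducing_D _ assms, where C' = "D (- a) (- b) y"]) (simp only: D_square D_inverse)
  then show ?thesis by (simp only: D_square)
qed

lemma ruelle_point_B: "ruelle_point f (B a b) y \<longleftrightarrow> ruelle_point f A y"
proof (cases "convergent (lyapunov_approx f A y)")
  case True
  have "compact_operator (D a b y o\<^sub>L L y) \<longleftrightarrow> compact_operator (L y)"
  proof
    assume "compact_operator (D a b y o\<^sub>L L y)"
    then have "compact_operator (D (- a) (- b) y o\<^sub>L (D a b y o\<^sub>L L y))" by (rule compact_operator_compose_left)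
    moreover have "D (- a) (- b) y o\<^sub>L (D a b y o\<^sub>L L y) = L y"
      by (rule blinfun_eqI) (simp add: D_D D_zero)
    ultimately show "compact_operator (L y)" by simp
  qed (rule compact_operator_compose_left)
  then show ?thesis using True by (simp add: ruelle_point_def convergent_B lyapunov_operator_B)
qed (simp add: ruelle_point_def convergent_B)

lemma ruelle_pointD:
  assumes "ruelle_point f A y"
  shows "convergent (lyapunov_approx f A y)" "compact_operator (L y)" "positive_operator (L y)"
  using assms positive_lyapunov_operator by (auto simp: ruelle_point_def)

lemma approx_invariant:
  assumes "bundle_projection f A V Q" "n > 0" "v \<in> V y"
  shows "lyapunov_approx f A y n v \<in> V y"
proof -
  have "Q y (lyapunov_approx f A y n v) = lyapunov_approx f A y n (Q y v)"
    using reducing_lyapunov_approx[OF bundle_projectionD(1)[OF assms(1)] assms(2), of y]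
    by (metis blinfun_apply_blinfun_compose)
  also have "Q y v = v" by (rule bundle_projectionD(3)[OF assms(1,3)])
  finally show ?thesis
    using bundle_projectionD(2)[OF assms(1), of y "lyapunov_approx f A y n v"] by simp
qed

lemma L_commute:
  assumes "bundle_projection f A V Q" "ruelle_point f A y"
  shows "Q y (L y v) = L y (Q y v)"
proof -
  have "Q y o\<^sub>L L y = L y o\<^sub>L Q y"
    by (rule lyapunov_operator_commute[OF ruelle_pointD(1)[OF assms(2)]])
      (rule reducing_lyapunov_approx[OF bundle_projectionD(1)[OF assms(1)]])
  then show ?thesis by (metis blinfun_apply_blinfun_compose)
qed

lemma L_invariant:
  assumes "bundle_projection f A V Q" "ruelle_point f A y" "v \<in> V y"
  shows "L y v \<in> V y"
  using L_commute[OF assms(1,2), of v] bundle_projectionD(2)[OF assms(1), of y "L y v"]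
    bundle_projectionD(3)[OF assms(1,3)] by simp

lemma L_scalars: "ruelle_point f A y \<Longrightarrow> L y o\<^sub>L J = J o\<^sub>L L y"
  by (rule lyapunov_operator_commute[OF ruelle_pointD(1), symmetric])
    (assumption, rule lyapunov_approx_commute, assumption, rule scalars_gram[OF J A_facts(3)])

section \<open>Exponents at a Ruelle point and their order\<close>

lemma spectrum_iff:
  "subspace (V y) \<Longrightarrow> \<kappa> \<in> spectrum V y \<longleftrightarrow> (\<exists>v. v \<in> V y \<and> v \<noteq> 0 \<and> L y v = exp \<kappa> *\<^sub>R v)"
proof -
  assume "subspace (V y)"
  then have "0 \<in> eig V y \<kappa>" using subspace_0[OF subspace_eigenspace] by (simp add: subspace_0)
  then have "eig V y \<kappa> \<noteq> {0} \<longleftrightarrow> (\<exists>v. v \<in> eig V y \<kappa> \<and> v \<noteq> 0)" by auto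
  then show ?thesis unfolding spectrum_def eigenspace_def by (simp add: conj_comms)
qed

lemma not_spectrum: "\<kappa> \<notin> spectrum V y \<Longrightarrow> eig V y \<kappa> = {0}"
  by (simp add: spectrum_def)

text \<open>The logarithm of \<open>dominated_eigenvalues\<close>: across a domination the exponents
  have a gap of at least \<open>- ln a / l\<close>.\<close>

lemma eig_order:
  assumes dom: "dominated J f A UNIV l a V1 V2" and a: "0 < a" and Q: "bundle_projection f A V1 Q"
    and y: "ruelle_point f A y" and p: "p \<in> spectrum V1 y" and q: "q \<in> spectrum V2 y"
  shows "real l * q \<le> ln a + real l * p"
proof -
  obtain v where v: "v \<in> V1 y" "v \<noteq> 0" "L y v = exp p *\<^sub>R v"
    using p unfolding spectrum_iff[where V = V1, OF dominatedD(1)[OF dom]] by blast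
  obtain u where u: "u \<in> V2 y" "u \<noteq> 0" "L y u = exp q *\<^sub>R u"
    using q unfolding spectrum_iff[where V = V2, OF dominatedD(2)[OF dom]] by blast
  have "exp q ^ l \<le> a * exp p ^ l"
    by (rule dominated_eigenvalues[OF dom a ruelle_pointD(1)[OF y] approx_invariant[OF Q] u v])
  then have "exp (real l * q) \<le> exp (ln a + real l * p)"
    using a by (simp add: exp_add exp_of_nat_mult)
  then show ?thesis by simp
qed

text \<open>The third condition says that \<open>\<alpha> * exp (l * (b - a))\<close> stays below 1,
  that is, the shifts do not use up the gap which domination leaves between unstable and center
  exponents. The last one keeps the unstable exponents positive.\<close>

definition admissible :: "real \<Rightarrow> real \<Rightarrow> bool" where
  "admissible a b \<longleftrightarrow> a \<le> 0 \<and> 0 \<le> b \<and> real l * (b - a) < - ln \<alpha> \<and> (\<forall>\<kappa>\<in>Ku. 0 < \<kappa> + a)"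

lemma admissible_zero: "admissible 0 0"
  using \<alpha> signs(1) by (simp add: admissible_def)

lemma order_uc:
  assumes ab: "admissible a b" and y: "ruelle_point f A y" and p: "p \<in> spectrum Eu y" and q: "q \<in> spectrum Ec y"
  shows "q + b < p + a"
proof -
  have "real l * q \<le> ln \<alpha> + real l * p" by (rule eig_order[OF dom_uc \<alpha>(1) projections(1) y p q])
  moreover have "real l * (b - a) < - ln \<alpha>" using ab by (simp add: admissible_def)
  ultimately have "real l * (q + b) < real l * (p + a)" by (simp add: algebra_simps)
  then show ?thesis by (simp add: mult_less_cancel_left)
qed

lemma order_cs:
  assumes ab: "admissible a b" and y: "ruelle_point f A y" and p: "p \<in> spectrum Ec y" and q: "q \<in> spectrum Es y"
  shows "q < p + b"
proof -
  have "real l * q \<le> ln \<beta> + real l * p" by (rule eig_order[OF dom_cs \<beta>(1) projections(2) y p q])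
  moreover have "ln \<beta> < 0" using \<beta> by simp
  ultimately have "real l * q < real l * p" by linarith
  then have "q < p" by (simp add: mult_less_cancel_left)
  then show ?thesis using ab by (simp add: admissible_def)
qed

lemma J_eig:
  assumes V: "closed_subspace J (V y)" and y: "ruelle_point f A y" and v: "v \<in> eig V y \<kappa>"
  shows "J v \<in> eig V y \<kappa>"
proof -
  have "L y (J v) = J (L y v)" using L_scalars[OF y] by (metis blinfun_apply_blinfun_compose)
  then show ?thesis using V v by (simp add: closed_subspace_def eigenspace_def blinfun.scaleR_right)
qed

lemma subspace_eig: "closed_subspace J (V y) \<Longrightarrow> subspace (eig V y \<kappa>)"
  by (rule subspace_inter[OF _ subspace_eigenspace]) (simp add: closed_subspace_def)

lemma hdim_eig_eq_0:
  assumes V: "closed_subspace J (V y)" and y: "ruelle_point f A y"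
  shows "hdim J (eig V y \<kappa>) = 0 \<longleftrightarrow> \<kappa> \<notin> spectrum V y"
proof
  assume "hdim J (eig V y \<kappa>) = 0"
  then have "eig V y \<kappa> = {0}"
    by (intro hdim_eq_0[OF J subspace_eig[where V = V, OF V]] J_eig[where V = V, OF V y])
  then show "\<kappa> \<notin> spectrum V y" by (simp add: spectrum_def)
qed (simp add: not_spectrum)

text \<open>A bundle that dominates another one is finite dimensional, and the Lyapunov operator is
  injective on it, so the spectral decomposition applies.\<close>

lemma dominating_spectrum:
  assumes dom: "dominated J f A UNIV l a V1 V2" and Q: "bundle_projection f A V1 Q" and y: "ruelle_point f A y"
  shows "finite (spectrum V1 y)" and "hdim J (V1 y) = (\<Sum>\<kappa>\<in>spectrum V1 y. hdim J (eig V1 y \<kappa>))"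
proof -
  obtain \<theta> where \<theta>: "\<theta> > 0" "\<And>v. v \<in> V1 y \<Longrightarrow> norm v = 1 \<Longrightarrow> \<theta> \<le> L y v \<bullet> v"
    using dominated_lyapunov_lower_bound[OF dom ruelle_pointD(1)[OF y] approx_invariant[OF Q]] by blast
  have inj: "v = 0" if "v \<in> V1 y" "L y v = 0" for v
  proof -
    have "\<theta> * (v \<bullet> v) \<le> L y v \<bullet> v" by (rule form_lower_bound_scale[OF dominatedD(1)[OF dom] \<theta>(2) that(1)])
    then have "v \<bullet> v \<le> 0" using that(2) \<theta>(1) by (simp add: mult_le_0_iff)
    then have "v \<bullet> v = 0" by (intro antisym inner_ge_zero)
    then show ?thesis by simp
  qed
  note sp = finite_dim_spectral[OF J ruelle_pointD(3,2)[OF y] L_scalars[OF y] dominatedD(3)[OF dom]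
      dominated_finite_dim[OF dom A_facts(2)] L_invariant[OF Q y] inj]
  show "finite (spectrum V1 y)" unfolding spectrum_def by (rule sp(1); assumption)
  show "hdim J (V1 y) = (\<Sum>\<kappa>\<in>spectrum V1 y. hdim J (eig V1 y \<kappa>))"
    unfolding spectrum_def by (rule sp(2); assumption)
qed

lemma dominating_spectrum_nonempty:
  assumes dom: "dominated J f A UNIV l a V1 V2" and Q: "bundle_projection f A V1 Q" and y: "ruelle_point f A y"
    and nz: "V1 y \<noteq> {0}"
  shows "spectrum V1 y \<noteq> {}"
proof
  assume "spectrum V1 y = {}"
  then have "hdim J (V1 y) = 0" using dominating_spectrum(2)[OF dom Q y] by simp
  moreover have "J v \<in> V1 y" if "v \<in> V1 y" for v
    using dominatedD(3)[OF dom, of y] that by (simp add: closed_subspace_def)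
  ultimately have "V1 y = {0}" by (intro hdim_eq_0[OF J dominatedD(1)[OF dom]])
  then show False using nz by simp
qed

text \<open>No domination between \<open>Eu\<close> and \<open>Es\<close> is given directly; a
  center exponent, which exists since the center bundle is nonzero, lies in between.\<close>

lemma order_us:
  assumes ab: "admissible a b" and y: "ruelle_point f A y" and p: "p \<in> spectrum Eu y" and q: "q \<in> spectrum Es y"
  shows "q < p + a"
proof -
  obtain r where r: "r \<in> spectrum Ec y" using dominating_spectrum_nonempty[OF dom_cs projections(2) y nonzero(2)] by blast
  show ?thesis using order_uc[OF ab y p r] order_cs[OF ab y r q] by linarith
qed

section \<open>Oseledets subspaces of the perturbed cocycle\<close>

lemma scaled_eigenvector: "exp a *\<^sub>R w = exp \<kappa> *\<^sub>R v \<longleftrightarrow> w = exp (\<kappa> - a) *\<^sub>R (v :: 'h)"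
proof -
  have e: "exp \<kappa> *\<^sub>R v = exp a *\<^sub>R (exp (\<kappa> - a) *\<^sub>R v)"
    by (simp add: exp_diff)
  show ?thesis unfolding e by (simp only: scaleR_cancel_left exp_not_eq_zero simp_thms)
qed

text \<open>The perturbed Lyapunov operator is \<open>D\<close> after the old one. Both respect the
  three bundles, so the eigenvalue equation splits into components whose exponents are shifted back
  by \<open>a\<close>, \<open>b\<close> and 0.\<close>

lemma eigenspace_B:
  assumes y: "ruelle_point f A y"
  shows "v \<in> oseledets f (B a b) y (ereal \<kappa>) \<longleftrightarrow>
    Pu y v \<in> eig Eu y (\<kappa> - a) \<and> Pc y v \<in> eig Ec y (\<kappa> - b) \<and> Ps y v \<in> eig Es y \<kappa>"
proof -
  note c = L_commute[OF projections(1) y] L_commute[OF projections(2) y] L_commute[OF projections(3) y]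
  have "v \<in> oseledets f (B a b) y (ereal \<kappa>) \<longleftrightarrow> D a b y (L y v) = exp \<kappa> *\<^sub>R v"
    by (simp add: oseledets_ereal eigenspace_def lyapunov_operator_B[OF ruelle_pointD(1)[OF y]])
  also have "\<dots> \<longleftrightarrow> exp a *\<^sub>R L y (Pu y v) = exp \<kappa> *\<^sub>R Pu y v \<and> exp b *\<^sub>R L y (Pc y v) = exp \<kappa> *\<^sub>R Pc y v
      \<and> L y (Ps y v) = exp \<kappa> *\<^sub>R Ps y v" (is "?l \<longleftrightarrow> ?r")
  proof
    assume ?l
    then have "Pu y (D a b y (L y v)) = Pu y (exp \<kappa> *\<^sub>R v)" "Pc y (D a b y (L y v)) = Pc y (exp \<kappa> *\<^sub>R v)"
      "Ps y (D a b y (L y v)) = Ps y (exp \<kappa> *\<^sub>R v)" by simp_all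
    then show ?r by (simp add: P_D c blinfun.scaleR_right)
  next
    assume r: ?r
    show ?l by (rule eq_by_projections[of y]) (use r in \<open>simp_all add: P_D c blinfun.scaleR_right\<close>)
  qed
  finally show ?thesis
    by (simp add: scaled_eigenvector eigenspace_def Pu(2) Pc(2) Ps(2))
qed

lemma oseledets_B_kernel:
  assumes y: "ruelle_point f A y"
  shows "oseledets f (B a b) y (-\<infinity>) = oseledets f A y (-\<infinity>)"
proof -
  have "D a b y (L y v) = 0 \<longleftrightarrow> L y v = 0" for v
  proof
    assume "D a b y (L y v) = 0"
    then have "D (- a) (- b) y (D a b y (L y v)) = 0" by simp
    then show "L y v = 0" by (simp add: D_D D_zero)
  qed simp
  then show ?thesis by (simp add: oseledets_def lyapunov_operator_B[OF ruelle_pointD(1)[OF y]])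
qed

lemma closed_subspaces: "closed_subspace J (Eu y)" "closed_subspace J (Ec y)" "closed_subspace J (Es y)"
  by (rule uc(3), rule uc(4), rule cs(4))

lemma zero_eig: "0 \<in> eig Eu y \<kappa>" "0 \<in> eig Ec y \<kappa>" "0 \<in> eig Es y \<kappa>"
  using closed_subspaces[of y] by (auto simp: closed_subspace_def eigenspace_def subspace_0)

text \<open>For admissible shifts the three shifted spectra are disjoint, so at most one of the
  three components of an eigenvector can be nonzero.\<close>

lemma oseledets_B:
  assumes ab: "admissible a b" and y: "ruelle_point f A y"
  shows "oseledets f (B a b) y (ereal \<kappa>) = (if \<kappa> - a \<in> spectrum Eu y then eig Eu y (\<kappa> - a)
    else if \<kappa> - b \<in> spectrum Ec y then eig Ec y (\<kappa> - b) else eig Es y \<kappa>)"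
proof -
  have zu: "Pc y v = 0 \<and> Ps y v = 0 \<and> Pu y v = v" if "v \<in> Eu y" for v using that P_orth(1,2) Pu(3) by blast
  have zc: "Pu y v = 0 \<and> Ps y v = 0 \<and> Pc y v = v" if "v \<in> Ec y" for v using that P_orth(3,4) Pc(3) by blast
  have zs: "Pu y v = 0 \<and> Pc y v = 0 \<and> Ps y v = v" if "v \<in> Es y" for v using that P_orth(5,6) Ps(3) by blast
  show ?thesis
  proof (cases "\<kappa> - a \<in> spectrum Eu y")
    case u: True
    have "\<kappa> - b \<notin> spectrum Ec y" using order_uc[OF ab y u, of "\<kappa> - b"] by auto
    moreover have "\<kappa> \<notin> spectrum Es y" using order_us[OF ab y u, of \<kappa>] by auto
    ultimately have e: "eig Ec y (\<kappa> - b) = {0}" "eig Es y \<kappa> = {0}" by - (rule not_spectrum, assumption)+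
    have "v \<in> oseledets f (B a b) y (ereal \<kappa>) \<longleftrightarrow> v \<in> eig Eu y (\<kappa> - a)" for v
      unfolding eigenspace_B[OF y] e
    proof
      assume v: "Pu y v \<in> eig Eu y (\<kappa> - a) \<and> Pc y v \<in> {0} \<and> Ps y v \<in> {0}"
      then have "v = Pu y v" using P_sum[of y v] by simp
      then show "v \<in> eig Eu y (\<kappa> - a)" using v by simp
    qed (use zu in simp)
    then show ?thesis using u by auto
  next
    case u: False
    show ?thesis
    proof (cases "\<kappa> - b \<in> spectrum Ec y")
      case c: True
      have "\<kappa> \<notin> spectrum Es y" using order_cs[OF ab y c, of \<kappa>] by auto
      with u have e: "eig Eu y (\<kappa> - a) = {0}" "eig Es y \<kappa> = {0}" by - (rule not_spectrum, assumption)+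
      have "v \<in> oseledets f (B a b) y (ereal \<kappa>) \<longleftrightarrow> v \<in> eig Ec y (\<kappa> - b)" for v
        unfolding eigenspace_B[OF y] e
      proof
        assume v: "Pu y v \<in> {0} \<and> Pc y v \<in> eig Ec y (\<kappa> - b) \<and> Ps y v \<in> {0}"
        then have "v = Pc y v" using P_sum[of y v] by simp
        then show "v \<in> eig Ec y (\<kappa> - b)" using v by simp
      qed (use zc in simp)
      then show ?thesis using u c by auto
    next
      case c: False
      from u c have e: "eig Eu y (\<kappa> - a) = {0}" "eig Ec y (\<kappa> - b) = {0}" by - (rule not_spectrum, assumption)+
      have "v \<in> oseledets f (B a b) y (ereal \<kappa>) \<longleftrightarrow> v \<in> eig Es y \<kappa>" for v
        unfolding eigenspace_B[OF y] e
      proof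
        assume v: "Pu y v \<in> {0} \<and> Pc y v \<in> {0} \<and> Ps y v \<in> eig Es y \<kappa>"
        then have "v = Ps y v" using P_sum[of y v] by simp
        then show "v \<in> eig Es y \<kappa>" using v by simp
      qed (use zs in simp)
      then show ?thesis using u c by auto
    qed
  qed
qed

section \<open>Multiplicities and Oseledets points of the perturbed cocycle\<close>

text \<open>The candidate for the multiplicities of \<open>B a b\<close>. For admissible shifts the
  cases exclude each other, by the order of the exponents.\<close>

definition mult_B :: "real \<Rightarrow> real \<Rightarrow> real \<Rightarrow> enat" where
  "mult_B a b \<kappa> = (if \<kappa> - a \<in> Ku then m (\<kappa> - a) else if \<kappa> - b \<in> Kc then m (\<kappa> - b)
    else if \<kappa> \<in> Ks then m \<kappa> else 0)"

text \<open>The shifts do not occur here. So this is a common characterisation through which the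
  Oseledets points of the original and of the perturbed cocycle can be compared.\<close>

definition good :: "'x \<Rightarrow> bool" where
  "good y \<longleftrightarrow> ruelle_point f A y \<and> spectrum Eu y = Ku \<and> spectrum Ec y = Kc \<and> spectrum Es y = Ks \<and>
    (\<forall>\<kappa>\<in>Ku. hdim J (eig Eu y \<kappa>) = m \<kappa>) \<and> (\<forall>\<kappa>\<in>Kc. hdim J (eig Ec y \<kappa>) = m \<kappa>) \<and>
    (\<forall>\<kappa>\<in>Ks. hdim J (eig Es y \<kappa>) = m \<kappa>)"

lemma mult_nonzero: "m \<kappa> \<noteq> 0 \<longleftrightarrow> \<kappa> \<in> Ku \<union> Kc \<union> Ks"
  unfolding exponents(1)[symmetric] by (simp add: exponents_def)

lemma mult_B_zero: "mult_B 0 0 = m"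
proof
  fix \<kappa>
  show "mult_B 0 0 \<kappa> = m \<kappa>" using mult_nonzero[of \<kappa>] by (auto simp: mult_B_def)
qed

lemma bundle_inter:
  "Eu y \<inter> Ec y = {0}" "Eu y \<inter> Es y = {0}" "Ec y \<inter> Es y = {0}"
proof -
  show "Eu y \<inter> Ec y = {0}" by (rule uc(7))
  show "Ec y \<inter> Es y = {0}" by (rule cs(7))
  have "v = 0" if "v \<in> Eu y" "v \<in> Es y" for v using Pu(3)[OF that(1)] P_orth(5)[OF that(2)] by simp
  moreover have "0 \<in> Eu y" "0 \<in> Es y" using zero_eig(1,3)[of y 0] by simp_all
  ultimately show "Eu y \<inter> Es y = {0}" by blast
qed

lemma points_eigenspace:
  assumes y: "y \<in> points"
  shows "\<kappa> \<in> Ku \<Longrightarrow> eigenspace (L y) (exp \<kappa>) \<subseteq> Eu y"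
    and "\<kappa> \<in> Kc \<Longrightarrow> eigenspace (L y) (exp \<kappa>) \<subseteq> Ec y"
    and "\<kappa> \<in> Ks \<Longrightarrow> eigenspace (L y) (exp \<kappa>) \<subseteq> Es y"
proof -
  have sub: "oseledets f A y \<mu> \<subseteq> closure (span (\<Union>\<kappa>\<in>S. oseledets f A y \<kappa>))" if "\<mu> \<in> S" for \<mu> S
    using UN_upper[OF that] by (rule subset_trans[OF _ subset_trans[OF span_superset closure_subset]])
  show "eigenspace (L y) (exp \<kappa>) \<subseteq> Eu y" if "\<kappa> \<in> Ku"
    unfolding bundles(1)[OF y] oseledets_ereal[symmetric] by (rule sub) (use that in simp)
  show "eigenspace (L y) (exp \<kappa>) \<subseteq> Ec y" if "\<kappa> \<in> Kc"
    unfolding bundles(2)[OF y] oseledets_ereal[symmetric] by (rule sub) (use that in simp)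
  show "eigenspace (L y) (exp \<kappa>) \<subseteq> Es y" if "\<kappa> \<in> Ks"
    unfolding bundles(3)[OF y] oseledets_ereal[symmetric] by (rule sub) (use that in simp)
qed

text \<open>At an Oseledets point the eigenspace of each exponent lies entirely in the bundle that
  carries the exponent, and the other two bundles meet that bundle only in 0.\<close>

lemma points_good:
  assumes y: "y \<in> points"
  shows "good y"
proof -
  note r = oseledets_pointsD(2)[OF y]
  note hd = oseledets_pointsD(5)[OF y, unfolded oseledets_ereal]
  have full: "hdim J (eig V y \<kappa>) = m \<kappa>" if "eigenspace (L y) (exp \<kappa>) \<subseteq> V y" for V \<kappa>
    using hd[of \<kappa>] Int_absorb1[OF that] by simp
  have mult: "\<kappa> \<in> Ku \<union> Kc \<union> Ks" if V: "closed_subspace J (V y)" and sp: "\<kappa> \<in> spectrum V y" for V \<kappa>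
  proof (rule ccontr)
    assume "\<kappa> \<notin> Ku \<union> Kc \<union> Ks"
    then have "m \<kappa> = 0" using mult_nonzero by blast
    then have "hdim J (eigenspace (L y) (exp \<kappa>)) = 0" using hd by simp
    moreover have "J v \<in> eigenspace (L y) (exp \<kappa>)" if "v \<in> eigenspace (L y) (exp \<kappa>)" for v
      using J_eig[where V = "\<lambda>_. UNIV", OF _ r] that by (simp add: closed_subspace_def)
    ultimately have "eigenspace (L y) (exp \<kappa>) = {0}" by (intro hdim_eq_0[OF J subspace_eigenspace])
    then have "eig V y \<kappa> \<subseteq> {0}" by blast
    moreover have "0 \<in> eig V y \<kappa>" by (rule subspace_0[OF subspace_eig[where V = V, OF V]])
    ultimately have "eig V y \<kappa> = {0}" by blast
    then show False using sp by (simp add: spectrum_def)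
  qed
  have iff: "spectrum V y = K"
    if V: "closed_subspace J (V y)" and K: "\<And>\<kappa>. \<kappa> \<in> K \<Longrightarrow> eigenspace (L y) (exp \<kappa>) \<subseteq> V y" "K \<subseteq> Ku \<union> Kc \<union> Ks"
      and other: "\<And>\<kappa>. \<kappa> \<in> Ku \<union> Kc \<union> Ks - K \<Longrightarrow> eig V y \<kappa> = {0}" for V K
  proof (intro set_eqI iffI)
    fix \<kappa> assume k: "\<kappa> \<in> K"
    then have "m \<kappa> \<noteq> 0" using K(2) mult_nonzero by blast
    then have "hdim J (eig V y \<kappa>) \<noteq> 0" using full[where V = V, OF K(1)[OF k]] by simp
    then show "\<kappa> \<in> spectrum V y" using hdim_eig_eq_0[where V = V, OF V r] by blast
  next
    fix \<kappa> assume k: "\<kappa> \<in> spectrum V y"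
    show "\<kappa> \<in> K"
    proof (rule ccontr)
      assume "\<kappa> \<notin> K"
      then have "eig V y \<kappa> = {0}" using mult[where V = V, OF V k] by (intro other) blast
      then show False using k by (simp add: spectrum_def)
    qed
  qed
  note pe = points_eigenspace[OF y]
  have inter: "eig V y \<kappa> = {0}" if "closed_subspace J (V y)" "eigenspace (L y) (exp \<kappa>) \<subseteq> W y" "V y \<inter> W y = {0}" for V W \<kappa>
  proof -
    have "eig V y \<kappa> \<subseteq> {0}" using that(2,3) by blast
    moreover have "0 \<in> eig V y \<kappa>" using subspace_0[OF subspace_eig[where V = V, OF that(1)]] .
    ultimately show ?thesis by blast
  qed
  have "spectrum Eu y = Ku"
  proof (rule iff[where V = Eu, OF closed_subspaces(1) pe(1)])
    show "eig Eu y \<kappa> = {0}" if k: "\<kappa> \<in> Ku \<union> Kc \<union> Ks - Ku" for \<kappa>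
    proof (cases "\<kappa> \<in> Kc")
      case True then show ?thesis by (intro inter[where V = Eu and W = Ec, OF closed_subspaces(1) pe(2) bundle_inter(1)])
    next
      case False
      then have "\<kappa> \<in> Ks" using k by blast
      then show ?thesis by (intro inter[where V = Eu and W = Es, OF closed_subspaces(1) pe(3) bundle_inter(2)])
    qed
  qed auto
  moreover have "spectrum Ec y = Kc"
  proof (rule iff[where V = Ec, OF closed_subspaces(2) pe(2)])
    show "eig Ec y \<kappa> = {0}" if k: "\<kappa> \<in> Ku \<union> Kc \<union> Ks - Kc" for \<kappa>
    proof (cases "\<kappa> \<in> Ku")
      case True then show ?thesis
        by (intro inter[where V = Ec and W = Eu, OF closed_subspaces(2) pe(1)]) (assumption, subst Int_commute, rule bundle_inter)
    next
      case False
      then have "\<kappa> \<in> Ks" using k by blast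
      then show ?thesis by (intro inter[where V = Ec and W = Es, OF closed_subspaces(2) pe(3) bundle_inter(3)])
    qed
  qed auto
  moreover have "spectrum Es y = Ks"
  proof (rule iff[where V = Es, OF closed_subspaces(3) pe(3)])
    show "eig Es y \<kappa> = {0}" if k: "\<kappa> \<in> Ku \<union> Kc \<union> Ks - Ks" for \<kappa>
    proof (cases "\<kappa> \<in> Ku")
      case True then show ?thesis
        by (intro inter[where V = Es and W = Eu, OF closed_subspaces(3) pe(1)]) (assumption, subst Int_commute, rule bundle_inter)
    next
      case False
      then have "\<kappa> \<in> Kc" using k by blast
      then show ?thesis
        by (intro inter[where V = Es and W = Ec, OF closed_subspaces(3) pe(2)]) (assumption, subst Int_commute, rule bundle_inter)
    qed
  qed auto
  ultimately show ?thesis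
    unfolding good_def using r full[where V = Eu, OF pe(1)] full[where V = Ec, OF pe(2)] full[where V = Es, OF pe(3)] by (intro conjI ballI)
qed

lemma points_exist: obtains x where "x \<in> points"
  by (rule oseledets_points_exist[OF prob_M AE_points])

lemma goodD:
  assumes "good y"
  shows "ruelle_point f A y" "spectrum Eu y = Ku" "spectrum Ec y = Kc" "spectrum Es y = Ks"
    "\<kappa> \<in> Ku \<Longrightarrow> hdim J (eig Eu y \<kappa>) = m \<kappa>" "\<kappa> \<in> Kc \<Longrightarrow> hdim J (eig Ec y \<kappa>) = m \<kappa>"
    "\<kappa> \<in> Ks \<Longrightarrow> hdim J (eig Es y \<kappa>) = m \<kappa>"
  using assms by (simp_all add: good_def)

lemma good_exists: obtains x where "good x"
  using points_exist points_good by blast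

lemma finite_K: "finite Ku" "finite Kc"
proof -
  obtain x where x: "good x" by (rule good_exists)
  show "finite Ku" using dominating_spectrum(1)[OF dom_uc projections(1) goodD(1)[OF x]] goodD(2)[OF x] by simp
  show "finite Kc" using dominating_spectrum(1)[OF dom_cs projections(2) goodD(1)[OF x]] goodD(3)[OF x] by simp
qed

lemma nonempty_K: "Ku \<noteq> {}" "Kc \<noteq> {}"
proof -
  obtain x where x: "good x" by (rule good_exists)
  show "Ku \<noteq> {}"
    using dominating_spectrum_nonempty[OF dom_uc projections(1) goodD(1)[OF x] nonzero(1)] goodD(2)[OF x] by simp
  show "Kc \<noteq> {}"
    using dominating_spectrum_nonempty[OF dom_cs projections(2) goodD(1)[OF x] nonzero(2)] goodD(3)[OF x] by simp
qed

lemma order_K: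
  assumes ab: "admissible a b"
  shows "p \<in> Ku \<Longrightarrow> q \<in> Kc \<Longrightarrow> q + b < p + a" "p \<in> Kc \<Longrightarrow> q \<in> Ks \<Longrightarrow> q < p + b"
    "p \<in> Ku \<Longrightarrow> q \<in> Ks \<Longrightarrow> q < p + a"
proof -
  obtain x where x: "good x" by (rule good_exists)
  note o = order_uc[OF ab goodD(1)[OF x]] order_cs[OF ab goodD(1)[OF x]] order_us[OF ab goodD(1)[OF x]]
  show "p \<in> Ku \<Longrightarrow> q \<in> Kc \<Longrightarrow> q + b < p + a" "p \<in> Kc \<Longrightarrow> q \<in> Ks \<Longrightarrow> q < p + b"
    "p \<in> Ku \<Longrightarrow> q \<in> Ks \<Longrightarrow> q < p + a"
    using o[unfolded goodD(2-4)[OF x]] by simp_all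
qed

lemma mult_B_shift:
  assumes ab: "admissible a b"
  shows "p \<in> Ku \<Longrightarrow> mult_B a b (p + a) = m p" "p \<in> Kc \<Longrightarrow> mult_B a b (p + b) = m p"
    "p \<in> Ks \<Longrightarrow> mult_B a b p = m p"
proof -
  show "p \<in> Ku \<Longrightarrow> mult_B a b (p + a) = m p" by (simp add: mult_B_def)
  show "mult_B a b (p + b) = m p" if p: "p \<in> Kc"
  proof -
    have "p + b - a \<notin> Ku" using order_K(1)[OF ab _ p, of "p + b - a"] by auto
    then show ?thesis using p by (simp add: mult_B_def)
  qed
  show "mult_B a b p = m p" if p: "p \<in> Ks"
  proof -
    have "p - a \<notin> Ku" using order_K(3)[OF ab _ p, of "p - a"] by auto
    moreover have "p - b \<notin> Kc" using order_K(2)[OF ab _ p, of "p - b"] by auto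
    ultimately show ?thesis using p by (simp add: mult_B_def)
  qed
qed

lemma mult_B_nonzero:
  "{\<kappa>. mult_B a b \<kappa> \<noteq> 0} = (\<lambda>\<kappa>. \<kappa> + a) ` Ku \<union> ((\<lambda>\<kappa>. \<kappa> + b) ` Kc \<union> Ks)"
proof -
  have shift: "\<kappa> \<in> (\<lambda>\<kappa>. \<kappa> + c) ` K \<longleftrightarrow> \<kappa> - c \<in> K" for \<kappa> c :: real and K
    by (auto simp: image_iff intro!: bexI[of _ "\<kappa> - c"])
  have nz: "p \<in> Ku \<Longrightarrow> m p \<noteq> 0" "p \<in> Kc \<Longrightarrow> m p \<noteq> 0" "p \<in> Ks \<Longrightarrow> m p \<noteq> 0" for p
    using mult_nonzero[of p] by simp_all
  have "mult_B a b \<kappa> \<noteq> 0 \<longleftrightarrow> \<kappa> - a \<in> Ku \<or> \<kappa> - b \<in> Kc \<or> \<kappa> \<in> Ks" for \<kappa>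
    using nz(1)[of "\<kappa> - a"] nz(2)[of "\<kappa> - b"] nz(3)[of \<kappa>] by (simp add: mult_B_def)
  then show ?thesis by (simp add: set_eq_iff shift)
qed

lemma has_multiplicities_if_good:
  assumes ab: "admissible a b" and y: "good y"
  shows "has_multiplicities J f (B a b) (mult_B a b) y"
  unfolding has_multiplicities_def
proof (intro conjI allI)
  note g = goodD[OF y]
  show "ruelle_point f (B a b) y" using g(1) by (simp only: ruelle_point_B)
  show "hdim J (oseledets f (B a b) y (ereal \<kappa>)) = mult_B a b \<kappa>" for \<kappa>
  proof -
    have "hdim J (eig Es y \<kappa>) = (if \<kappa> \<in> Ks then m \<kappa> else 0)"
      using g(7)[of \<kappa>] hdim_eig_eq_0[where V = Es, OF closed_subspaces(3) g(1), of \<kappa>] g(4) by simp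
    then show ?thesis
      unfolding oseledets_B[OF ab g(1)] g(2,3) mult_B_def using g(5)[of "\<kappa> - a"] g(6)[of "\<kappa> - b"] by simp
  qed
qed

text \<open>Domination fixes the order of the three parts of the spectrum, and the dimensions of the
  bundles fix where one part ends and the next begins; so the multiplicities alone
  determine which exponents belong to which bundle.\<close>

lemma good_if_has_multiplicities:
  assumes ab: "admissible a b" and h: "has_multiplicities J f (B a b) (mult_B a b) y"
  shows "good y"
proof -
  have y: "ruelle_point f A y" using h by (simp add: has_multiplicities_def ruelle_point_B)
  have mB: "mult_B a b \<kappa> = hdim J (if \<kappa> - a \<in> spectrum Eu y then eig Eu y (\<kappa> - a)
    else if \<kappa> - b \<in> spectrum Ec y then eig Ec y (\<kappa> - b) else eig Es y \<kappa>)" for \<kappa>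
    using h unfolding has_multiplicities_def oseledets_B[OF ab y] by simp
  \<comment> \<open>A reference point: its three spectra are \<open>Ku\<close>, \<open>Kc\<close>,
    \<open>Ks\<close>, and its bundles have the same dimensions as those at
    \<open>y\<close>.\<close>
  obtain x where x: "good x" by (rule good_exists)
  let ?a = "\<lambda>\<kappa>. \<kappa> + a" and ?b = "\<lambda>\<kappa>. \<kappa> + b"
  have shift: "\<kappa> \<in> (\<lambda>\<kappa>. \<kappa> + c) ` K \<longleftrightarrow> \<kappa> - c \<in> K" for \<kappa> c :: real and K
    by (auto simp: image_iff intro!: bexI[of _ "\<kappa> - c"])
  have inj: "inj_on (\<lambda>\<kappa>. \<kappa> + c) K" for c :: real and K by (simp add: inj_on_def)
  note cl = closed_subspaces[of y]
  note zero = hdim_eig_eq_0[where V = Eu, OF cl(1) y] hdim_eig_eq_0[where V = Ec, OF cl(2) y]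
    hdim_eig_eq_0[where V = Es, OF cl(3) y]
  have nz: "{\<kappa>. mult_B a b \<kappa> \<noteq> 0} = ?a ` spectrum Eu y \<union> (?b ` spectrum Ec y \<union> spectrum Es y)"
  proof -
    have "mult_B a b \<kappa> \<noteq> 0 \<longleftrightarrow> \<kappa> - a \<in> spectrum Eu y \<or> \<kappa> - b \<in> spectrum Ec y \<or> \<kappa> \<in> spectrum Es y" for \<kappa>
      unfolding mB by (simp add: zero)
    then show ?thesis by (simp add: set_eq_iff shift)
  qed
  have mu: "mult_B a b (p + a) = hdim J (eig Eu y p)" if "p \<in> spectrum Eu y" for p using that by (simp add: mB)
  have mc: "mult_B a b (p + b) = hdim J (eig Ec y p)" if p: "p \<in> spectrum Ec y" for p
  proof -
    have "p + b - a \<notin> spectrum Eu y" using order_uc[OF ab y _ p, of "p + b - a"] by auto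
    then show ?thesis using p by (simp add: mB)
  qed
  have ms: "mult_B a b p = hdim J (eig Es y p)" if p: "p \<in> spectrum Es y" for p
  proof -
    have "p - a \<notin> spectrum Eu y" using order_us[OF ab y _ p, of "p - a"] by auto
    moreover have "p - b \<notin> spectrum Ec y" using order_cs[OF ab y _ p, of "p - b"] by auto
    ultimately show ?thesis by (simp add: mB)
  qed
  note fin = dominating_spectrum(1)[OF dom_uc projections(1) y] dominating_spectrum(1)[OF dom_cs projections(2) y]
  have fd: "hdim J (Eu y) \<noteq> \<infinity>" "hdim J (Ec y) \<noteq> \<infinity>"
    using dominated_finite_dim[OF dom_uc A_facts(2)] dominated_finite_dim[OF dom_cs A_facts(2)] by (simp_all add: hdim_def)
  \<comment> \<open>The multiplicities over the shifted unstable exponents add up to the dimension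
    of the unstable bundle, both at \<open>y\<close> and at the reference point. These are the equal
    totals for \<open>upper_sets_eq\<close>.\<close>
  have su: "sum (mult_B a b) (?a ` spectrum Eu y) = hdim J (Eu y)"
    unfolding dominating_spectrum(2)[OF dom_uc projections(1) y] sum.reindex[OF inj] o_def
    by (intro sum.cong refl mu)
  have sc: "sum (mult_B a b) (?b ` spectrum Ec y) = hdim J (Ec y)"
    unfolding dominating_spectrum(2)[OF dom_cs projections(2) y] sum.reindex[OF inj] o_def
    by (intro sum.cong refl mc)
  have su': "sum (mult_B a b) (?a ` Ku) = hdim J (Eu x)"
    unfolding dominating_spectrum(2)[OF dom_uc projections(1) goodD(1)[OF x]] goodD(2)[OF x] sum.reindex[OF inj] o_def
    by (rule sum.cong) (simp_all add: mult_B_shift[OF ab] goodD(5)[OF x])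
  have sc': "sum (mult_B a b) (?b ` Kc) = hdim J (Ec x)"
    unfolding dominating_spectrum(2)[OF dom_cs projections(2) goodD(1)[OF x]] goodD(3)[OF x] sum.reindex[OF inj] o_def
    by (rule sum.cong) (simp_all add: mult_B_shift[OF ab] goodD(6)[OF x])
  have disjoint: "U \<inter> R = {}" if "\<And>u r :: real. u \<in> U \<Longrightarrow> r \<in> R \<Longrightarrow> r < u" for U R
  proof (rule equals0I)
    fix z assume "z \<in> U \<inter> R"
    then have "z < z" by (elim IntE) (rule that)
    then show False by simp
  qed
  have cancel: "R = R'" if "U \<union> R = U \<union> R'" "U \<inter> R = {}" "U \<inter> R' = {}" for U R R' :: "real set"
    using that by blast
  have all: "?a ` spectrum Eu y \<union> (?b ` spectrum Ec y \<union> spectrum Es y) = ?a ` Ku \<union> (?b ` Kc \<union> Ks)"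
    using nz mult_B_nonzero by simp
  have up1: "r < u" if "u \<in> ?a ` spectrum Eu y" "r \<in> ?b ` spectrum Ec y \<union> spectrum Es y" for u r
    using that order_uc[OF ab y] order_us[OF ab y] by auto
  have up1': "r < u" if "u \<in> ?a ` Ku" "r \<in> ?b ` Kc \<union> Ks" for u r
    using that order_K(1,3)[OF ab] by auto
  have up2: "r < u" if "u \<in> ?b ` spectrum Ec y" "r \<in> spectrum Es y" for u r
    using that order_cs[OF ab y] by auto
  have up2': "r < u" if "u \<in> ?b ` Kc" "r \<in> Ks" for u r
    using that order_K(2)[OF ab] by auto
  have nz1: "mult_B a b u \<noteq> 0" if "u \<in> ?a ` spectrum Eu y \<union> (?b ` spectrum Ec y \<union> spectrum Es y)" for u
    using that unfolding nz[symmetric] by simp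
  have nz2: "mult_B a b u \<noteq> 0" if "u \<in> ?a ` Ku \<union> (?b ` Kc \<union> Ks)" for u
    using that unfolding mult_B_nonzero[symmetric] by simp
  have eu: "?a ` spectrum Eu y = ?a ` Ku"
  proof (rule upper_sets_eq[OF all _ _ up1 up1'])
    show "sum (mult_B a b) (?a ` spectrum Eu y) = sum (mult_B a b) (?a ` Ku)" unfolding su su' by (rule uc(8))
    show "sum (mult_B a b) (?a ` spectrum Eu y) \<noteq> \<infinity>" unfolding su by (rule fd)
    show "mult_B a b u \<noteq> 0" if "u \<in> ?a ` spectrum Eu y" for u by (rule nz1[OF UnI1[OF that]])
    show "mult_B a b u \<noteq> 0" if "u \<in> ?a ` Ku" for u by (rule nz2[OF UnI1[OF that]])
  qed (rule finite_imageI[OF fin(1)], rule finite_imageI[OF finite_K(1)])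
  \<comment> \<open>With the common unstable part removed, the same argument separates the center
    from the stable exponents.\<close>
  have rest: "?b ` spectrum Ec y \<union> spectrum Es y = ?b ` Kc \<union> Ks"
  proof -
    have "?a ` Ku \<inter> (?b ` spectrum Ec y \<union> spectrum Es y) = {}" by (rule disjoint[OF up1[unfolded eu]])
    moreover have "?a ` Ku \<inter> (?b ` Kc \<union> Ks) = {}" by (rule disjoint[OF up1'])
    ultimately show ?thesis by (rule cancel[OF all[unfolded eu]])
  qed
  have ec: "?b ` spectrum Ec y = ?b ` Kc"
  proof (rule upper_sets_eq[OF rest _ _ up2 up2'])
    show "sum (mult_B a b) (?b ` spectrum Ec y) = sum (mult_B a b) (?b ` Kc)" unfolding sc sc' by (rule cs(8))
    show "sum (mult_B a b) (?b ` spectrum Ec y) \<noteq> \<infinity>" unfolding sc by (rule fd)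
    show "mult_B a b u \<noteq> 0" if "u \<in> ?b ` spectrum Ec y" for u by (rule nz1[OF UnI2[OF UnI1[OF that]]])
    show "mult_B a b u \<noteq> 0" if "u \<in> ?b ` Kc" for u by (rule nz2[OF UnI2[OF UnI1[OF that]]])
  qed (rule finite_imageI[OF fin(2)], rule finite_imageI[OF finite_K(2)])
  have es: "spectrum Es y = Ks"
  proof -
    have "?b ` Kc \<inter> spectrum Es y = {}" by (rule disjoint[OF up2[unfolded ec]])
    moreover have "?b ` Kc \<inter> Ks = {}" by (rule disjoint[OF up2'])
    ultimately show ?thesis by (rule cancel[OF rest[unfolded ec]])
  qed
  have eu': "spectrum Eu y = Ku" and ec': "spectrum Ec y = Kc"
    using eu ec by (simp_all add: inj_image_eq_iff[OF inj])
  show ?thesis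
    unfolding good_def eu' ec' es
  proof (intro conjI ballI refl y)
    show "hdim J (eig Eu y \<kappa>) = m \<kappa>" if "\<kappa> \<in> Ku" for \<kappa>
      using mu[unfolded eu', OF that] mult_B_shift(1)[OF ab that] by simp
    show "hdim J (eig Ec y \<kappa>) = m \<kappa>" if "\<kappa> \<in> Kc" for \<kappa>
      using mc[unfolded ec', OF that] mult_B_shift(2)[OF ab that] by simp
    show "hdim J (eig Es y \<kappa>) = m \<kappa>" if "\<kappa> \<in> Ks" for \<kappa>
      using ms[unfolded es, OF that] mult_B_shift(3)[OF ab that] by simp
  qed
qed

lemma has_multiplicities_iff_good:
  "admissible a b \<Longrightarrow> has_multiplicities J f (B a b) (mult_B a b) y \<longleftrightarrow> good y"
  using has_multiplicities_if_good good_if_has_multiplicities by blast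

text \<open>Two candidates agree at every point where both hold. For a probability measure such
  points exist, which resolves the definite description.\<close>

lemma multiplicity_B:
  assumes ab: "admissible a b"
  shows "multiplicity J f M (B a b) = mult_B a b"
  unfolding multiplicity_def
proof (rule the_equality)
  have AE: "AE x in M. good x" using AE_points by eventually_elim (rule points_good)
  show h: "AE x in M. has_multiplicities J f (B a b) (mult_B a b) x"
    using AE by eventually_elim (rule has_multiplicities_if_good[OF ab])
  fix m' assume "AE x in M. has_multiplicities J f (B a b) m' x"
  with h have "AE x in M. m' = mult_B a b"
  proof eventually_elim
    case (elim x)
    show ?case
    proof
      fix \<kappa>
      have "mult_B a b \<kappa> = hdim J (oseledets f (B a b) x (ereal \<kappa>))" using elim(1) by (simp add: has_multiplicities_def)
      also have "\<dots> = m' \<kappa>" using elim(2) by (simp add: has_multiplicities_def)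
      finally show "m' \<kappa> = mult_B a b \<kappa>" by simp
    qed
  qed
  then show "m' = mult_B a b" by (simp only: prob_space.AE_const[OF prob_M])
qed

text \<open>An exact equality: both sides say that \<open>good\<close> holds along the whole
  orbit.\<close>

lemma points_B:
  assumes ab: "admissible a b"
  shows "oseledets_points J f M (B a b) = points"
proof -
  have "has_multiplicities J f A m z \<longleftrightarrow> good z" for z
    using has_multiplicities_iff_good[OF admissible_zero, of z] by (simp only: B_zero mult_B_zero)
  then show ?thesis
    unfolding oseledets_points_def multiplicity_B[OF ab] has_multiplicities_iff_good[OF ab] by simp
qed

lemma exponents_B:
  assumes ab: "admissible a b"
  shows "exponents J f M (B a b) = (\<lambda>\<kappa>. \<kappa> + a) ` Ku \<union> ((\<lambda>\<kappa>. \<kappa> + b) ` Kc \<union> Ks)"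
  unfolding exponents_def multiplicity_B[OF ab] by (rule mult_B_nonzero)

lemma oseledets_B_shift:
  assumes ab: "admissible a b" and x: "x \<in> points"
  shows "\<kappa> \<in> Ku \<Longrightarrow> oseledets f (B a b) x (ereal (\<kappa> + a)) = oseledets f A x (ereal \<kappa>)"
    and "\<kappa> \<in> Kc \<Longrightarrow> oseledets f (B a b) x (ereal (\<kappa> + b)) = oseledets f A x (ereal \<kappa>)"
    and "\<kappa> \<in> Ks \<Longrightarrow> oseledets f (B a b) x (ereal \<kappa>) = oseledets f A x (ereal \<kappa>)"
proof -
  note g = goodD[OF points_good[OF x]] and pe = points_eigenspace[OF x]
  show "oseledets f (B a b) x (ereal (\<kappa> + a)) = oseledets f A x (ereal \<kappa>)" if "\<kappa> \<in> Ku"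
    unfolding oseledets_B[OF ab g(1)] g(2,3) oseledets_ereal[of f A] using that Int_absorb1[OF pe(1)[OF that]] by simp
  show "oseledets f (B a b) x (ereal (\<kappa> + b)) = oseledets f A x (ereal \<kappa>)" if k: "\<kappa> \<in> Kc"
  proof -
    have "\<kappa> + b - a \<notin> Ku" using order_K(1)[OF ab _ k, of "\<kappa> + b - a"] by auto
    then show ?thesis
      unfolding oseledets_B[OF ab g(1)] g(2,3) oseledets_ereal[of f A] using k Int_absorb1[OF pe(2)[OF k]] by simp
  qed
  show "oseledets f (B a b) x (ereal \<kappa>) = oseledets f A x (ereal \<kappa>)" if k: "\<kappa> \<in> Ks"
  proof -
    have "\<kappa> - a \<notin> Ku" using order_K(3)[OF ab _ k, of "\<kappa> - a"] by auto
    moreover have "\<kappa> - b \<notin> Kc" using order_K(2)[OF ab _ k, of "\<kappa> - b"] by auto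
    ultimately show ?thesis
      unfolding oseledets_B[OF ab g(1)] g(2,3) oseledets_ereal[of f A] using Int_absorb1[OF pe(3)[OF k]] by simp
  qed
qed

subsection \<open>The perturbed cocycle\<close>

lemma iterate_B:
  shows "v \<in> Eu x \<Longrightarrow> iterate f (B a b) n x v = exp (real n * a) *\<^sub>R iterate f A n x v"
    and "v \<in> Ec x \<Longrightarrow> iterate f (B a b) n x v = exp (real n * b) *\<^sub>R iterate f A n x v"
    and "v \<in> Es x \<Longrightarrow> iterate f (B a b) n x v = iterate f A n x v"
proof -
  have it: "iterate f (B a b) n x v = exp (real n * c) *\<^sub>R iterate f A n x v" if "D a b x v = exp c *\<^sub>R v" for c
  proof -
    have "(blinfun_apply (D a b x) ^^ n) v = exp (real n * c) *\<^sub>R v"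
      by (induction n) (simp_all add: that blinfun.scaleR_right exp_add distrib_right)
    moreover have "B a b = (\<lambda>x. A x o\<^sub>L D a b x)" by (rule ext) (rule B_def)
    ultimately show ?thesis
      by (simp add: iterate_perturbed[OF reducing_D] blinfun.scaleR_right)
  qed
  show "v \<in> Eu x \<Longrightarrow> iterate f (B a b) n x v = exp (real n * a) *\<^sub>R iterate f A n x v"
    by (rule it) (simp add: D_apply P_orth Pu(3))
  show "v \<in> Ec x \<Longrightarrow> iterate f (B a b) n x v = exp (real n * b) *\<^sub>R iterate f A n x v"
    by (rule it) (simp add: D_apply P_orth Pc(3))
  show "v \<in> Es x \<Longrightarrow> iterate f (B a b) n x v = iterate f A n x v"
    using it[of 0] by (simp add: D_apply P_orth Ps(3))
qed

lemma B_apply: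
  shows "v \<in> Eu x \<Longrightarrow> B a b x v = exp a *\<^sub>R A x v"
    and "v \<in> Ec x \<Longrightarrow> B a b x v = exp b *\<^sub>R A x v"
    and "v \<in> Es x \<Longrightarrow> B a b x v = A x v"
  using iterate_B[of v x a b 1] by simp_all

lemma B_invariant:
  shows "v \<in> Eu x \<Longrightarrow> B a b x v \<in> Eu (f x)"
    and "v \<in> Ec x \<Longrightarrow> B a b x v \<in> Ec (f x)"
    and "v \<in> Es x \<Longrightarrow> B a b x v \<in> Es (f x)"
  using uc(1,2,5,6) cs(2,6) by (simp_all add: B_apply subspace_scale)

lemma unit_in_center: obtains w where "w \<in> Ec x" "norm w = 1"
proof -
  obtain w where w: "w \<in> Ec x" "w \<noteq> 0" using nonzero(2)[of x] subspace_0[OF uc(2)] by blast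
  show ?thesis
    by (rule that[of "(1 / norm w) *\<^sub>R w"]) (use w in \<open>simp_all add: subspace_scale[OF uc(2)]\<close>)
qed

text \<open>Over \<open>l\<close> steps the ratio of center to unstable growth changes by the factor
  \<open>exp (l * (b - a))\<close>, which admissibility permits, while raising the center only helps
  it dominate the stable bundle. The maximum gives one constant for all pairs, as
  \<open>extended_oseledets_ruelle\<close> demands.\<close>

lemma dominated_B:
  assumes ab: "admissible a b"
  defines "\<gamma> \<equiv> max (\<alpha> * exp (real l * (b - a))) \<beta>"
  shows "dominated J f (B a b) UNIV l \<gamma> Eu Ec" "dominated J f (B a b) UNIV l \<gamma> Ec Es"
    "dominated J f (B a b) UNIV l \<gamma> Eu Es" and "0 < \<gamma>" "\<gamma> < 1"
proof -
  have ab': "a \<le> 0" "0 \<le> b" "real l * (b - a) < - ln \<alpha>" using ab by (auto simp: admissible_def)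
  have "\<alpha> * exp (real l * (b - a)) < \<alpha> * exp (- ln \<alpha>)" using \<alpha> ab'(3) by simp
  also have "\<dots> = 1" using \<alpha> by (simp add: exp_minus)
  finally show \<gamma>1: "\<gamma> < 1" using \<beta> by (simp add: \<gamma>_def)
  show \<gamma>0: "0 < \<gamma>" using \<beta> by (simp add: \<gamma>_def)
  have cs_bound: "norm (iterate f (B a b) l x u) \<le> \<gamma> * norm (iterate f (B a b) l x v)"
    if "u \<in> Es x" "v \<in> Ec x" "norm u = 1" "norm v = 1" for x u v
  proof -
    have "norm (iterate f A l x u) \<le> \<beta> * norm (iterate f A l x v)" by (rule cs(11)[OF that])
    also have "\<dots> \<le> \<gamma> * norm (iterate f A l x v)" by (intro mult_right_mono) (auto simp: \<gamma>_def)
    also have "\<dots> \<le> \<gamma> * (exp (real l * b) * norm (iterate f A l x v))"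
      using \<gamma>0 ab'(2) by (intro mult_left_mono) (auto simp: mult_le_cancel_right1)
    finally show ?thesis using that by (simp add: iterate_B)
  qed
  have uc_bound: "norm (iterate f (B a b) l x u) \<le> \<gamma> * norm (iterate f (B a b) l x v)"
    if "u \<in> Ec x" "v \<in> Eu x" "norm u = 1" "norm v = 1" for x u v
  proof -
    have "exp (real l * b) * norm (iterate f A l x u) \<le> exp (real l * b) * (\<alpha> * norm (iterate f A l x v))"
      by (intro mult_left_mono uc(11)[OF that]) simp
    also have "\<dots> = (\<alpha> * exp (real l * (b - a))) * (exp (real l * a) * norm (iterate f A l x v))"
      by (simp add: right_diff_distrib exp_diff)
    also have "\<dots> \<le> \<gamma> * (exp (real l * a) * norm (iterate f A l x v))"
      by (intro mult_right_mono) (auto simp: \<gamma>_def)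
    finally show ?thesis using that by (simp add: iterate_B)
  qed
  obtain \<theta> where \<theta>: "\<theta> > 0" "\<And>x v. v \<in> Eu x \<Longrightarrow> norm v = 1 \<Longrightarrow> \<theta> \<le> norm (A x v)" using uc(10) by blast
  obtain \<theta>' where \<theta>': "\<theta>' > 0" "\<And>x v. v \<in> Ec x \<Longrightarrow> norm v = 1 \<Longrightarrow> \<theta>' \<le> norm (A x v)" using cs(10) by blast
  have \<theta>B: "exp a * \<theta> \<le> norm (B a b x v)" if "v \<in> Eu x" "norm v = 1" for x v
    using \<theta>(2)[OF that] that by (simp add: B_apply)
  have \<theta>B': "exp b * \<theta>' \<le> norm (B a b x v)" if "v \<in> Ec x" "norm v = 1" for x v
    using \<theta>'(2)[OF that] that by (simp add: B_apply)
  have pos: "exp a * \<theta> > 0" "exp b * \<theta>' > 0" using \<theta> \<theta>' by simp_all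
  show "dominated J f (B a b) UNIV l \<gamma> Eu Ec"
    by (rule dominatedI[OF closed_subspaces(1,2) bundle_inter(1) B_invariant(1,2) uc(8,9) pos(1) \<theta>B uc_bound])
  show "dominated J f (B a b) UNIV l \<gamma> Ec Es"
    by (rule dominatedI[OF closed_subspaces(2,3) bundle_inter(3) B_invariant(2,3) cs(8,9) pos(2) \<theta>B' cs_bound])
  have us_bound: "norm (iterate f (B a b) l x u) \<le> \<gamma> * norm (iterate f (B a b) l x v)"
    if uv: "u \<in> Es x" "v \<in> Eu x" "norm u = 1" "norm v = 1" for x u v
  proof -
    \<comment> \<open>A unit vector of the center chains the two dominations.\<close>
    obtain w where w: "w \<in> Ec x" "norm w = 1" by (rule unit_in_center)
    have "norm (iterate f (B a b) l x u) \<le> \<gamma> * norm (iterate f (B a b) l x w)"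
      by (rule cs_bound[OF uv(1) w(1) uv(3) w(2)])
    also have "\<dots> \<le> 1 * norm (iterate f (B a b) l x w)" using \<gamma>1 by (intro mult_right_mono) auto
    also have "\<dots> \<le> \<gamma> * norm (iterate f (B a b) l x v)" using uc_bound[OF w(1) uv(2) w(2) uv(4)] by simp
    finally show ?thesis .
  qed
  show "dominated J f (B a b) UNIV l \<gamma> Eu Es"
    by (rule dominatedI[OF closed_subspaces(1,3) bundle_inter(2) B_invariant(1,3) uc(8) cs(9) pos(1) \<theta>B us_bound])
qed

text \<open>The perturbed cocycle is equipped with exactly three groups, even if the decomposition
  of the original one is finer.\<close>

definition splitting :: "nat \<Rightarrow> 'x \<Rightarrow> 'h set" where
  "splitting i = (if i = 0 then Eu else if i = 1 then Ec else Es)"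

definition projection :: "nat \<Rightarrow> 'x \<Rightarrow> 'h \<Rightarrow>\<^sub>L 'h" where
  "projection i = (if i = 0 then Pu else if i = 1 then Pc else Ps)"

definition group :: "real \<Rightarrow> real \<Rightarrow> nat \<Rightarrow> ereal set" where
  "group a b i = (if i = 0 then ereal ` (\<lambda>\<kappa>. \<kappa> + a) ` Ku else if i = 1 then ereal ` (\<lambda>\<kappa>. \<kappa> + b) ` Kc
    else insert (-\<infinity>) (ereal ` Ks))"

lemma less_3_cases: "i < 3 \<Longrightarrow> i = 0 \<or> i = 1 \<or> i = (2::nat)" by auto

lemma lessThan_3: "{..<3} = {0, 1, 2::nat}" by auto

lemma group_order:
  assumes ab: "admissible a b" and ij: "i < j" "j < 3" and p: "p \<in> group a b i" and q: "q \<in> group a b j"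
  shows "q < p"
proof -
  note o = order_K[OF ab]
  consider "i = 0" "j = 1" | "i = 0" "j = 2" | "i = 1" "j = 2" using ij by linarith
  then show ?thesis
  proof cases
    case 1
    then obtain \<kappa> \<mu> where "p = ereal (\<kappa> + a)" "\<kappa> \<in> Ku" "q = ereal (\<mu> + b)" "\<mu> \<in> Kc"
      using p q by (auto simp: group_def)
    then show ?thesis using o(1) by simp
  next
    case 2
    then obtain \<kappa> where \<kappa>: "p = ereal (\<kappa> + a)" "\<kappa> \<in> Ku" using p by (auto simp: group_def)
    have "q = -\<infinity> \<or> (\<exists>\<mu>\<in>Ks. q = ereal \<mu>)" using q 2 by (auto simp: group_def)
    then show ?thesis using \<kappa> o(3) by auto
  next
    case 3
    then obtain \<kappa> where \<kappa>: "p = ereal (\<kappa> + b)" "\<kappa> \<in> Kc" using p by (auto simp: group_def)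
    have "q = -\<infinity> \<or> (\<exists>\<mu>\<in>Ks. q = ereal \<mu>)" using q 3 by (auto simp: group_def)
    then show ?thesis using \<kappa> o(2) by auto
  qed
qed

lemma bundle_sum_splitting: "bundle_sum splitting {i} = splitting i"
proof
  fix x
  have "subspace (splitting i x)" using uc(1,2) cs(2) by (simp add: splitting_def)
  then show "bundle_sum splitting {i} x = splitting i x" by (simp add: bundle_sum_def span_eq_iff)
qed

lemma direct_decomposition_splitting: "direct_decomposition 3 (\<lambda>i. splitting i x)"
  unfolding direct_decomposition_def
proof (rule allI, rule ex1I)
  fix v
  let ?w = "\<lambda>i. if i < 3 then projection i x v else 0"
  show "(\<forall>i<3. ?w i \<in> splitting i x) \<and> (\<forall>i\<ge>3. ?w i = 0) \<and> v = (\<Sum>i<3. ?w i)"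
  proof (intro conjI)
    show "\<forall>i<3. ?w i \<in> splitting i x" by (simp add: projection_def splitting_def Pu(2) Pc(2) Ps(2))
    show "v = (\<Sum>i<3. ?w i)" using P_sum[of x v] by (simp add: lessThan_3 projection_def add.assoc)
  qed simp
  fix w assume w: "(\<forall>i<3. w i \<in> splitting i x) \<and> (\<forall>i\<ge>3. w i = 0) \<and> v = (\<Sum>i<3. w i)"
  have m: "w 0 \<in> Eu x" "w 1 \<in> Ec x" "w 2 \<in> Es x"
    using conjunct1[OF w, rule_format, of 0] conjunct1[OF w, rule_format, of 1] conjunct1[OF w, rule_format, of 2]
    by (simp_all add: splitting_def)
  have v: "v = w 0 + w 1 + w 2" using w by (simp add: lessThan_3 add.assoc)
  have "projection 0 x v = w 0" "projection 1 x v = w 1" "projection 2 x v = w 2"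
    unfolding v using m by (simp_all add: projection_def blinfun.add_right P_orth Pu(3) Pc(3) Ps(3))
  then have "w i = projection i x v" if "i < 3" for i using less_3_cases[OF that] by auto
  then show "w = ?w" using w by (intro ext) auto
qed

lemma continuous_splitting_splitting: "continuous_splitting 3 splitting"
  unfolding continuous_splitting_def
proof (intro exI[of _ projection] allI impI conjI)
  fix i :: nat assume i: "i < 3"
  show "continuous_on UNIV (\<lambda>x. blinfun_apply (projection i x))"
    by (rule continuous_on_coordinatewise_then_product) (simp add: projection_def P_cont)
  fix x v
  show "projection i x v \<in> splitting i x" by (simp add: projection_def splitting_def Pu(2) Pc(2) Ps(2))
  have in_sum: "projection j x v \<in> bundle_sum splitting ({..<3} - {i}) x" if "j < 3" "j \<noteq> i" for j
    unfolding bundle_sum_def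
  proof (rule span_base, rule UN_I)
    show "j \<in> {..<3} - {i}" using that by simp
    show "projection j x v \<in> splitting j x" by (simp add: projection_def splitting_def Pu(2) Pc(2) Ps(2))
  qed
  have "v = (\<Sum>j<3. projection j x v)" using P_sum[of x v] by (simp add: lessThan_3 projection_def add.assoc)
  also have "\<dots> = projection i x v + (\<Sum>j\<in>{..<3} - {i}. projection j x v)"
    by (rule sum.remove) (use i in auto)
  finally have "v - projection i x v = (\<Sum>j\<in>{..<3} - {i}. projection j x v)" by (simp add: diff_eq_eq add.commute)
  also have "\<dots> \<in> bundle_sum splitting ({..<3} - {i}) x"
    by (rule subspace_sum) (simp add: bundle_sum_def, rule in_sum, simp_all)
  finally show "v - projection i x v \<in> bundle_sum splitting ({..<3} - {i}) x" .
qed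

lemma splitting_closure:
  assumes ab: "admissible a b" and x: "x \<in> points" and i: "i < 3"
  shows "splitting i x = closure (span (\<Union>\<kappa>\<in>group a b i. oseledets f (B a b) x \<kappa>))"
  using less_3_cases[OF i]
proof (elim disjE)
  note s = oseledets_B_shift[OF ab x]
  assume "i = 0"
  then show ?thesis using bundles(1)[OF x] s(1) by (simp add: splitting_def group_def image_image)
next
  note s = oseledets_B_shift[OF ab x]
  assume "i = 1"
  then show ?thesis using bundles(2)[OF x] s(2) by (simp add: splitting_def group_def image_image)
next
  note s = oseledets_B_shift[OF ab x]
  have r: "ruelle_point f A x" by (rule oseledets_pointsD(2)[OF x])
  assume "i = 2"
  then show ?thesis using bundles(3)[OF x] s(3)
    by (simp add: splitting_def group_def image_image oseledets_B_kernel[OF r])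
qed

lemma extended_B:
  assumes ab: "admissible a b"
  shows "extended_oseledets_ruelle J f M (B a b) 3 (group a b) splitting"
  unfolding extended_oseledets_ruelle_def points_B[OF ab]
proof (intro conjI)
  show "AE x in M. x \<in> points" by (rule AE_points)
  show "(\<Union>i<3. group a b i) = insert (-\<infinity>) (ereal ` exponents J f M (B a b))"
    unfolding exponents_B[OF ab] lessThan_3 by (auto simp: group_def)
  show "disjoint_family_on (group a b) {..<3}"
    unfolding disjoint_family_on_def
  proof (intro ballI impI equals0I)
    fix i j p assume ij: "i \<in> {..<3}" "j \<in> {..<3}" "i \<noteq> j" and p: "p \<in> group a b i \<inter> group a b j"
    then consider "i < j" | "j < i" by linarith
    then show False
    proof cases
      case 1 then show False using group_order[OF ab 1, of p p] ij p by auto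
    next
      case 2 then show False using group_order[OF ab 2, of p p] ij p by auto
    qed
  qed
  show "\<forall>x\<in>points. \<forall>i<3. splitting i x = closure (span (\<Union>\<kappa>\<in>group a b i. oseledets f (B a b) x \<kappa>))"
    by (intro ballI allI impI splitting_closure[OF ab])
  show "\<forall>x. \<forall>i<3. closed_subspace J (splitting i x)" by (simp add: splitting_def closed_subspaces)
  show "\<forall>x. direct_decomposition 3 (\<lambda>i. splitting i x)" by (simp add: direct_decomposition_splitting)
  show "\<forall>i<3. \<exists>d. \<forall>x. hdim J (splitting i x) = d"
  proof (intro allI impI exI)
    show "hdim J (splitting i x) = hdim J (splitting i undefined)" for i x
      unfolding splitting_def using uc(8)[of x undefined] uc(9)[of x undefined] cs(9)[of x undefined] by simp
  qed
  show "continuous_splitting 3 splitting" by (rule continuous_splitting_splitting)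
  show "\<exists>l \<alpha>. 0 < \<alpha> \<and> \<alpha> < 1 \<and> (\<forall>i j. i < j \<longrightarrow> j < 3 \<longrightarrow> dominated J f (B a b) UNIV l \<alpha> (splitting i) (splitting j))"
  proof (intro exI conjI allI impI)
    fix i j :: nat assume "i < j" "j < 3"
    then consider "i = 0" "j = 1" | "i = 0" "j = 2" | "i = 1" "j = 2" by linarith
    then show "dominated J f (B a b) UNIV l (max (\<alpha> * exp (real l * (b - a))) \<beta>) (splitting i) (splitting j)"
      by cases (simp_all add: splitting_def dominated_B[OF ab])
  qed (rule dominated_B[OF ab])+
qed

lemma partially_hyperbolic_B:
  assumes ab: "admissible a b"
  shows "partially_hyperbolic J f M (B a b) Eu Ec Es"
  unfolding partially_hyperbolic_def
proof (intro exI conjI)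
  show "extended_oseledets_ruelle J f M (B a b) 3 (group a b) splitting" by (rule extended_B[OF ab])
  show "{0} \<union> {1} \<union> {2} = {..<3::nat}" by auto
  show "Eu = bundle_sum splitting {0}" "Ec = bundle_sum splitting {1}" "Es = bundle_sum splitting {2}"
    unfolding bundle_sum_splitting by (simp_all add: splitting_def)
  have pos: "0 < \<kappa> + a" if "\<kappa> \<in> Ku" for \<kappa> using ab that by (simp add: admissible_def)
  show "\<forall>\<kappa>\<in>\<Union> (group a b ` {0}). 0 < \<kappa>" using pos by (auto simp: group_def)
  \<comment> \<open>An exponent 0 can only be a shifted center exponent: the unstable ones stay
    positive and the stable ones are unchanged.\<close>
  show "0 \<in> exponents J f M (B a b) \<longrightarrow> 0 \<in> \<Union> (group a b ` {1})"
  proof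
    assume "0 \<in> exponents J f M (B a b)"
    moreover have "0 \<notin> (\<lambda>\<kappa>. \<kappa> + a) ` Ku" using pos by force
    moreover have "0 \<notin> Ks" using signs(2)[of 0] by auto
    ultimately have "0 \<in> (\<lambda>\<kappa>. \<kappa> + b) ` Kc" unfolding exponents_B[OF ab] by blast
    then show "0 \<in> \<Union> (group a b ` {1})" by (simp add: group_def zero_ereal_def)
  qed
  show "\<forall>\<kappa>\<in>\<Union> (group a b ` {2}). \<kappa> < 0" using signs(2) by (auto simp: group_def)
  show "-\<infinity> \<in> \<Union> (group a b ` {2})" by (simp add: group_def)
qed (use dominated_B[OF ab] in simp_all)

subsection \<open>Continuity and distance\<close>

lemma norm_projection_le:
  assumes "bundle_projection f A V Q"
  shows "norm (Q x) \<le> 1"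
proof (rule norm_blinfun_bound)
  fix v
  have "norm (Q x v) * norm (Q x v) = Q x v \<bullet> Q x v" by (simp add: dot_square_norm power2_eq_square)
  also have "\<dots> = Q x v \<bullet> v"
    using bundle_projectionD(4)[OF assms, of x "Q x v" v] bundle_projectionD(6)[OF assms, of x v] by simp
  also have "\<dots> \<le> norm (Q x v) * norm v" by (rule norm_cauchy_schwarz)
  finally show "norm (Q x v) \<le> 1 * norm v" by (cases "Q x v = 0") auto
qed simp

lemma norm_D_le: "norm (D a b x) \<le> exp a + exp b + 1"
proof -
  have "norm (D a b x) \<le> norm (exp a *\<^sub>R Pu x) + norm (exp b *\<^sub>R Pc x) + norm (Ps x)"
    unfolding D_def by (intro norm_triangle_le add_mono order_refl norm_triangle_ineq)
  also have "\<dots> \<le> exp a * 1 + exp b * 1 + 1"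
    unfolding norm_scaleR abs_exp_cancel
    by (intro add_mono mult_left_mono norm_projection_le[OF projections(1)] norm_projection_le[OF projections(2)]
        norm_projection_le[OF projections(3)]) simp_all
  finally show ?thesis by simp
qed

lemma norm_A_bounded: "\<exists>C\<ge>1. \<forall>x. norm (A x) \<le> C"
proof -
  have "compact (range (\<lambda>x. norm (A x)))"
    by (intro compact_continuous_image continuous_on_norm A_facts compact_X)
  then have "bdd_above (range (\<lambda>x. norm (A x)))" by (intro bounded_imp_bdd_above compact_imp_bounded)
  then obtain C where "\<And>x. norm (A x) \<le> C" by (auto simp: bdd_above_def)
  then show ?thesis by (intro exI[of _ "max 1 C"]) (simp add: le_max_iff_disj)
qed

text \<open>\<open>D\<close> is only strongly continuous. Once it stands to the left of the compact
  operator \<open>A x\<close>, strong convergence becomes norm convergence; replacing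
  \<open>A x\<close> by \<open>A y\<close> costs at most a uniform bound on \<open>D\<close> times
  the norm of the difference.\<close>

lemma continuous_B: "continuous_on UNIV (B a b)"
proof -
  have eq: "B a b y = D a b (f y) o\<^sub>L A y" for y
    by (rule blinfun_eqI) (use reducing_D[of a b] in \<open>simp add: B_def reducing_def\<close>)
  have Dc: "continuous_on UNIV (\<lambda>y. D a b y v)" for v
    unfolding D_apply by (intro continuous_on_add continuous_on_scaleR continuous_on_const P_cont)
  have "(B a b \<longlongrightarrow> B a b x) (at x)" for x
  proof -
    have "((\<lambda>y. D a b (f y) v) \<longlongrightarrow> D a b (f x) v) (at x)" for v
      using continuous_on_compose2[OF Dc f_cont, of v] by (simp add: continuous_on_def)
    then have "((\<lambda>y. D a b (f y) o\<^sub>L A x) \<longlongrightarrow> (D a b (f x) o\<^sub>L A x)) (at x)"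
      by (rule strong_compose_compact_tendsto[OF A_facts(2) _ norm_D_le norm_D_le])
    moreover have "((\<lambda>y. D a b (f y) o\<^sub>L (A y - A x)) \<longlongrightarrow> 0) (at x)"
    proof (rule Lim_null_comparison)
      show "\<forall>\<^sub>F y in at x. norm (D a b (f y) o\<^sub>L (A y - A x)) \<le> (exp a + exp b + 1) * norm (A y - A x)"
        by (intro always_eventually allI order_trans[OF norm_blinfun_compose] mult_right_mono norm_D_le) simp
      have "((\<lambda>y. A y - A x) \<longlongrightarrow> 0) (at x)"
        using A_facts(1) by (simp add: continuous_on_def LIM_zero)
      then show "((\<lambda>y. (exp a + exp b + 1) * norm (A y - A x)) \<longlongrightarrow> 0) (at x)"
        by (intro tendsto_mult_right_zero tendsto_norm_zero)
    qed
    ultimately have "((\<lambda>y. (D a b (f y) o\<^sub>L A x) + (D a b (f y) o\<^sub>L (A y - A x))) \<longlongrightarrow> (D a b (f x) o\<^sub>L A x) + 0) (at x)"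
      by (rule tendsto_add)
    moreover have "(D a b (f y) o\<^sub>L A x) + (D a b (f y) o\<^sub>L (A y - A x)) = B a b y" for y
      unfolding eq by (simp add: blinfun_compose.diff_right)
    ultimately show ?thesis by (simp only: eq[of x, symmetric] add_0_right)
  qed
  then show ?thesis by (simp add: continuous_on_def)
qed

lemma C0I_B: "B a b \<in> C0I J M"
  unfolding C0I_def
proof (rule CollectI, intro conjI allI)
  show "continuous_on UNIV (B a b)" by (rule continuous_B)
  show "compact_operator (B a b x)" for x
    unfolding B_def by (rule compact_operator_compose_right[OF A_facts(2)])
  \<comment> \<open>\<open>J\<close> preserves each of the three bundles, so it acts separately on
    the components of a vector.\<close>
  have com: "Q x (J v) = J (Q x v)"
    if Q: "Q \<in> {Pu, Pc, Ps}" for Q x v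
  proof -
    have cl: "J w \<in> Eu x" if "w \<in> Eu x" for w using closed_subspaces(1)[of x] that by (simp add: closed_subspace_def)
    have cl2: "J w \<in> Ec x" if "w \<in> Ec x" for w using closed_subspaces(2)[of x] that by (simp add: closed_subspace_def)
    have cl3: "J w \<in> Es x" if "w \<in> Es x" for w using closed_subspaces(3)[of x] that by (simp add: closed_subspace_def)
    have Jv: "J v = J (Pu x v) + J (Pc x v) + J (Ps x v)"
      unfolding blinfun.add_right[symmetric] P_sum ..
    note c = cl[OF Pu(2)] cl2[OF Pc(2)] cl3[OF Ps(2)]
    have "Pu x (J v) = J (Pu x v)" "Pc x (J v) = J (Pc x v)" "Ps x (J v) = J (Ps x v)"
      by (subst Jv, simp add: blinfun.add_right P_orth c Pu(3) Pc(3) Ps(3))+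
    then show ?thesis using Q by auto
  qed
  show "B a b x o\<^sub>L J = J o\<^sub>L B a b x" for x
  proof (rule blinfun_eqI)
    fix v
    have "A x (J w) = J (A x w)" for w using A_facts(3)[of x] by (metis blinfun_apply_blinfun_compose)
    moreover have "D a b x (J v) = J (D a b x v)" by (simp add: D_apply com blinfun.add_right blinfun.scaleR_right)
    ultimately show "(B a b x o\<^sub>L J) v = (J o\<^sub>L B a b x) v" by (simp add: B_def)
  qed
  obtain C where C: "C \<ge> 1" "\<And>x. norm (A x) \<le> C" using norm_A_bounded by blast
  define C' where "C' = C * (exp a + exp b + 1)"
  have "exp a + exp b + 1 \<ge> 1" by (simp add: add_nonneg_nonneg)
  \<comment> \<open>Being at least 1 makes \<open>ln C'\<close> nonnegative, so it also bounds the
    maximum with 0.\<close>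
  then have C'1: "C' \<ge> 1" unfolding C'_def using C(1) mult_mono[of 1 C 1 "exp a + exp b + 1"] by simp
  have bound: "norm (B a b x) \<le> C'" for x
    unfolding B_def C'_def
    by (rule order_trans[OF norm_blinfun_compose]) (intro mult_mono C norm_D_le, use C(1) in simp_all)
  interpret prob_space M by (rule prob_M)
  show "integrable M (\<lambda>x. max 0 (ln (norm (B a b x))))"
  proof (rule integrable_const_bound[where B = "ln C'"])
    have "(\<lambda>x. norm (B a b x)) \<in> borel_measurable borel"
      by (intro borel_measurable_continuous_onI continuous_on_norm continuous_B)
    then have "(\<lambda>x. norm (B a b x)) \<in> borel_measurable M"
      using measurable_cong_sets[OF sets_M refl] by blast
    then show "(\<lambda>x. max 0 (ln (norm (B a b x)))) \<in> borel_measurable M"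
      by (intro borel_measurable_max borel_measurable_const borel_measurable_ln)
    have "max 0 (ln (norm (B a b x))) \<le> ln C'" for x
    proof (cases "norm (B a b x) = 0")
      case True then show ?thesis using C'1 by simp
    next
      case False
      then have "0 < norm (B a b x)" by simp
      then have "ln (norm (B a b x)) \<le> ln C'" using bound[of x] C'1 by (subst ln_le_cancel_iff) auto
      then show ?thesis using C'1 by simp
    qed
    then show "AE x in M. norm (max 0 (ln (norm (B a b x)))) \<le> ln C'" by simp
  qed
qed

lemma C0_norm_B:
  assumes ab: "a \<le> 0" "0 \<le> b" and C: "\<And>x. norm (A x) \<le> C"
  shows "C0_norm (\<lambda>x. A x - B a b x) \<le> C * (exp b - exp a)"
  unfolding C0_norm_def
proof (rule cSUP_least)
  fix x
  have C0: "0 \<le> C" using C[of x] norm_ge_zero[of "A x"] by linarith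
  \<comment> \<open>The identity minus \<open>D a b x\<close>; the stable components cancel.\<close>
  define R where "R = (1 - exp a) *\<^sub>R Pu x + (1 - exp b) *\<^sub>R Pc x"
  have "A x - B a b x = A x o\<^sub>L R"
  proof (rule blinfun_eqI)
    fix v
    have "v - D a b x v = R v"
    proof -
      have "R v = (1 - exp a) *\<^sub>R Pu x v + (1 - exp b) *\<^sub>R Pc x v"
        by (simp add: R_def blinfun.add_left blinfun.scaleR_left)
      moreover have "v = Pu x v + Pc x v + Ps x v" by (rule P_sum[symmetric])
      moreover have "p + q + s - (exp a *\<^sub>R p + exp b *\<^sub>R q + s) = (1 - exp a) *\<^sub>R p + (1 - exp b) *\<^sub>R q"
        for p q s :: 'h
        by (simp add: algebra_simps)
      ultimately show ?thesis unfolding D_apply by metis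
    qed
    then have "A x (v - D a b x v) = A x (R v)" by simp
    then show "(A x - B a b x) v = (A x o\<^sub>L R) v" by (simp add: B_def blinfun.diff_left blinfun.diff_right)
  qed
  also have "norm (A x o\<^sub>L R) \<le> norm (A x) * norm R" by (rule norm_blinfun_compose)
  also have "\<dots> \<le> C * (exp b - exp a)"
  proof (intro mult_mono C C0)
    have "norm R \<le> norm ((1 - exp a) *\<^sub>R Pu x) + norm ((1 - exp b) *\<^sub>R Pc x)"
      unfolding R_def by (rule norm_triangle_ineq)
    also have "\<dots> \<le> (1 - exp a) * 1 + (exp b - 1) * 1"
      unfolding norm_scaleR using ab
      by (intro add_mono mult_mono norm_projection_le[OF projections(1)] norm_projection_le[OF projections(2)]) auto
    finally show "norm R \<le> exp b - exp a" by simp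
  qed simp
  finally show "norm (A x - B a b x) \<le> C * (exp b - exp a)" .
qed simp

subsection \<open>Sums of exponents\<close>

definition weight :: "real \<Rightarrow> real" where
  "weight \<kappa> = real (the_enat (m \<kappa>))"

text \<open>\<open>the_enat\<close> says nothing at infinity; the multiplicities are finite because
  both bundles are finite dimensional.\<close>

lemma weight_pos: "\<kappa> \<in> Ku \<union> Kc \<Longrightarrow> 0 < weight \<kappa>"
proof -
  assume k: "\<kappa> \<in> Ku \<union> Kc"
  obtain x where x: "good x" by (rule good_exists)
  have fin: "finite_dim (eig Eu x \<kappa>)"
    by (rule finite_dim_subset[OF dominated_finite_dim[OF dom_uc A_facts(2), of x]]) blast
  have fin': "finite_dim (eig Ec x \<kappa>)"
    by (rule finite_dim_subset[OF dominated_finite_dim[OF dom_cs A_facts(2), of x]]) blast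
  have fin: "hdim J (eig Eu x \<kappa>) \<noteq> \<infinity>" "hdim J (eig Ec x \<kappa>) \<noteq> \<infinity>"
    by (simp_all add: hdim_def fin fin')
  have "m \<kappa> \<noteq> \<infinity>"
  proof (cases "\<kappa> \<in> Ku")
    case True then show ?thesis using fin(1) unfolding goodD(5)[OF x True] by simp
  next
    case False
    then have "\<kappa> \<in> Kc" using k by blast
    then have "hdim J (eig Ec x \<kappa>) = m \<kappa>" by (rule goodD(6)[OF x])
    then show ?thesis using fin(2) by simp
  qed
  moreover have "m \<kappa> \<noteq> 0" using k mult_nonzero by blast
  ultimately show ?thesis by (cases "m \<kappa>") (auto simp: weight_def zero_enat_def)
qed

text \<open>\<open>exponent_sum\<close> selects exponents by inclusion of their Oseledets subspaces
  in \<open>V\<close>. An exponent outside \<open>S\<close> is rejected since its subspace is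
  nonzero but meets \<open>V\<close> only in 0.\<close>

lemma exponent_sum_B_general:
  assumes ab: "admissible a b"
    and S: "S \<subseteq> exponents J f M (B a b)"
      "\<And>\<kappa> x. \<kappa> \<in> S \<Longrightarrow> x \<in> points \<Longrightarrow> oseledets f (B a b) x (ereal \<kappa>) \<subseteq> V x"
      "\<And>\<kappa> x. \<kappa> \<in> exponents J f M (B a b) \<Longrightarrow> \<kappa> \<notin> S \<Longrightarrow> x \<in> points \<Longrightarrow>
        oseledets f (B a b) x (ereal \<kappa>) \<inter> V x \<subseteq> {0}"
  shows "exponent_sum J f M (B a b) V = (\<Sum>\<kappa>\<in>S. real (the_enat (mult_B a b \<kappa>)) * \<kappa>)"
proof -
  have "{\<kappa>. \<kappa> \<in> exponents J f M (B a b) \<and> (\<forall>x\<in>points. oseledets f (B a b) x (ereal \<kappa>) \<subseteq> V x)} = S"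
  proof (intro set_eqI iffI CollectI)
    fix \<kappa> assume "\<kappa> \<in> {\<kappa>. \<kappa> \<in> exponents J f M (B a b) \<and> (\<forall>x\<in>points. oseledets f (B a b) x (ereal \<kappa>) \<subseteq> V x)}"
    then have k: "\<kappa> \<in> exponents J f M (B a b)" "\<And>x. x \<in> points \<Longrightarrow> oseledets f (B a b) x (ereal \<kappa>) \<subseteq> V x" by auto
    show "\<kappa> \<in> S"
    proof (rule ccontr)
      assume nS: "\<kappa> \<notin> S"
      obtain x where x: "x \<in> points" by (rule points_exist)
      have "oseledets f (B a b) x (ereal \<kappa>) \<subseteq> {0}" using S(3)[OF k(1) nS x] k(2)[OF x] by blast
      moreover have "0 \<in> oseledets f (B a b) x (ereal \<kappa>)" by (simp add: oseledets_def)
      ultimately have "oseledets f (B a b) x (ereal \<kappa>) = {0}" by blast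
      moreover have "hdim J (oseledets f (B a b) x (ereal \<kappa>)) = multiplicity J f M (B a b) \<kappa>"
        by (rule oseledets_pointsD(5)) (simp add: points_B[OF ab] x)
      ultimately have "multiplicity J f M (B a b) \<kappa> = 0" by simp
      then show False using k(1) by (simp add: exponents_def)
    qed
  next
    fix \<kappa> assume "\<kappa> \<in> S"
    then show "\<kappa> \<in> exponents J f M (B a b) \<and> (\<forall>x\<in>points. oseledets f (B a b) x (ereal \<kappa>) \<subseteq> V x)"
      using S(1,2) by auto
  qed
  then show ?thesis
    unfolding exponent_sum_def points_B[OF ab] multiplicity_B[OF ab] by (simp only:)
qed

lemma oseledets_B_bundle:
  assumes ab: "admissible a b" and x: "x \<in> points"
  shows "\<kappa> \<in> (\<lambda>\<kappa>. \<kappa> + a) ` Ku \<Longrightarrow> oseledets f (B a b) x (ereal \<kappa>) \<subseteq> Eu x"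
    and "\<kappa> \<in> (\<lambda>\<kappa>. \<kappa> + b) ` Kc \<Longrightarrow> oseledets f (B a b) x (ereal \<kappa>) \<subseteq> Ec x"
    and "\<kappa> \<in> Ks \<Longrightarrow> oseledets f (B a b) x (ereal \<kappa>) \<subseteq> Es x"
proof -
  note s = oseledets_B_shift[OF ab x, unfolded oseledets_ereal[of f A]] and pe = points_eigenspace[OF x]
  show "oseledets f (B a b) x (ereal \<kappa>) \<subseteq> Eu x" if "\<kappa> \<in> (\<lambda>\<kappa>. \<kappa> + a) ` Ku"
    using that by (rule imageE) (simp only: s(1) pe(1))
  show "oseledets f (B a b) x (ereal \<kappa>) \<subseteq> Ec x" if "\<kappa> \<in> (\<lambda>\<kappa>. \<kappa> + b) ` Kc"
    using that by (rule imageE) (simp only: s(2) pe(2))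
  show "oseledets f (B a b) x (ereal \<kappa>) \<subseteq> Es x" if "\<kappa> \<in> Ks"
    by (simp only: s(3)[OF that] pe(3)[OF that])
qed

lemma exponent_sum_center:
  assumes ab: "admissible a b"
  shows "exponent_sum J f M (B a b) Ec = (\<Sum>\<kappa>\<in>Kc. weight \<kappa> * (\<kappa> + b))"
proof -
  note ob = oseledets_B_bundle[OF ab]
  have "exponent_sum J f M (B a b) Ec = (\<Sum>\<kappa>\<in>(\<lambda>\<kappa>. \<kappa> + b) ` Kc. real (the_enat (mult_B a b \<kappa>)) * \<kappa>)"
  proof (rule exponent_sum_B_general[OF ab])
    show "(\<lambda>\<kappa>. \<kappa> + b) ` Kc \<subseteq> exponents J f M (B a b)" unfolding exponents_B[OF ab] by blast
    show "oseledets f (B a b) x (ereal \<kappa>) \<subseteq> Ec x" if "\<kappa> \<in> (\<lambda>\<kappa>. \<kappa> + b) ` Kc" "x \<in> points" for \<kappa> x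
      by (rule ob(2)[OF that(2,1)])
    fix \<kappa> x assume k: "\<kappa> \<in> exponents J f M (B a b)" "\<kappa> \<notin> (\<lambda>\<kappa>. \<kappa> + b) ` Kc" and x: "x \<in> points"
    then consider "\<kappa> \<in> (\<lambda>\<kappa>. \<kappa> + a) ` Ku" | "\<kappa> \<in> Ks" unfolding exponents_B[OF ab] by blast
    then show "oseledets f (B a b) x (ereal \<kappa>) \<inter> Ec x \<subseteq> {0}"
    proof cases
      case 1 then show ?thesis using ob(1)[OF x 1] bundle_inter(1)[of x] by blast
    next
      case 2 then show ?thesis using ob(3)[OF x 2] bundle_inter(3)[of x] by blast
    qed
  qed
  also have "\<dots> = (\<Sum>\<kappa>\<in>Kc. weight \<kappa> * (\<kappa> + b))"
    by (subst sum.reindex) (auto simp: inj_on_def weight_def mult_B_shift[OF ab] intro!: sum.cong)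
  finally show ?thesis .
qed

lemma exponent_sum_center_unstable:
  assumes ab: "admissible a b"
  shows "exponent_sum J f M (B a b) (\<lambda>x. span (Eu x \<union> Ec x)) =
    (\<Sum>\<kappa>\<in>Ku. weight \<kappa> * (\<kappa> + a)) + (\<Sum>\<kappa>\<in>Kc. weight \<kappa> * (\<kappa> + b))"
proof -
  note ob = oseledets_B_bundle[OF ab]
  let ?U = "(\<lambda>\<kappa>. \<kappa> + a) ` Ku" and ?C = "(\<lambda>\<kappa>. \<kappa> + b) ` Kc"
  have "exponent_sum J f M (B a b) (\<lambda>x. span (Eu x \<union> Ec x)) = (\<Sum>\<kappa>\<in>?U \<union> ?C. real (the_enat (mult_B a b \<kappa>)) * \<kappa>)"
  proof (rule exponent_sum_B_general[OF ab])
    show "?U \<union> ?C \<subseteq> exponents J f M (B a b)" unfolding exponents_B[OF ab] by blast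
    fix \<kappa> x assume x: "x \<in> points"
    have sp: "Eu x \<subseteq> span (Eu x \<union> Ec x)" "Ec x \<subseteq> span (Eu x \<union> Ec x)"
      using span_superset[of "Eu x \<union> Ec x"] by simp_all
    show "oseledets f (B a b) x (ereal \<kappa>) \<subseteq> span (Eu x \<union> Ec x)" if "\<kappa> \<in> ?U \<union> ?C"
      using that
    proof
      assume "\<kappa> \<in> ?U" then show ?thesis by (rule subset_trans[OF ob(1)[OF x] sp(1)])
    next
      assume "\<kappa> \<in> ?C" then show ?thesis by (rule subset_trans[OF ob(2)[OF x] sp(2)])
    qed
    assume k: "\<kappa> \<in> exponents J f M (B a b)" "\<kappa> \<notin> ?U \<union> ?C"
    then have k': "\<kappa> \<in> Ks" unfolding exponents_B[OF ab] by blast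
    have "v = 0" if "v \<in> Es x" "v \<in> span (Eu x \<union> Ec x)" for v
    proof -
      have "Eu x \<union> Ec x \<subseteq> {v. Ps x v = 0}" using P_orth(2,4) by auto
      moreover have "subspace {v. Ps x v = 0}" by (auto simp: subspace_def blinfun.add_right blinfun.scaleR_right)
      ultimately have "span (Eu x \<union> Ec x) \<subseteq> {v. Ps x v = 0}" by (rule span_minimal)
      then have "Ps x v = 0" using that(2) by (simp add: subset_iff)
      then show ?thesis using Ps(3)[OF that(1)] by simp
    qed
    then show "oseledets f (B a b) x (ereal \<kappa>) \<inter> span (Eu x \<union> Ec x) \<subseteq> {0}" using ob(3)[OF x k'] by auto
  qed
  also have "\<dots> = (\<Sum>\<kappa>\<in>?U. real (the_enat (mult_B a b \<kappa>)) * \<kappa>) + (\<Sum>\<kappa>\<in>?C. real (the_enat (mult_B a b \<kappa>)) * \<kappa>)"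
  proof (rule sum.union_disjoint)
    show "?U \<inter> ?C = {}"
    proof (rule equals0I)
      fix z assume "z \<in> ?U \<inter> ?C"
      then obtain p q where "p \<in> Ku" "q \<in> Kc" "p + a = q + b" by auto
      then show False using order_K(1)[OF ab, of p q] by simp
    qed
  qed (use finite_K in auto)
  also have "(\<Sum>\<kappa>\<in>?U. real (the_enat (mult_B a b \<kappa>)) * \<kappa>) = (\<Sum>\<kappa>\<in>Ku. weight \<kappa> * (\<kappa> + a))"
    by (subst sum.reindex) (auto simp: inj_on_def weight_def mult_B_shift[OF ab] intro!: sum.cong)
  also have "(\<Sum>\<kappa>\<in>?C. real (the_enat (mult_B a b \<kappa>)) * \<kappa>) = (\<Sum>\<kappa>\<in>Kc. weight \<kappa> * (\<kappa> + b))"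
    by (subst sum.reindex) (auto simp: inj_on_def weight_def mult_B_shift[OF ab] intro!: sum.cong)
  finally show ?thesis .
qed

text \<open>Lowering the unstable exponents by \<open>t \<cdot> dim E\<^sup>c\<close> and raising the center ones by
  \<open>t \<cdot> dim E\<^sup>u\<close> preserves the total.\<close>

theorem perturbation_exists:
  assumes zero: "exponent_sum J f M A Ec = 0" and \<epsilon>: "0 < \<epsilon>"
  shows "\<exists>B'. B' \<in> C0I J M \<and> partially_hyperbolic J f M B' Eu Ec Es \<and> C0_norm (\<lambda>x. A x - B' x) \<le> \<epsilon> \<and>
    center_unstable_entropy J f M B' Eu Ec = center_unstable_entropy J f M A Eu Ec \<and>
    0 < exponent_sum J f M B' Ec"
proof -
  define Nu Nc where "Nu = sum weight Ku" and "Nc = sum weight Kc"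
  have Nu: "Nu > 0" unfolding Nu_def by (rule sum_pos[OF finite_K(1) nonempty_K(1)]) (simp add: weight_pos)
  have Nc: "Nc > 0" unfolding Nc_def by (rule sum_pos[OF finite_K(2) nonempty_K(2)]) (simp add: weight_pos)
  obtain C where C: "C \<ge> 1" "\<And>x. norm (A x) \<le> C" using norm_A_bounded by blast
  \<comment> \<open>All constraints on \<open>t\<close> are strict and hold in the limit at 0 from
    the right, so some positive \<open>t\<close> meets them together.\<close>
  have lim1: "((\<lambda>t. real l * (t * Nu - - t * Nc)) \<longlongrightarrow> real l * (0 * Nu - - 0 * Nc)) (at_right 0)"
    by (intro tendsto_intros)
  have lim2: "((\<lambda>t. C * (exp (t * Nu) - exp (- t * Nc))) \<longlongrightarrow> C * (exp (0 * Nu) - exp (- 0 * Nc))) (at_right 0)"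
    by (intro tendsto_intros)
  have lim3: "((\<lambda>t. \<kappa> + (- t * Nc)) \<longlongrightarrow> \<kappa> + (- 0 * Nc)) (at_right 0)" for \<kappa>
    by (intro tendsto_intros)
  have "0 < - ln \<alpha>" using \<alpha> by simp
  then have ev1: "\<forall>\<^sub>F t in at_right 0. real l * (t * Nu - - t * Nc) < - ln \<alpha>"
    by (intro order_tendstoD(2)[OF lim1]) simp
  have ev2: "\<forall>\<^sub>F t in at_right 0. C * (exp (t * Nu) - exp (- t * Nc)) < \<epsilon>"
    by (rule order_tendstoD(2)[OF lim2]) (simp add: \<epsilon>)
  have ev3: "\<forall>\<^sub>F t in at_right 0. \<forall>\<kappa>\<in>Ku. 0 < \<kappa> + (- t * Nc)"
    by (intro eventually_ball_finite finite_K ballI order_tendstoD(1)[OF lim3]) (simp add: signs(1))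
  have ev4: "\<forall>\<^sub>F t :: real in at_right 0. 0 < t" by (rule eventually_at_right_less)
  have "\<forall>\<^sub>F t in at_right 0. 0 < t \<and> real l * (t * Nu - - t * Nc) < - ln \<alpha> \<and>
      C * (exp (t * Nu) - exp (- t * Nc)) < \<epsilon> \<and> (\<forall>\<kappa>\<in>Ku. 0 < \<kappa> + (- t * Nc))"
    using ev1 ev2 ev3 ev4 by eventually_elim (intro conjI)
  then obtain t where t: "0 < t" "real l * (t * Nu - - t * Nc) < - ln \<alpha>"
      "C * (exp (t * Nu) - exp (- t * Nc)) < \<epsilon>" "\<forall>\<kappa>\<in>Ku. 0 < \<kappa> + (- t * Nc)"
    using eventually_happens'[OF trivial_limit_at_right_real] by blast
  define a b where "a = - t * Nc" and "b = t * Nu"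
  have a: "a \<le> 0" and b: "0 \<le> b" using t(1) Nu Nc by (simp_all add: a_def b_def)
  have ab: "admissible a b" unfolding admissible_def using a b t(2,4) by (simp add: a_def b_def)
  have sumshift: "(\<Sum>\<kappa>\<in>K. weight \<kappa> * (\<kappa> + c)) = (\<Sum>\<kappa>\<in>K. weight \<kappa> * \<kappa>) + sum weight K * c" for K c
    by (simp add: distrib_left sum.distrib sum_distrib_right)
  have zeroK: "(\<Sum>\<kappa>\<in>Kc. weight \<kappa> * \<kappa>) = 0"
    using exponent_sum_center[OF admissible_zero] zero by (simp add: B_zero)
  have "exponent_sum J f M (B a b) Ec = Nc * b"
    unfolding exponent_sum_center[OF ab] sumshift zeroK by (simp add: Nc_def)
  then have "0 < exponent_sum J f M (B a b) Ec" using Nc Nu t(1) by (simp add: b_def)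
  moreover have "center_unstable_entropy J f M (B a b) Eu Ec = center_unstable_entropy J f M A Eu Ec"
  proof -
    have "Nu * a + Nc * b = 0" by (simp add: a_def b_def)
    then have "exponent_sum J f M (B a b) (\<lambda>x. span (Eu x \<union> Ec x)) = exponent_sum J f M (B 0 0) (\<lambda>x. span (Eu x \<union> Ec x))"
      unfolding exponent_sum_center_unstable[OF ab] exponent_sum_center_unstable[OF admissible_zero] sumshift
      by (simp add: Nu_def Nc_def)
    then show ?thesis by (simp only: center_unstable_entropy_def B_zero)
  qed
  moreover have "C0_norm (\<lambda>x. A x - B a b x) \<le> \<epsilon>"
    using C0_norm_B[OF a b C(2)] t(3) by (simp add: a_def b_def)
  ultimately show ?thesis using C0I_B partially_hyperbolic_B[OF ab] by blast
qed

end

section \<open>Groups of Oseledets subspaces\<close>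

text \<open>Domination passes from single bundles to orthogonal sums with orthogonal images: by
  Pythagoras the squares of both sides are double sums over pairs, which are compared term by
  term.\<close>

lemma bilinear_domination_sum:
  fixes T :: "'h::real_inner \<Rightarrow>\<^sub>L 'h" and u v :: "nat \<Rightarrow> 'h"
  assumes fin: "finite I" "finite K" and a: "a \<ge> 0"
    and orth: "\<And>i j. i \<in> I \<Longrightarrow> j \<in> I \<Longrightarrow> i \<noteq> j \<Longrightarrow> v i \<bullet> v j = 0" "\<And>i j. i \<in> I \<Longrightarrow> j \<in> I \<Longrightarrow> i \<noteq> j \<Longrightarrow> T (v i) \<bullet> T (v j) = 0"
      "\<And>i j. i \<in> K \<Longrightarrow> j \<in> K \<Longrightarrow> i \<noteq> j \<Longrightarrow> u i \<bullet> u j = 0" "\<And>i j. i \<in> K \<Longrightarrow> j \<in> K \<Longrightarrow> i \<noteq> j \<Longrightarrow> T (u i) \<bullet> T (u j) = 0"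
    and le: "\<And>i j. i \<in> I \<Longrightarrow> j \<in> K \<Longrightarrow> norm (T (u j)) * norm (v i) \<le> a * (norm (T (v i)) * norm (u j))"
  shows "norm (T (sum u K)) * norm (sum v I) \<le> a * (norm (T (sum v I)) * norm (sum u K))"
proof (rule power2_le_imp_le)
  have pyth: "(norm (sum w S))\<^sup>2 = (\<Sum>i\<in>S. (norm (w i))\<^sup>2)"
    if "finite S" "\<And>i j. i \<in> S \<Longrightarrow> j \<in> S \<Longrightarrow> i \<noteq> j \<Longrightarrow> w i \<bullet> w j = 0" for S :: "nat set" and w :: "nat \<Rightarrow> 'h"
    by (rule norm_sum_Pythagorean) (use that in \<open>simp_all add: pairwise_def orthogonal_def\<close>)
  have pythT: "(norm (T (sum w S)))\<^sup>2 = (\<Sum>i\<in>S. (norm (T (w i)))\<^sup>2)"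
    if "finite S" "\<And>i j. i \<in> S \<Longrightarrow> j \<in> S \<Longrightarrow> i \<noteq> j \<Longrightarrow> T (w i) \<bullet> T (w j) = 0" for S :: "nat set" and w :: "nat \<Rightarrow> 'h"
    unfolding blinfun.sum_right by (rule pyth[where w = "\<lambda>i. T (w i)", OF that])
  have Tu: "(norm (T (sum u K)))\<^sup>2 = (\<Sum>i\<in>K. (norm (T (u i)))\<^sup>2)" by (rule pythT[OF fin(2)]) (rule orth(4))
  have Tv: "(norm (T (sum v I)))\<^sup>2 = (\<Sum>i\<in>I. (norm (T (v i)))\<^sup>2)" by (rule pythT[OF fin(1)]) (rule orth(2))
  have u: "(norm (sum u K))\<^sup>2 = (\<Sum>i\<in>K. (norm (u i))\<^sup>2)" by (rule pyth[OF fin(2)]) (rule orth(3))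
  have v: "(norm (sum v I))\<^sup>2 = (\<Sum>i\<in>I. (norm (v i))\<^sup>2)" by (rule pyth[OF fin(1)]) (rule orth(1))
  have "(norm (T (sum u K)) * norm (sum v I))\<^sup>2 = (\<Sum>j\<in>K. (norm (T (u j)))\<^sup>2) * (\<Sum>i\<in>I. (norm (v i))\<^sup>2)"
    unfolding power_mult_distrib Tu v ..
  also have "\<dots> = (\<Sum>j\<in>K. \<Sum>i\<in>I. (norm (T (u j)) * norm (v i))\<^sup>2)"
    by (simp only: sum_product power_mult_distrib)
  also have "\<dots> \<le> (\<Sum>j\<in>K. \<Sum>i\<in>I. (a * (norm (T (v i)) * norm (u j)))\<^sup>2)"
    by (intro sum_mono power_mono le) simp_all
  also have "\<dots> = a\<^sup>2 * ((\<Sum>j\<in>K. (norm (u j))\<^sup>2) * (\<Sum>i\<in>I. (norm (T (v i)))\<^sup>2))"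
    unfolding sum_product by (simp add: sum_distrib_left power_mult_distrib mult_ac)
  also have "\<dots> = (a * (norm (T (sum v I)) * norm (sum u K)))\<^sup>2"
    unfolding power_mult_distrib Tv u by (simp only: mult_ac)
  finally show "(norm (T (sum u K)) * norm (sum v I))\<^sup>2 \<le> (a * (norm (T (sum v I)) * norm (sum u K)))\<^sup>2" .
qed (use a in simp)

text \<open>The data of \<open>partially_hyperbolic\<close> together with orthogonal projections
  onto the single groups, and with no condition on the center bundle. Both cases of the proof start
  from here.\<close>

locale partially_hyperbolic_groups =
  fixes J :: "'h::{real_inner, banach} \<Rightarrow>\<^sub>L 'h" and f :: "'x::t2_space \<Rightarrow> 'x" and M :: "'x measure"
    and A :: "'x \<Rightarrow> 'h \<Rightarrow>\<^sub>L 'h" and k :: nat and G :: "nat \<Rightarrow> ereal set" and E :: "nat \<Rightarrow> 'x \<Rightarrow> 'h set"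
    and Iu Ic Is :: "nat set" and l :: nat and \<alpha> \<beta> :: real and P :: "nat \<Rightarrow> 'x \<Rightarrow> 'h \<Rightarrow>\<^sub>L 'h"
  assumes J: "hilbert_scalars J" and sets_M: "sets M = sets borel" and prob_M: "prob_space M"
    and A: "A \<in> C0I J M" and ext: "extended_oseledets_ruelle J f M A k G E"
    and I_union: "Iu \<union> Ic \<union> Is = {..<k}" and I_disjoint: "Iu \<inter> Ic = {}" "Iu \<inter> Is = {}" "Ic \<inter> Is = {}"
    and unstable: "\<And>\<kappa>. \<kappa> \<in> (\<Union>i\<in>Iu. G i) \<Longrightarrow> 0 < \<kappa>" and center: "0 \<in> exponents J f M A \<Longrightarrow> 0 \<in> (\<Union>i\<in>Ic. G i)"
    and stable: "\<And>\<kappa>. \<kappa> \<in> (\<Union>i\<in>Is. G i) \<Longrightarrow> \<kappa> < 0" and kernel: "-\<infinity> \<in> (\<Union>i\<in>Is. G i)"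
    and \<alpha>: "0 < \<alpha>" "\<alpha> < 1" and \<beta>: "0 < \<beta>" "\<beta> < 1"
    and dom_uc: "dominated J f A UNIV l \<alpha> (bundle_sum E Iu) (bundle_sum E Ic)"
    and dom_cs: "dominated J f A UNIV l \<beta> (bundle_sum E Ic) (bundle_sum E Is)"
    and nonzero: "bundle_sum E Iu x \<noteq> {0}"
    and P_cont: "\<And>i v. i < k \<Longrightarrow> continuous_on UNIV (\<lambda>x. P i x v)"
    and P_projection: "\<And>i. i < k \<Longrightarrow> bundle_projection f A (E i) (P i)"
    and P_sum: "\<And>x v. (\<Sum>i<k. P i x v) = v"
    and E_orth: "\<And>i j x u v. i < k \<Longrightarrow> j < k \<Longrightarrow> i \<noteq> j \<Longrightarrow> u \<in> E i x \<Longrightarrow> v \<in> E j x \<Longrightarrow> u \<bullet> v = 0"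
begin

abbreviation "Eu \<equiv> bundle_sum E Iu"
abbreviation "Ec \<equiv> bundle_sum E Ic"
abbreviation "Es \<equiv> bundle_sum E Is"
abbreviation "points \<equiv> oseledets_points J f M A"

lemma I_less: "i \<in> Iu \<Longrightarrow> i < k" "i \<in> Ic \<Longrightarrow> i < k" "i \<in> Is \<Longrightarrow> i < k"
  using I_union by auto

lemma I_subset: "Iu \<subseteq> {..<k}" "Ic \<subseteq> {..<k}" "Is \<subseteq> {..<k}"
  using I_union by auto

lemma I_finite: "finite Iu" "finite Ic" "finite Is"
  using I_subset by (auto intro: finite_subset)

lemma E_in_bundle_sum: "i \<in> I \<Longrightarrow> E i x \<subseteq> bundle_sum E I x"
  unfolding bundle_sum_def by (rule subset_trans[OF _ span_superset]) (rule UN_upper)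

lemma projection_sum:
  assumes "I \<subseteq> {..<k}"
  shows "bundle_projection f A (bundle_sum E I) (\<lambda>x. \<Sum>i\<in>I. P i x)"
proof (rule bundle_projection_sum)
  show "finite I" by (rule finite_subset[OF assms]) simp
  show "bundle_projection f A (E i) (P i)" if "i \<in> I" for i using assms that by (intro P_projection) auto
  show "u \<bullet> v = 0" if "i \<in> I" "j \<in> I" "i \<noteq> j" "u \<in> E i x" "v \<in> E j x" for i j x u v
    by (rule E_orth[OF _ _ that(3-5)]) (use assms that in auto)
qed

lemma projection_vanishes:
  assumes I: "I \<subseteq> {..<k}" "K \<subseteq> {..<k}" "I \<inter> K = {}" and v: "v \<in> bundle_sum E I x"
  shows "(\<Sum>i\<in>K. P i x) v = 0"
proof -
  let ?Q = "\<lambda>x. \<Sum>i\<in>K. P i x"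
  note Q = bundle_projectionD[OF projection_sum[OF I(2)]]
  have "v \<bullet> ?Q x v = 0"
  proof (rule bundle_sums_orthogonal[OF _ v Q(2)])
    fix i j u v assume ij: "i \<in> I" "j \<in> K" "u \<in> E i x" "v \<in> E j x"
    then have "i < k" "j < k" "i \<noteq> j" using I by auto
    then show "u \<bullet> v = 0" using ij(3,4) by (rule E_orth)
  qed
  then have "?Q x v \<bullet> ?Q x v = 0" using Q(4)[of x "?Q x v" v] Q(6)[of x v] by (simp add: inner_commute)
  then show ?thesis by simp
qed

lemma points_exist: obtains x where "x \<in> points"
  by (rule oseledets_points_exist[OF prob_M ext_AE[OF ext]])

lemma bundle_closure:
  assumes x: "x \<in> points" and I: "I \<subseteq> {..<k}"
  shows "bundle_sum E I x = closure (span (\<Union>\<kappa>\<in>(\<Union>i\<in>I. G i). oseledets f A x \<kappa>))"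
  by (rule ext_bundle_sum[OF ext x I bundle_projection_closed[OF projection_sum[OF I]]])

lemma oseledets_in_group: "x \<in> points \<Longrightarrow> i < k \<Longrightarrow> \<kappa> \<in> G i \<Longrightarrow> oseledets f A x \<kappa> \<subseteq> E i x"
  using ext_bundle[OF ext, of x i] subset_trans[OF UN_upper[of \<kappa> "G i" "oseledets f A x"] subset_trans[OF span_superset closure_subset]]
  by simp

lemma group_exponent: "i < k \<Longrightarrow> \<kappa> \<in> G i \<Longrightarrow> \<kappa> = -\<infinity> \<or> \<kappa> \<in> ereal ` exponents J f M A"
  using ext_groups[OF ext] by blast

lemma exponent_group:
  assumes "\<kappa> \<in> exponents J f M A"
  obtains i where "i < k" "ereal \<kappa> \<in> G i"
proof -
  have "ereal \<kappa> \<in> (\<Union>i<k. G i)" unfolding ext_groups[OF ext] using assms by simp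
  then show ?thesis using that by blast
qed

lemma group_eq:
  assumes "i < k" "j < k" "\<kappa> \<in> G i" "\<kappa> \<in> G j"
  shows "i = j"
  using disjoint_family_onD[OF ext_disjoint[OF ext], of i j] assms by auto

lemma nonzero_group:
  assumes x: "x \<in> points" and i: "i < k" and nz: "E i x \<noteq> {0}"
  obtains \<kappa> v where "\<kappa> \<in> G i" "v \<in> oseledets f A x \<kappa>" "v \<in> E i x" "v \<noteq> 0"
proof -
  have "\<not> (\<Union>\<kappa>\<in>G i. oseledets f A x \<kappa>) \<subseteq> {0}"
  proof
    assume "(\<Union>\<kappa>\<in>G i. oseledets f A x \<kappa>) \<subseteq> {0}"
    then have "span (\<Union>\<kappa>\<in>G i. oseledets f A x \<kappa>) \<subseteq> {0}" by (rule span_minimal) simp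
    then have "closure (span (\<Union>\<kappa>\<in>G i. oseledets f A x \<kappa>)) \<subseteq> {0}" by (rule closure_minimal) simp
    moreover have "0 \<in> E i x" by (rule subspace_0[OF ext_subspace[OF ext i]])
    ultimately show False using nz ext_bundle[OF ext x i] by blast
  qed
  then obtain \<kappa> v where "\<kappa> \<in> G i" "v \<in> oseledets f A x \<kappa>" "v \<noteq> 0" by auto
  then show ?thesis using that oseledets_in_group[OF x i] by blast
qed

section \<open>Order and domination of unstable and stable groups\<close>

lemma nonzero_everywhere:
  assumes "i < k" "E i x \<noteq> {0}" "\<exists>d. \<forall>x. hdim J (E i x) = d"
  shows "E i y \<noteq> {0}"
proof
  assume "E i y = {0}"
  then have "hdim J (E i x) = 0" using assms(3) by (metis hdim_zero)
  moreover have "J v \<in> E i x" if "v \<in> E i x" for v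
    using ext_closed_subspace[OF ext assms(1), of x] that by (simp add: closed_subspace_def)
  ultimately show False using hdim_eq_0[OF J ext_subspace[OF ext assms(1)], of x] assms(2) by blast
qed

lemma ext_hdim: "i < k \<Longrightarrow> \<exists>d. \<forall>x. hdim J (E i x) = d"
  using ext unfolding extended_oseledets_ruelle_def by (simp only: simp_thms)

text \<open>The groups need not be ordered by their exponents, but an unstable group lies before a stable
  one when both are nonzero, as domination orders the exponents.\<close>

lemma unstable_before_stable:
  assumes dom: "\<And>i j. i < j \<Longrightarrow> j < k \<Longrightarrow> dominated J f A UNIV m \<gamma> (E i) (E j)" and \<gamma>: "0 < \<gamma>" "\<gamma> < 1"
    and i: "i \<in> Iu" and j: "j \<in> Is" and nz: "E i x \<noteq> {0}" "E j x \<noteq> {0}"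
  shows "i < j"
proof (rule ccontr)
  assume "\<not> i < j"
  then have ji: "j < i" using i j I_disjoint(2) by (metis IntI empty_iff linorder_neqE_nat)
  obtain y where y: "y \<in> points" by (rule points_exist)
  note ik = I_less(1)[OF i] and jk = I_less(3)[OF j]
  obtain \<kappa> v where v: "\<kappa> \<in> G i" "v \<in> oseledets f A y \<kappa>" "v \<in> E i y" "v \<noteq> 0"
    by (rule nonzero_group[OF y ik nonzero_everywhere[OF ik nz(1) ext_hdim[OF ik]]])
  obtain \<mu> w where w: "\<mu> \<in> G j" "w \<in> oseledets f A y \<mu>" "w \<in> E j y" "w \<noteq> 0"
    by (rule nonzero_group[OF y jk nonzero_everywhere[OF jk nz(2) ext_hdim[OF jk]]])
  let ?e = "\<lambda>\<kappa>. if \<kappa> = -\<infinity> then 0 else exp (real_of_ereal \<kappa>)"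
  note r = bundle_projectionD[OF P_projection[OF jk]]
  have inv: "lyapunov_approx f A y n z \<in> E j y" if n: "n > 0" and z: "z \<in> E j y" for n z
  proof -
    have "lyapunov_approx f A y n z = (lyapunov_approx f A y n o\<^sub>L P j y) z" by (simp add: r(3)[OF z])
    also have "\<dots> = P j y (lyapunov_approx f A y n z)" unfolding reducing_lyapunov_approx[OF r(1) n, symmetric] by simp
    also have "\<dots> \<in> E j y" by (rule r(2))
    finally show ?thesis .
  qed
  \<comment> \<open>In the wrong order, domination would bound a number that is at least 1 by
    \<gamma> times a number that is at most 1.\<close>
  have "?e \<kappa> ^ m \<le> \<gamma> * ?e \<mu> ^ m"
    by (rule dominated_eigenvalues[OF dom[OF ji ik] \<gamma>(1) oseledets_pointsD(3)[OF y] inv v(3,4) _ w(3,4)])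
      (use v(2) w(2) in \<open>simp_all add: oseledets_def\<close>)
  moreover have "0 < \<kappa>" using unstable[of \<kappa>] i v(1) by blast
  then have "1 \<le> ?e \<kappa>" using group_exponent[OF ik v(1)] by auto
  then have "1 \<le> ?e \<kappa> ^ m" by (rule one_le_power)
  moreover have "\<mu> < 0" using stable[of \<mu>] j w(1) by blast
  then have "0 \<le> ?e \<mu>" "?e \<mu> \<le> 1" using group_exponent[OF jk w(1)] by auto
  then have "?e \<mu> ^ m \<le> 1" by (rule power_le_one)
  then have "\<gamma> * ?e \<mu> ^ m \<le> \<gamma> * 1" using \<gamma>(1) by (intro mult_left_mono) auto
  ultimately show False using \<gamma>(2) by linarith
qed

text \<open>The two given dominations connect \<open>Eu\<close> and \<open>Es\<close> only through
  \<open>Ec\<close>, which may be zero. So the estimate is assembled from the pairs consisting of an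
  unstable and a stable group.\<close>

lemma dominated_unstable_stable: "\<exists>m \<gamma>. 0 < \<gamma> \<and> \<gamma> < 1 \<and> dominated J f A UNIV m \<gamma> Eu Es"
proof -
  obtain m \<gamma> where \<gamma>: "0 < \<gamma>" "\<gamma> < 1"
    and dom: "\<And>i j. i < j \<Longrightarrow> j < k \<Longrightarrow> dominated J f A UNIV m \<gamma> (E i) (E j)"
    using ext_dominated[OF ext] by blast
  note uc = dominatedD[OF dom_uc] and cs = dominatedD[OF dom_cs]
  have pair: "norm (iterate f A m x u) * norm v \<le> \<gamma> * (norm (iterate f A m x v) * norm u)"
    if i: "i \<in> Iu" and j: "j \<in> Is" and v: "v \<in> E i x" and u: "u \<in> E j x" for i j x u v
  proof (cases "u = 0 \<or> v = 0")
    case True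
    then show ?thesis by auto
  next
    case False
    then have uv: "u \<noteq> 0" "v \<noteq> 0" by simp_all
    \<comment> \<open>Nonzero vectors make both groups nonzero, so their order is known and the
      domination between them can be used.\<close>
    then have "i < j" using v u by (intro unstable_before_stable[OF dom \<gamma> i j, of x]) auto
    then have d: "dominated J f A UNIV m \<gamma> (E i) (E j)" using I_less(3)[OF j] by (rule dom)
    have "norm (iterate f A m x ((1 / norm u) *\<^sub>R u)) \<le> \<gamma> * norm (iterate f A m x ((1 / norm v) *\<^sub>R v))"
      by (rule dominatedD(11)[OF d]) (use uv u v in \<open>simp_all add: subspace_scale dominatedD(1,2)[OF d]\<close>)
    then show ?thesis using uv by (simp add: blinfun.scaleR_right field_simps)
  qed
  have orth: "iterate f A m x u \<bullet> iterate f A m x v = 0" "u \<bullet> v = 0"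
    if ij: "i < k" "j < k" "i \<noteq> j" "u \<in> E i x" "v \<in> E j x" for i j x u v
  proof -
    show "u \<bullet> v = 0" by (rule E_orth[OF ij])
    have inv: "A x v \<in> E i (f x)" if "i < k" "v \<in> E i x" for i x v
      using bundle_projectionD(2,3,5)[OF P_projection[OF that(1)]] that(2) by metis
    show "iterate f A m x u \<bullet> iterate f A m x v = 0"
      by (rule E_orth[OF ij(1-3) iterate_invariant[where E = "E i"] iterate_invariant[where E = "E j"]])
        (use ij inv in simp_all)
  qed
  have P_in: "P i x v \<in> E i x" if "i < k" for i x v by (rule bundle_projectionD(2)[OF P_projection[OF that]])
  have bound: "norm (iterate f A m x u) \<le> \<gamma> * norm (iterate f A m x v)"
    if u: "u \<in> Es x" and v: "v \<in> Eu x" and n: "norm u = 1" "norm v = 1" for x u v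
  proof -
    have us: "u = (\<Sum>i\<in>Is. P i x u)" and vs: "v = (\<Sum>i\<in>Iu. P i x v)"
      using bundle_projectionD(3)[OF projection_sum[OF I_subset(3)] u] bundle_projectionD(3)[OF projection_sum[OF I_subset(1)] v]
      by (simp_all add: blinfun.sum_left)
    have "norm (iterate f A m x (\<Sum>i\<in>Is. P i x u)) * norm (\<Sum>i\<in>Iu. P i x v)
        \<le> \<gamma> * (norm (iterate f A m x (\<Sum>i\<in>Iu. P i x v)) * norm (\<Sum>i\<in>Is. P i x u))"
    proof (rule bilinear_domination_sum[OF I_finite(1,3)])
      fix i j assume ij: "i \<in> Iu" "j \<in> Iu" "i \<noteq> j"
      note o = orth[OF I_less(1)[OF ij(1)] I_less(1)[OF ij(2)] ij(3) P_in[OF I_less(1)[OF ij(1)]] P_in[OF I_less(1)[OF ij(2)]]]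
      show "P i x v \<bullet> P j x v = 0" "iterate f A m x (P i x v) \<bullet> iterate f A m x (P j x v) = 0" by (rule o)+
    next
      fix i j assume ij: "i \<in> Is" "j \<in> Is" "i \<noteq> j"
      note o = orth[OF I_less(3)[OF ij(1)] I_less(3)[OF ij(2)] ij(3) P_in[OF I_less(3)[OF ij(1)]] P_in[OF I_less(3)[OF ij(2)]]]
      show "P i x u \<bullet> P j x u = 0" "iterate f A m x (P i x u) \<bullet> iterate f A m x (P j x u) = 0" by (rule o)+
    next
      fix i j assume ij: "i \<in> Iu" "j \<in> Is"
      show "norm (iterate f A m x (P j x u)) * norm (P i x v) \<le> \<gamma> * (norm (iterate f A m x (P i x v)) * norm (P j x u))"
        by (rule pair[OF ij P_in[OF I_less(1)[OF ij(1)]] P_in[OF I_less(3)[OF ij(2)]]])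
    qed (use \<gamma> in simp)
    then show ?thesis unfolding us[symmetric] vs[symmetric] using n by simp
  qed
  obtain \<theta> where \<theta>: "\<theta> > 0" "\<And>x v. v \<in> Eu x \<Longrightarrow> norm v = 1 \<Longrightarrow> \<theta> \<le> norm (A x v)" using uc(10) by blast
  have inter: "Eu x \<inter> Es x = {0}" for x
  proof -
    have "v = 0" if "v \<in> Eu x" "v \<in> Es x" for v
      using projection_vanishes[OF I_subset(3,1) _ that(2)] bundle_projectionD(3)[OF projection_sum[OF I_subset(1)] that(1)]
        I_disjoint(2) by (simp add: Int_commute)
    then show ?thesis using subspace_0[OF uc(1)] subspace_0[OF cs(2)] by blast
  qed
  have "dominated J f A UNIV m \<gamma> Eu Es"
    by (rule dominatedI[OF uc(3) cs(4) inter uc(5) cs(6) uc(8) cs(9) \<theta> bound])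
  then show ?thesis using \<gamma> by blast
qed

lemma unstable_stable_inter: "Eu x \<inter> Es x = {0}"
proof -
  obtain m \<gamma> where "dominated J f A UNIV m \<gamma> Eu Es" using dominated_unstable_stable by blast
  then show ?thesis by (rule dominatedD(7))
qed

lemma finite_dim_unstable: "finite_dim (Eu x)"
  using A by (intro dominated_finite_dim[OF dom_uc]) (simp add: C0I_def)

section \<open>The case of a zero center bundle\<close>

lemma oseledets_nonzero:
  assumes "x \<in> points" "\<kappa> \<in> exponents J f M A"
  shows "\<not> oseledets f A x (ereal \<kappa>) \<subseteq> {0}"
proof
  assume "oseledets f A x (ereal \<kappa>) \<subseteq> {0}"
  moreover have "0 \<in> oseledets f A x (ereal \<kappa>)" by (simp add: oseledets_def)
  ultimately have "oseledets f A x (ereal \<kappa>) = {0}" by blast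
  then show False using oseledets_pointsD(5)[OF assms(1), of \<kappa>] assms(2) by (simp add: exponents_def)
qed

text \<open>The group of the exponent is not a center group, as that bundle is zero, and not a
  stable one, as \<open>Es\<close> meets \<open>Eu\<close> only in 0. So it is unstable.\<close>

lemma exponent_positive_in_unstable:
  assumes c: "\<And>x. Ec x = {0}" and \<kappa>: "\<kappa> \<in> exponents J f M A" and x: "x \<in> points" and sub: "oseledets f A x (ereal \<kappa>) \<subseteq> Eu x"
  shows "0 < \<kappa>" and "0 < the_enat (multiplicity J f M A \<kappa>)"
proof -
  let ?V = "oseledets f A x (ereal \<kappa>)"
  have m: "hdim J ?V = multiplicity J f M A \<kappa>" by (rule oseledets_pointsD(5)[OF x])
  have m0: "multiplicity J f M A \<kappa> \<noteq> 0" using \<kappa> by (simp add: exponents_def)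
  note nz = oseledets_nonzero[OF x \<kappa>]
  obtain i where i: "i < k" "ereal \<kappa> \<in> G i" by (rule exponent_group[OF \<kappa>])
  have Ei: "?V \<subseteq> E i x" by (rule oseledets_in_group[OF x i])
  have "i \<notin> Ic" using E_in_bundle_sum[of i Ic x] c[of x] Ei nz by blast
  moreover have "i \<notin> Is"
  proof
    assume "i \<in> Is"
    then have "?V \<subseteq> Eu x \<inter> Es x" using E_in_bundle_sum[of i Is x] Ei sub by blast
    then show False using nz unstable_stable_inter[of x] by simp
  qed
  ultimately have "i \<in> Iu" using i(1) I_union by blast
  then have "0 < ereal \<kappa>" using i(2) by (intro unstable) blast
  then show "0 < \<kappa>" by simp
  have "finite_dim ?V" using finite_dim_unstable sub by (rule finite_dim_subset)
  then have "hdim J ?V \<noteq> \<infinity>" by (simp add: hdim_def)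
  then have "multiplicity J f M A \<kappa> \<noteq> \<infinity>" unfolding m .
  then show "0 < the_enat (multiplicity J f M A \<kappa>)" using m0 by (cases "multiplicity J f M A \<kappa>") (auto simp: zero_enat_def)
qed

lemma exponent_sum_unstable_pos:
  assumes c: "\<And>x. Ec x = {0}"
  shows "0 < exponent_sum J f M A Eu"
proof -
  define S where "S = {\<kappa>. \<kappa> \<in> exponents J f M A \<and> (\<forall>x\<in>points. oseledets f A x (ereal \<kappa>) \<subseteq> Eu x)}"
  obtain x where x: "x \<in> points" by (rule points_exist)
  have S: "\<kappa> \<in> exponents J f M A" "oseledets f A y (ereal \<kappa>) \<subseteq> Eu y" if "\<kappa> \<in> S" "y \<in> points" for \<kappa> y
    using that by (auto simp: S_def)
  \<comment> \<open>Finiteness matters because a sum over an infinite set is 0. One eigenvector for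
    each exponent gives an independent family in the finite dimensional space
    \<open>Eu x\<close>.\<close>
  have fin: "finite S"
  proof -
    have "\<exists>v. v \<in> oseledets f A x (ereal \<kappa>) \<and> v \<noteq> 0" if "\<kappa> \<in> S" for \<kappa>
      using oseledets_nonzero[OF x S(1)[OF that x]] by blast
    then obtain v where v: "\<And>\<kappa>. \<kappa> \<in> S \<Longrightarrow> v \<kappa> \<in> oseledets f A x (ereal \<kappa>)" "\<And>\<kappa>. \<kappa> \<in> S \<Longrightarrow> v \<kappa> \<noteq> 0" by metis
    have orth: "v \<kappa> \<bullet> v \<mu> = 0" if "\<kappa> \<in> S" "\<mu> \<in> S" "\<kappa> \<noteq> \<mu>" for \<kappa> \<mu>
      by (rule eigenspace_orthogonal[OF positive_lyapunov_operator[OF oseledets_pointsD(3)[OF x]]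
            v(1)[OF that(1), unfolded oseledets_ereal] v(1)[OF that(2), unfolded oseledets_ereal]]) (use that(3) in simp)
    have inj: "inj_on v S"
    proof (rule inj_onI, rule ccontr)
      fix \<kappa> \<mu> assume "\<kappa> \<in> S" "\<mu> \<in> S" "v \<kappa> = v \<mu>" "\<kappa> \<noteq> \<mu>"
      then show False using orth[of \<kappa> \<mu>] v(2)[of \<mu>] by simp
    qed
    have "independent (v ` S)"
    proof (rule pairwise_orthogonal_independent)
      show "pairwise orthogonal (v ` S)" using orth by (auto simp: pairwise_def orthogonal_def)
      show "0 \<notin> v ` S" using v(2) by auto
    qed
    moreover obtain T where T: "finite T" "Eu x \<subseteq> span T" using finite_dim_unstable[of x] by (auto simp: finite_dim_def)
    have "v ` S \<subseteq> span T" using v(1) S(2)[OF _ x] T(2) by blast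
    ultimately have "finite (v ` S)" using independent_span_bound[OF T(1)] by blast
    then show ?thesis using inj by (rule finite_imageD)
  qed
  have ne: "S \<noteq> {}"
  proof -
    have "\<exists>i\<in>Iu. E i x \<noteq> {0}"
    proof (rule ccontr)
      assume "\<not> (\<exists>i\<in>Iu. E i x \<noteq> {0})"
      then have "(\<Union>i\<in>Iu. E i x) \<subseteq> {0}" by blast
      then have "Eu x \<subseteq> {0}" unfolding bundle_sum_def by (rule span_minimal) simp
      then show False using nonzero[of x] subspace_0[OF dominatedD(1)[OF dom_uc, of x]] by blast
    qed
    then obtain i where i: "i \<in> Iu" "E i x \<noteq> {0}" by blast
    note ik = I_less(1)[OF i(1)]
    obtain \<kappa> v where k: "\<kappa> \<in> G i" by (rule nonzero_group[OF x ik i(2)])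
    have "0 < \<kappa>" using unstable[of \<kappa>] i(1) k by blast
    then obtain r where r: "\<kappa> = ereal r" "r \<in> exponents J f M A" using group_exponent[OF ik k] by auto
    have "oseledets f A y (ereal r) \<subseteq> Eu y" if y: "y \<in> points" for y
      using oseledets_in_group[OF y ik k] E_in_bundle_sum[OF i(1), of y] r(1) by blast
    then have "r \<in> S" using r(2) by (simp add: S_def)
    then show ?thesis by blast
  qed
  have "0 < (\<Sum>\<kappa>\<in>S. real (the_enat (multiplicity J f M A \<kappa>)) * \<kappa>)"
    by (rule sum_pos[OF fin ne]) (intro mult_pos_pos, simp_all add: exponent_positive_in_unstable[OF c S(1)[OF _ x] x S(2)[OF _ x]])
  then show ?thesis by (simp only: exponent_sum_def S_def)
qed

text \<open>\<open>partially_hyperbolic\<close> puts no sign condition on the exponents of the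
  center, so the unstable groups may be counted there together with the zero center groups.\<close>

lemma regrouped:
  assumes c: "\<And>x. Ec x = {0}"
  shows "partially_hyperbolic J f M A (\<lambda>_. {0}) Eu Es"
proof -
  obtain m \<gamma> where \<gamma>: "0 < \<gamma>" "\<gamma> < 1" and dom: "dominated J f A UNIV m \<gamma> Eu Es" using dominated_unstable_stable by blast
  note d = dominatedD[OF dom]
  have Eu: "bundle_sum E (Iu \<union> Ic) x = Eu x" for x
  proof
    have "E i x \<subseteq> Eu x" if "i \<in> Iu \<union> Ic" for i
      using that
    proof
      assume "i \<in> Iu" then show ?thesis by (rule E_in_bundle_sum)
    next
      assume "i \<in> Ic" then have "E i x \<subseteq> {0}" unfolding c[of x, symmetric] by (rule E_in_bundle_sum)
      then show ?thesis using subspace_0[OF d(1), of x] by auto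
    qed
    then show "bundle_sum E (Iu \<union> Ic) x \<subseteq> Eu x"
      using d(1)[of x] unfolding bundle_sum_def[of E "Iu \<union> Ic"] by (intro span_minimal UN_least)
    show "Eu x \<subseteq> bundle_sum E (Iu \<union> Ic) x" unfolding bundle_sum_def by (intro span_mono UN_mono) simp_all
  qed
  \<comment> \<open>The zero bundle contains no unit vector, so its estimates are vacuous and 1
    serves as lower bound.\<close>
  have dom0: "dominated J f A UNIV m \<gamma> (\<lambda>_. {0}) Eu"
  proof (rule dominatedI)
    show "closed_subspace J {0}" by (simp add: closed_subspace_def)
    show "{0} \<inter> Eu x = {0}" for x using subspace_0[OF d(1), of x] by blast
    show "closed_subspace J (Eu x)" for x by (rule d(3))
    show "A x v \<in> Eu (f x)" if "v \<in> Eu x" for x v by (rule d(5)[OF that])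
    show "hdim J (Eu x) = hdim J (Eu y)" for x y by (rule d(8))
    show "(0::real) < 1" by simp
  qed simp_all
  show ?thesis
    unfolding partially_hyperbolic_def
  proof (intro exI conjI)
    show "extended_oseledets_ruelle J f M A k G E" by (rule ext)
    show "{} \<union> (Iu \<union> Ic) \<union> Is = {..<k}" using I_union by simp
    show "(Iu \<union> Ic) \<inter> Is = {}" by (simp add: Int_Un_distrib2 I_disjoint)
    show "(\<lambda>_. {0}) = bundle_sum E {}" by (rule HOL.ext) (simp add: bundle_sum_def)
    show "Eu = bundle_sum E (Iu \<union> Ic)" by (rule HOL.ext) (rule Eu[symmetric])
    show "0 \<in> exponents J f M A \<longrightarrow> 0 \<in> \<Union> (G ` (Iu \<union> Ic))"
      unfolding image_Un Union_Un_distrib by (intro impI UnI2 center)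
    show "\<forall>\<kappa>\<in>\<Union> (G ` Is). \<kappa> < 0" by (rule ballI) (rule stable)
    show "-\<infinity> \<in> \<Union> (G ` Is)" by (rule kernel)
    show "dominated J f A UNIV m \<gamma> (\<lambda>_. {0}) Eu" by (rule dom0)
    show "dominated J f A UNIV m \<gamma> Eu Es" by (rule dom)
  qed (use \<gamma> in simp_all)
qed

section \<open>The case of a nonzero center bundle\<close>

lemma center_unstable_splittingI:
  assumes f: "continuous_on UNIV f" and X: "compact (UNIV :: 'x set)" and c: "\<And>x. Ec x \<noteq> {0}"
  shows "center_unstable_splitting J f M A Eu Ec Es (\<lambda>x. \<Sum>i\<in>Iu. P i x) (\<lambda>x. \<Sum>i\<in>Ic. P i x) (\<lambda>x. \<Sum>i\<in>Is. P i x)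
    {\<kappa>. ereal \<kappa> \<in> \<Union> (G ` Iu)} {\<kappa>. ereal \<kappa> \<in> \<Union> (G ` Ic)} {\<kappa>. ereal \<kappa> \<in> \<Union> (G ` Is)} l \<alpha> \<beta>"
proof (rule center_unstable_splitting.intro)
  have cont: "continuous_on UNIV (\<lambda>x. (\<Sum>i\<in>I. P i x) v)" if "I \<subseteq> {..<k}" for I v
    unfolding blinfun.sum_left using that by (intro continuous_on_sum P_cont) auto
  show "continuous_on UNIV (\<lambda>x. (\<Sum>i\<in>Iu. P i x) v)" "continuous_on UNIV (\<lambda>x. (\<Sum>i\<in>Ic. P i x) v)"
    "continuous_on UNIV (\<lambda>x. (\<Sum>i\<in>Is. P i x) v)" for v
    by (rule cont[OF I_subset(1)] cont[OF I_subset(2)] cont[OF I_subset(3)])+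
  show "(\<Sum>i\<in>Iu. P i x) v + (\<Sum>i\<in>Ic. P i x) v + (\<Sum>i\<in>Is. P i x) v = v" for x v
  proof -
    have "v = (\<Sum>i\<in>Iu \<union> Ic \<union> Is. P i x v)" unfolding I_union by (rule P_sum[symmetric])
    also have "\<dots> = (\<Sum>i\<in>Iu \<union> Ic. P i x v) + (\<Sum>i\<in>Is. P i x v)"
      by (rule sum.union_disjoint) (use I_finite I_disjoint in auto)
    also have "(\<Sum>i\<in>Iu \<union> Ic. P i x v) = (\<Sum>i\<in>Iu. P i x v) + (\<Sum>i\<in>Ic. P i x v)"
      by (rule sum.union_disjoint[OF I_finite(1,2) I_disjoint(1)])
    finally show ?thesis by (simp add: blinfun.sum_left)
  qed
  note pv = projection_vanishes
  show "v \<in> Eu x \<Longrightarrow> (\<Sum>i\<in>Ic. P i x) v = 0" for v x by (rule pv[OF I_subset(1,2)]) (use I_disjoint in auto)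
  show "v \<in> Eu x \<Longrightarrow> (\<Sum>i\<in>Is. P i x) v = 0" for v x by (rule pv[OF I_subset(1,3)]) (use I_disjoint in auto)
  show "v \<in> Ec x \<Longrightarrow> (\<Sum>i\<in>Iu. P i x) v = 0" for v x by (rule pv[OF I_subset(2,1)]) (use I_disjoint in auto)
  show "v \<in> Ec x \<Longrightarrow> (\<Sum>i\<in>Is. P i x) v = 0" for v x by (rule pv[OF I_subset(2,3)]) (use I_disjoint in auto)
  show "v \<in> Es x \<Longrightarrow> (\<Sum>i\<in>Iu. P i x) v = 0" for v x by (rule pv[OF I_subset(3,1)]) (use I_disjoint in auto)
  show "v \<in> Es x \<Longrightarrow> (\<Sum>i\<in>Ic. P i x) v = 0" for v x by (rule pv[OF I_subset(3,2)]) (use I_disjoint in auto)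
  \<comment> \<open>Minus infinity belongs to a stable group and groups are disjoint, so the
    unstable and center groups consist of real exponents.\<close>
  have ker: "-\<infinity> \<notin> G i" if "i \<in> Iu \<union> Ic" for i
  proof
    assume "-\<infinity> \<in> G i"
    moreover obtain j where j: "j \<in> Is" "-\<infinity> \<in> G j" using kernel by blast
    moreover have "i < k" using that I_less(1,2) by blast
    ultimately have "i = j" using group_eq[of i j] I_less(3)[of j] by blast
    then show False using that j(1) I_disjoint by blast
  qed
  have real: "\<Union> (G ` I) = ereal ` {\<kappa>. ereal \<kappa> \<in> \<Union> (G ` I)}" if I: "I \<subseteq> Iu \<union> Ic" for I
  proof (intro set_eqI iffI)
    fix p assume p: "p \<in> \<Union> (G ` I)"
    then obtain i where i: "i \<in> I" "p \<in> G i" by blast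
    have "p \<noteq> -\<infinity>" using ker[of i] i I by auto
    moreover have "i < k" using i(1) I I_less(1,2) by blast
    ultimately obtain r where "p = ereal r" using group_exponent[of i p] i(2) by blast
    then show "p \<in> ereal ` {\<kappa>. ereal \<kappa> \<in> \<Union> (G ` I)}" using p by blast
  qed blast
  have real_s: "\<Union> (G ` Is) = insert (-\<infinity>) (ereal ` {\<kappa>. ereal \<kappa> \<in> \<Union> (G ` Is)})"
  proof (intro set_eqI iffI)
    fix p assume p: "p \<in> \<Union> (G ` Is)"
    then obtain i where i: "i \<in> Is" "p \<in> G i" by blast
    have "p = -\<infinity> \<or> (\<exists>r. p = ereal r)" using group_exponent[OF I_less(3)[OF i(1)] i(2)] by blast
    then show "p \<in> insert (-\<infinity>) (ereal ` {\<kappa>. ereal \<kappa> \<in> \<Union> (G ` Is)})" using p by blast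
  qed (use kernel in blast)
  show "exponents J f M A = {\<kappa>. ereal \<kappa> \<in> \<Union> (G ` Iu)} \<union> {\<kappa>. ereal \<kappa> \<in> \<Union> (G ` Ic)} \<union> {\<kappa>. ereal \<kappa> \<in> \<Union> (G ` Is)}"
  proof (intro set_eqI)
    fix \<kappa>
    have "\<kappa> \<in> exponents J f M A \<longleftrightarrow> ereal \<kappa> \<in> insert (-\<infinity>) (ereal ` exponents J f M A)" by auto
    also have "\<dots> \<longleftrightarrow> ereal \<kappa> \<in> \<Union> (G ` (Iu \<union> Ic \<union> Is))" unfolding I_union ext_groups[OF ext] ..
    finally show "\<kappa> \<in> exponents J f M A \<longleftrightarrow>
        \<kappa> \<in> {\<kappa>. ereal \<kappa> \<in> \<Union> (G ` Iu)} \<union> {\<kappa>. ereal \<kappa> \<in> \<Union> (G ` Ic)} \<union> {\<kappa>. ereal \<kappa> \<in> \<Union> (G ` Is)}" by simp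
  qed
  have disj: "{\<kappa>. ereal \<kappa> \<in> \<Union> (G ` I)} \<inter> {\<kappa>. ereal \<kappa> \<in> \<Union> (G ` K)} = {}"
    if "I \<subseteq> {..<k}" "K \<subseteq> {..<k}" "I \<inter> K = {}" for I K
  proof (rule equals0I)
    fix \<kappa> assume "\<kappa> \<in> {\<kappa>. ereal \<kappa> \<in> \<Union> (G ` I)} \<inter> {\<kappa>. ereal \<kappa> \<in> \<Union> (G ` K)}"
    then obtain i j where ij: "i \<in> I" "ereal \<kappa> \<in> G i" "j \<in> K" "ereal \<kappa> \<in> G j" by blast
    then have "i = j" using that(1,2) by (intro group_eq[of i j "ereal \<kappa>"]) auto
    then show False using ij that(3) by blast
  qed
  show "{\<kappa>. ereal \<kappa> \<in> \<Union> (G ` Iu)} \<inter> {\<kappa>. ereal \<kappa> \<in> \<Union> (G ` Ic)} = {}" by (rule disj[OF I_subset(1,2) I_disjoint(1)])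
  show "{\<kappa>. ereal \<kappa> \<in> \<Union> (G ` Iu)} \<inter> {\<kappa>. ereal \<kappa> \<in> \<Union> (G ` Is)} = {}" by (rule disj[OF I_subset(1,3) I_disjoint(2)])
  show "{\<kappa>. ereal \<kappa> \<in> \<Union> (G ` Ic)} \<inter> {\<kappa>. ereal \<kappa> \<in> \<Union> (G ` Is)} = {}" by (rule disj[OF I_subset(2,3) I_disjoint(3)])
  show "0 < \<kappa>" if "\<kappa> \<in> {\<kappa>. ereal \<kappa> \<in> \<Union> (G ` Iu)}" for \<kappa> using unstable[of "ereal \<kappa>"] that by simp
  show "\<kappa> < 0" if "\<kappa> \<in> {\<kappa>. ereal \<kappa> \<in> \<Union> (G ` Is)}" for \<kappa> using stable[of "ereal \<kappa>"] that by simp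
  show "Eu x = closure (span (\<Union>\<kappa>\<in>ereal ` {\<kappa>. ereal \<kappa> \<in> \<Union> (G ` Iu)}. oseledets f A x \<kappa>))" if "x \<in> points" for x
    unfolding real[OF Un_upper1, symmetric] by (rule bundle_closure[OF that I_subset(1)])
  show "Ec x = closure (span (\<Union>\<kappa>\<in>ereal ` {\<kappa>. ereal \<kappa> \<in> \<Union> (G ` Ic)}. oseledets f A x \<kappa>))" if "x \<in> points" for x
    unfolding real[OF Un_upper2, symmetric] by (rule bundle_closure[OF that I_subset(2)])
  show "Es x = closure (span (\<Union>\<kappa>\<in>insert (-\<infinity>) (ereal ` {\<kappa>. ereal \<kappa> \<in> \<Union> (G ` Is)}). oseledets f A x \<kappa>))" if "x \<in> points" for x
    unfolding real_s[symmetric] by (rule bundle_closure[OF that I_subset(3)])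
qed (rule J sets_M prob_M f X A projection_sum I_subset dom_uc dom_cs \<alpha> \<beta> nonzero c ext_AE[OF ext])+

end

section \<open>Assembling the theorem\<close>

lemma partially_hyperbolic_groups_exist:
  fixes A :: "'x::t2_space \<Rightarrow> 'h::{real_inner, banach} \<Rightarrow>\<^sub>L 'h"
  assumes J: "hilbert_scalars J" and M: "sets M = sets borel" "prob_space M"
    and pos: "\<And>U. open U \<Longrightarrow> U \<noteq> {} \<Longrightarrow> 0 < emeasure M U" and A: "A \<in> C0I J M"
    and ph: "partially_hyperbolic J f M A Eu Ec Es" and nz: "\<And>x. Eu x \<noteq> {0}"
  obtains k G E Iu Ic Is l \<alpha> \<beta> P where "partially_hyperbolic_groups J f M A k G E Iu Ic Is l \<alpha> \<beta> P"
    "Eu = bundle_sum E Iu" "Ec = bundle_sum E Ic" "Es = bundle_sum E Is"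
proof -
  obtain k G E Iu Ic Is l \<alpha> \<beta> where ph:
      "extended_oseledets_ruelle J f M A k G E" "Iu \<union> Ic \<union> Is = {..<k}" "Iu \<inter> Ic = {}" "Iu \<inter> Is = {}" "Ic \<inter> Is = {}"
      "Eu = bundle_sum E Iu" "Ec = bundle_sum E Ic" "Es = bundle_sum E Is"
      "\<forall>\<kappa>\<in>(\<Union>i\<in>Iu. G i). 0 < \<kappa>" "0 \<in> exponents J f M A \<longrightarrow> 0 \<in> (\<Union>i\<in>Ic. G i)"
      "\<forall>\<kappa>\<in>(\<Union>i\<in>Is. G i). \<kappa> < 0" "-\<infinity> \<in> (\<Union>i\<in>Is. G i)" "0 < \<alpha>" "\<alpha> < 1" "0 < \<beta>" "\<beta> < 1"
      "dominated J f A UNIV l \<alpha> Eu Ec" "dominated J f A UNIV l \<beta> Ec Es"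
    using ph unfolding partially_hyperbolic_def by (elim exE conjE) (rule that; assumption)
  \<comment> \<open>An unstable group exists since \<open>Eu\<close> is nonzero, a stable one since
    it has to hold minus infinity. So there are at least two groups, as
    \<open>ext_orthogonal_splitting\<close> requires.\<close>
  have "Iu \<noteq> {}"
  proof
    assume "Iu = {}"
    then have "Eu undefined = {0}" by (simp add: ph(6) bundle_sum_def)
    then show False using nz by blast
  qed
  then obtain i where i: "i \<in> Iu" by blast
  obtain j where j: "j \<in> Is" using ph(12) by blast
  have "i \<noteq> j" "i < k" "j < k" using i j ph(2,4) by auto
  then have k2: "k \<ge> 2" by linarith
  obtain P where P: "\<And>i v. i < k \<Longrightarrow> continuous_on UNIV (\<lambda>x. blinfun_apply (P i x) v)" "\<And>i. i < k \<Longrightarrow> bundle_projection f A (E i) (P i)"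
    "\<And>x v. (\<Sum>i<k. blinfun_apply (P i x) v) = v"
    "\<And>i j x u v. i < k \<Longrightarrow> j < k \<Longrightarrow> i \<noteq> j \<Longrightarrow> u \<in> E i x \<Longrightarrow> v \<in> E j x \<Longrightarrow> u \<bullet> v = 0"
    by (rule ext_orthogonal_splitting[OF ph(1) M(1) pos k2]) blast+
  have "partially_hyperbolic_groups J f M A k G E Iu Ic Is l \<alpha> \<beta> P"
    by (rule partially_hyperbolic_groups.intro[OF J M A ph(1-5) bspec[OF ph(9)] mp[OF ph(10)] bspec[OF ph(11)] ph(12-16)
          ph(17,18)[unfolded ph(6-8)] nz[unfolded ph(6)] P])
  then show ?thesis using ph(6-8) by (rule that)
qed

theorem theorem1:
  fixes J :: "'h::{real_inner, banach} \<Rightarrow>\<^sub>L 'h"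
    and f :: "'x::t2_space \<Rightarrow> 'x"
    and M :: "'x measure"
    and A :: "'x \<Rightarrow> 'h \<Rightarrow>\<^sub>L 'h"
    and Eu Ec Es :: "'x \<Rightarrow> 'h set"
    and \<epsilon> :: real
  assumes "hilbert_scalars J"
    and "separable_space (euclidean :: 'h topology)"
    and "\<not> finite_dim (UNIV :: 'h set)"
    and "compact (UNIV :: 'x set)"
    and "\<exists>g. homeomorphism UNIV UNIV f g"
    and "ergodic_base f M"
    and "\<And>U. open U \<Longrightarrow> U \<noteq> {} \<Longrightarrow> 0 < emeasure M U"
    and "A \<in> C0I J M"
    and "partially_hyperbolic J f M A Eu Ec Es"
    and "\<And>x. Eu x \<noteq> {0}"
    and "exponent_sum J f M A Ec = 0"
    and "0 < \<epsilon>"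
  shows "\<exists>B Eu' Ec' Es'. B \<in> C0I J M \<and>
    partially_hyperbolic J f M B Eu' Ec' Es' \<and> continuation J Eu Ec Eu' Ec' \<and>
    C0_norm (\<lambda>x. A x - B x) \<le> \<epsilon> \<and>
    center_unstable_entropy J f M B Eu' Ec' = center_unstable_entropy J f M A Eu Ec \<and>
    0 < exponent_sum J f M B Ec'"
proof -
  have M: "sets M = sets borel" "prob_space M" using assms(6) by (simp_all add: ergodic_base_def)
  obtain k G E Iu Ic Is l \<alpha> \<beta> P where gr: "partially_hyperbolic_groups J f M A k G E Iu Ic Is l \<alpha> \<beta> P"
    and eq: "Eu = bundle_sum E Iu" "Ec = bundle_sum E Ic" "Es = bundle_sum E Is"
    using partially_hyperbolic_groups_exist[OF assms(1) M assms(7-10)] by metis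
  interpret H: partially_hyperbolic_groups J f M A k G E Iu Ic Is l \<alpha> \<beta> P by (rule gr)
  show ?thesis
  proof (cases "\<exists>x. Ec x \<noteq> {0}")
    case True
    then obtain x where x: "Ec x \<noteq> {0}" by blast
    \<comment> \<open>The center bundle has constant dimension, so it is nonzero everywhere if it is
      nonzero somewhere.\<close>
    have c: "Ec y \<noteq> {0}" for y
    proof
      note d = dominatedD[OF H.dom_uc, folded eq(1,2)]
      assume "Ec y = {0}"
      then have "hdim J (Ec x) = 0" using d(9)[of x y] by simp
      moreover have "J v \<in> Ec x" if "v \<in> Ec x" for v using d(4)[of x] that by (simp add: closed_subspace_def)
      ultimately show False using hdim_eq_0[OF H.J d(2)] x by blast
    qed
    have f: "continuous_on UNIV f" using assms(5) by (auto simp: homeomorphism_def)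
    interpret C: center_unstable_splitting J f M A Eu Ec Es "\<lambda>x. \<Sum>i\<in>Iu. P i x" "\<lambda>x. \<Sum>i\<in>Ic. P i x" "\<lambda>x. \<Sum>i\<in>Is. P i x"
      "{\<kappa>. ereal \<kappa> \<in> \<Union> (G ` Iu)}" "{\<kappa>. ereal \<kappa> \<in> \<Union> (G ` Ic)}" "{\<kappa>. ereal \<kappa> \<in> \<Union> (G ` Is)}" l \<alpha> \<beta>
      using H.center_unstable_splittingI[OF f assms(4) c[unfolded eq(2)]] unfolding eq .
    obtain B where "B \<in> C0I J M" "partially_hyperbolic J f M B Eu Ec Es" "C0_norm (\<lambda>x. A x - B x) \<le> \<epsilon>"
      "center_unstable_entropy J f M B Eu Ec = center_unstable_entropy J f M A Eu Ec" "0 < exponent_sum J f M B Ec"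
      using C.perturbation_exists[OF assms(11,12)] by blast
    moreover have "continuation J Eu Ec Eu Ec" by (simp add: continuation_def)
    ultimately show ?thesis by blast
  next
    case False
    then have c: "Ec x = {0}" for x by blast
    note c' = c[unfolded eq(2)]
    have "partially_hyperbolic J f M A (\<lambda>_. {0}) Eu Es" unfolding eq by (rule H.regrouped[OF c'])
    moreover have "continuation J Eu Ec (\<lambda>_. {0}) Eu" by (simp add: continuation_def c)
    moreover have "C0_norm (\<lambda>x. A x - A x) \<le> \<epsilon>" using assms(12) by (simp add: C0_norm_def)
    \<comment> \<open>Both entropies use the same span, that of the unstable bundle together with
      zero.\<close>
    moreover have "center_unstable_entropy J f M A (\<lambda>_. {0}) Eu = center_unstable_entropy J f M A Eu Ec"
      by (simp add: center_unstable_entropy_def c)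
    moreover have "0 < exponent_sum J f M A Eu" unfolding eq by (rule H.exponent_sum_unstable_pos[OF c'])
    ultimately show ?thesis using assms(8) by blast
  qed
qed

end
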